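(* Let $M$ be a connected three-dimensional non-Riemannian Finsler manifold, with averaged Riemannian metric $\gamma$, admitting a linear connection that is compatible to the Finsler metric, is flat (has zero curvature) and has totally anti-symmetric torsion tensor. Then one of the following holds: (i) $M$ is a classical Berwald manifold of constant zero sectional curvature with respect to $\gamma$; or (ii) $M$ is a proper generalized Berwald manifold of constant positive sectional curvature with respect to $\gamma$.
   Context: Finsler metric: a continuous function $F\colon TM\to[0,\infty)$, smooth off the zero section, with $F(tv)=tF(v)$ for $t>0$, such that with $E=\frac12F^2$ the Hessian $g_{ij}=\frac{\partial^2E}{\partial y^i\partial y^j}$ is positive definite at every nonzero tangent vector; $y^i(v)=v(u^i)$ are the induced fibre coordinates on $TM$ for local coordinates $u^i$ on $M$. The Finsler manifold is Riemannian if $F^2$ is quadratic on every tangent space; otherwise it is non-Riemannian. The indicatrix at $p$ is $\partial K_p=F^{-1}(1)\cap T_pM$, with induced volume form $\mu=\sqrt{\det g_{ij}}\,\sum_{i=1}^3(-1)^{i-1}\frac{y^i}{F}\,dy^1\wedge\ldots\wedge\widehat{dy^i}\wedge\ldots\wedge dy^3$ (hat means omission; $\partial K_p$ is oriented so that $\mu$ is positive). The averaged Riemannian metric is $\gamma_p(v,w)=v^iw^j\int_{\partial K_p}g_{ij}\,\mu$ for $v,w\in T_pM$. A linear connection $\nabla$ on $M$ is compatible to $F$ if its parallel transports preserve the Finslerian length $F$ of tangent vectors. A generalized Berwald manifold is a Finsler manifold admitting a compatible linear connection; a classical Berwald manifold is one admitting a compatible linear connection with zero torsion; a proper generalized Berwald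 manifold is a generalized Berwald manifold that is not a classical Berwald manifold. The torsion $T$ of $\nabla$ is totally anti-symmetric if $T_\flat(X,Y,Z)=\gamma(T(X,Y),Z)$ is a 3-form. *)

theory Defs
  imports "HOL-Analysis.Analysis"
begin

section \<open>Smooth maps between Euclidean spaces\<close>

(* Used for open sets S only. *)
fun Ck_on :: "nat \<Rightarrow> 'a::real_normed_vector set \<Rightarrow> ('a \<Rightarrow> 'b::real_normed_vector) \<Rightarrow> bool" where
  "Ck_on 0 S f \<longleftrightarrow> continuous_on S f"
| "Ck_on (Suc k) S f \<longleftrightarrow>
     (\<forall>x\<in>S. f differentiable (at x)) \<and> (\<forall>v. Ck_on k S (\<lambda>x. frechet_derivative f (at x) v))"

definition smooth_on :: "'a::real_normed_vector set \<Rightarrow> ('a \<Rightarrow> 'b::real_normed_vector) \<Rightarrow> bool" where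
  "smooth_on S f \<longleftrightarrow> (\<forall>k. Ck_on k S f)"

definition partial :: "'n::finite \<Rightarrow> (real^'n \<Rightarrow> real) \<Rightarrow> real^'n \<Rightarrow> real" where
  "partial i f y = frechet_derivative f (at y) (axis i 1)"

section \<open>Smooth manifolds\<close>

record ('a, 'n::finite) chart =
  cdom :: "'a set"
  cmap :: "'a \<Rightarrow> real^'n"

record ('a, 'n::finite) manifold =
  mtop :: "'a topology"
  atlas :: "('a, 'n) chart set"

definition cinv :: "('a, 'n::finite) chart \<Rightarrow> real^'n \<Rightarrow> 'a" where
  "cinv c = inv_into (cdom c) (cmap c)"

definition transition :: "('a, 'n::finite) chart \<Rightarrow> ('a, 'n) chart \<Rightarrow> real^'n \<Rightarrow> real^'n" where
  "transition c d = cmap d \<circ> cinv c"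

(* The atlas is not required to be maximal. *)
definition smooth_manifold :: "('a, 'n::finite) manifold \<Rightarrow> bool" where
  "smooth_manifold M \<longleftrightarrow>
     Hausdorff_space (mtop M) \<and> second_countable (mtop M) \<and>
     (\<Union>c\<in>atlas M. cdom c) = topspace (mtop M) \<and>
     (\<forall>c\<in>atlas M. openin (mtop M) (cdom c) \<and> open (cmap c ` cdom c) \<and>
        homeomorphic_map (subtopology (mtop M) (cdom c)) (top_of_set (cmap c ` cdom c)) (cmap c)) \<and>
     (\<forall>c\<in>atlas M. \<forall>d\<in>atlas M. smooth_on (cmap c ` (cdom c \<inter> cdom d)) (transition c d))"

definition charts_at :: "('a, 'n::finite) manifold \<Rightarrow> 'a \<Rightarrow> ('a, 'n) chart set" where
  "charts_at M p = {c \<in> atlas M. p \<in> cdom c}"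

(* An arbitrary chart around p, for notions that do not depend on the choice of the chart. *)
definition chart_at :: "('a, 'n::finite) manifold \<Rightarrow> 'a \<Rightarrow> ('a, 'n) chart" where
  "chart_at M p = (SOME c. c \<in> charts_at M p)"

definition smooth_fun :: "('a, 'n::finite) manifold \<Rightarrow> 'a set \<Rightarrow> ('a \<Rightarrow> real) \<Rightarrow> bool" where
  "smooth_fun M W f \<longleftrightarrow> (\<forall>c\<in>atlas M. smooth_on (cmap c ` (W \<inter> cdom c)) (f \<circ> cinv c))"

section \<open>Tangent vectors and vector fields\<close>

(* A tangent vector v at p is the family of its coordinate tuples: the i-th component of v c is
   v(u^i) for the coordinates u of the chart c, and different charts around p are related by the
   Jacobian of the coordinate change.  Charts that do not contain p carry the dummy value 0. *)
type_synonym ('a, 'n) tvec = "('a, 'n) chart \<Rightarrow> real^'n"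

definition tangent_space :: "('a, 'n::finite) manifold \<Rightarrow> 'a \<Rightarrow> ('a, 'n) tvec set" where
  "tangent_space M p =
     {v. (\<forall>c\<in>charts_at M p. \<forall>d\<in>charts_at M p.
            v d = frechet_derivative (transition c d) (at (cmap c p)) (v c)) \<and>
         (\<forall>c. c \<notin> charts_at M p \<longrightarrow> v c = 0)}"

definition tzero :: "('a, 'n::finite) tvec" where
  "tzero = (\<lambda>c. 0)"

definition tadd :: "('a, 'n::finite) tvec \<Rightarrow> ('a, 'n) tvec \<Rightarrow> ('a, 'n) tvec" where
  "tadd v w = (\<lambda>c. v c + w c)"

definition tdiff :: "('a, 'n::finite) tvec \<Rightarrow> ('a, 'n) tvec \<Rightarrow> ('a, 'n) tvec" where
  "tdiff v w = (\<lambda>c. v c - w c)"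

definition tscale :: "real \<Rightarrow> ('a, 'n::finite) tvec \<Rightarrow> ('a, 'n) tvec" where
  "tscale a v = (\<lambda>c. a *\<^sub>R v c)"

(* The tangent vector at p whose coordinate tuple in the chart c around p is y. *)
definition tvec_of :: "('a, 'n::finite) manifold \<Rightarrow> ('a, 'n) chart \<Rightarrow> 'a \<Rightarrow> real^'n \<Rightarrow> ('a, 'n) tvec" where
  "tvec_of M c p y =
     (\<lambda>d. if d \<in> charts_at M p
          then frechet_derivative (transition c d) (at (cmap c p)) y else 0)"

definition coord_field :: "('a, 'n::finite) manifold \<Rightarrow> ('a, 'n) chart \<Rightarrow> 'n \<Rightarrow> 'a \<Rightarrow> ('a, 'n) tvec" where
  "coord_field M c i p = tvec_of M c p (axis i 1)"

(* Only the values on W matter; W is an open set. *)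
definition smooth_field :: "('a, 'n::finite) manifold \<Rightarrow> 'a set \<Rightarrow> ('a \<Rightarrow> ('a, 'n) tvec) \<Rightarrow> bool" where
  "smooth_field M W X \<longleftrightarrow>
     (\<forall>p\<in>W. X p \<in> tangent_space M p) \<and>
     (\<forall>c\<in>atlas M. smooth_on (cmap c ` (W \<inter> cdom c)) (\<lambda>x. X (cinv c x) c))"

definition vec_deriv :: "('a, 'n::finite) manifold \<Rightarrow> 'a \<Rightarrow> ('a, 'n) tvec \<Rightarrow> ('a \<Rightarrow> real) \<Rightarrow> real" where
  "vec_deriv M p v f =
     (let c = chart_at M p in frechet_derivative (f \<circ> cinv c) (at (cmap c p)) (v c))"

definition lie_bracket ::
  "('a, 'n::finite) manifold \<Rightarrow> ('a \<Rightarrow> ('a, 'n) tvec) \<Rightarrow> ('a \<Rightarrow> ('a, 'n) tvec) \<Rightarrow> 'a \<Rightarrow> ('a, 'n) tvec" where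
  "lie_bracket M X Y p =
     (\<lambda>c. if c \<in> charts_at M p
          then frechet_derivative (\<lambda>x. Y (cinv c x) c) (at (cmap c p)) (X p c)
             - frechet_derivative (\<lambda>x. X (cinv c x) c) (at (cmap c p)) (Y p c)
          else 0)"

section \<open>Linear connections\<close>

(* D p v Y is the covariant derivative at p of the vector field Y in the direction v; it is
   governed by the axioms whenever Y is smooth on some open neighbourhood W of p.  Locality
   follows from the Leibniz rule, since f need only be smooth on W. *)
type_synonym ('a, 'n) connection =
  "'a \<Rightarrow> ('a, 'n) tvec \<Rightarrow> ('a \<Rightarrow> ('a, 'n) tvec) \<Rightarrow> ('a, 'n) tvec"

definition linear_connection :: "('a, 'n::finite) manifold \<Rightarrow> ('a, 'n) connection \<Rightarrow> bool" where
  "linear_connection M D \<longleftrightarrow>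
     (\<forall>W X Y. openin (mtop M) W \<and> smooth_field M W X \<and> smooth_field M W Y \<longrightarrow>
        smooth_field M W (\<lambda>p. D p (X p) Y)) \<and>
     (\<forall>W Y p v w a. openin (mtop M) W \<and> smooth_field M W Y \<and> p \<in> W \<and>
        v \<in> tangent_space M p \<and> w \<in> tangent_space M p \<longrightarrow>
        D p (tadd v w) Y = tadd (D p v Y) (D p w Y) \<and>
        D p (tscale a v) Y = tscale a (D p v Y)) \<and>
     (\<forall>W Y Z p v. openin (mtop M) W \<and> smooth_field M W Y \<and> smooth_field M W Z \<and> p \<in> W \<and>
        v \<in> tangent_space M p \<longrightarrow>
        D p v (\<lambda>q. tadd (Y q) (Z q)) = tadd (D p v Y) (D p v Z)) \<and>
     (\<forall>W Y f p v. openin (mtop M) W \<and> smooth_field M W Y \<and> smooth_fun M W f \<and> p \<in> W \<and>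
        v \<in> tangent_space M p \<longrightarrow>
        D p v (\<lambda>q. tscale (f q) (Y q)) =
          tadd (tscale (vec_deriv M p v f) (Y p)) (tscale (f p) (D p v Y)))"

definition torsion ::
  "('a, 'n::finite) manifold \<Rightarrow> ('a, 'n) connection \<Rightarrow>
     ('a \<Rightarrow> ('a, 'n) tvec) \<Rightarrow> ('a \<Rightarrow> ('a, 'n) tvec) \<Rightarrow> 'a \<Rightarrow> ('a, 'n) tvec" where
  "torsion M D X Y p = tdiff (tdiff (D p (X p) Y) (D p (Y p) X)) (lie_bracket M X Y p)"

definition curvature ::
  "('a, 'n::finite) manifold \<Rightarrow> ('a, 'n) connection \<Rightarrow> ('a \<Rightarrow> ('a, 'n) tvec) \<Rightarrow>
     ('a \<Rightarrow> ('a, 'n) tvec) \<Rightarrow> ('a \<Rightarrow> ('a, 'n) tvec) \<Rightarrow> 'a \<Rightarrow> ('a, 'n) tvec" where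
  "curvature M D X Y Z p =
     tdiff (tdiff (D p (X p) (\<lambda>q. D q (Y q) Z)) (D p (Y p) (\<lambda>q. D q (X q) Z)))
       (D p (lie_bracket M X Y p) Z)"

definition torsion_free :: "('a, 'n::finite) manifold \<Rightarrow> ('a, 'n) connection \<Rightarrow> bool" where
  "torsion_free M D \<longleftrightarrow>
     (\<forall>W X Y p. openin (mtop M) W \<and> smooth_field M W X \<and> smooth_field M W Y \<and> p \<in> W \<longrightarrow>
        torsion M D X Y p = tzero)"

definition flat :: "('a, 'n::finite) manifold \<Rightarrow> ('a, 'n) connection \<Rightarrow> bool" where
  "flat M D \<longleftrightarrow>
     (\<forall>W X Y Z p. openin (mtop M) W \<and> smooth_field M W X \<and> smooth_field M W Y \<and>
        smooth_field M W Z \<and> p \<in> W \<longrightarrow> curvature M D X Y Z p = tzero)"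

section \<open>Parallel transport\<close>

(* Curves are parametrised by open intervals J, so every smooth arc on a compact interval is a
   restriction of such a curve. *)
definition smooth_curve :: "('a, 'n::finite) manifold \<Rightarrow> real set \<Rightarrow> (real \<Rightarrow> 'a) \<Rightarrow> bool" where
  "smooth_curve M J \<sigma> \<longleftrightarrow>
     open J \<and> is_interval J \<and> continuous_map (top_of_set J) (mtop M) \<sigma> \<and>
     (\<forall>c\<in>atlas M. smooth_on {t\<in>J. \<sigma> t \<in> cdom c} (cmap c \<circ> \<sigma>))"

definition christoffel ::
  "('a, 'n::finite) manifold \<Rightarrow> ('a, 'n) connection \<Rightarrow> ('a, 'n) chart \<Rightarrow> 'a \<Rightarrow> 'n \<Rightarrow> 'n \<Rightarrow> 'n \<Rightarrow> real" where
  "christoffel M D c p k i j = D p (coord_field M c i p) (coord_field M c j) c $ k"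

definition cov_deriv_along ::
  "('a, 'n::finite) manifold \<Rightarrow> ('a, 'n) connection \<Rightarrow> (real \<Rightarrow> 'a) \<Rightarrow> (real \<Rightarrow> ('a, 'n) tvec) \<Rightarrow>
     real \<Rightarrow> ('a, 'n) chart \<Rightarrow> real^'n" where
  "cov_deriv_along M D \<sigma> V t c =
     vector_derivative (\<lambda>s. V s c) (at t) +
     (\<chi> k. \<Sum>i\<in>UNIV. \<Sum>j\<in>UNIV. christoffel M D c (\<sigma> t) k i j *
        vector_derivative (cmap c \<circ> \<sigma>) (at t) $ i * V t c $ j)"

(* Differentiability suffices: solutions of this linear equation are automatically smooth. *)
definition parallel_along ::
  "('a, 'n::finite) manifold \<Rightarrow> ('a, 'n) connection \<Rightarrow> real set \<Rightarrow> (real \<Rightarrow> 'a) \<Rightarrow>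
     (real \<Rightarrow> ('a, 'n) tvec) \<Rightarrow> bool" where
  "parallel_along M D J \<sigma> V \<longleftrightarrow>
     (\<forall>t\<in>J. V t \<in> tangent_space M (\<sigma> t) \<and>
        (\<forall>c\<in>charts_at M (\<sigma> t).
           (\<lambda>s. V s c) differentiable (at t) \<and> cov_deriv_along M D \<sigma> V t c = 0))"

(* The graph of the parallel transport map from time a to time b along the curve. *)
definition parallel_transport ::
  "('a, 'n::finite) manifold \<Rightarrow> ('a, 'n) connection \<Rightarrow> real set \<Rightarrow> (real \<Rightarrow> 'a) \<Rightarrow> real \<Rightarrow> real \<Rightarrow>
     ('a, 'n) tvec \<Rightarrow> ('a, 'n) tvec \<Rightarrow> bool" where
  "parallel_transport M D J \<sigma> a b v w \<longleftrightarrow> (\<exists>V. parallel_along M D J \<sigma> V \<and> V a = v \<and> V b = w)"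

section \<open>Riemannian metrics and sectional curvature\<close>

definition sym_bilinear_at ::
  "('a, 'n::finite) manifold \<Rightarrow> 'a \<Rightarrow> (('a, 'n) tvec \<Rightarrow> ('a, 'n) tvec \<Rightarrow> real) \<Rightarrow> bool" where
  "sym_bilinear_at M p B \<longleftrightarrow>
     (\<forall>u\<in>tangent_space M p. \<forall>v\<in>tangent_space M p. \<forall>w\<in>tangent_space M p. \<forall>a.
        B u v = B v u \<and> B (tadd u v) w = B u w + B v w \<and> B (tscale a u) v = a * B u v)"

definition riemannian_metric ::
  "('a, 'n::finite) manifold \<Rightarrow> ('a \<Rightarrow> ('a, 'n) tvec \<Rightarrow> ('a, 'n) tvec \<Rightarrow> real) \<Rightarrow> bool" where
  "riemannian_metric M \<gamma> \<longleftrightarrow>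
     (\<forall>p\<in>topspace (mtop M). sym_bilinear_at M p (\<gamma> p) \<and>
        (\<forall>v\<in>tangent_space M p. v \<noteq> tzero \<longrightarrow> \<gamma> p v v > 0)) \<and>
     (\<forall>W X Y. openin (mtop M) W \<and> smooth_field M W X \<and> smooth_field M W Y \<longrightarrow>
        smooth_fun M W (\<lambda>p. \<gamma> p (X p) (Y p)))"

definition levi_civita ::
  "('a, 'n::finite) manifold \<Rightarrow> ('a \<Rightarrow> ('a, 'n) tvec \<Rightarrow> ('a, 'n) tvec \<Rightarrow> real) \<Rightarrow>
     ('a, 'n) connection \<Rightarrow> bool" where
  "levi_civita M \<gamma> D \<longleftrightarrow>
     linear_connection M D \<and> torsion_free M D \<and>
     (\<forall>W Y Z p v. openin (mtop M) W \<and> smooth_field M W Y \<and> smooth_field M W Z \<and> p \<in> W \<and>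
        v \<in> tangent_space M p \<longrightarrow>
        vec_deriv M p v (\<lambda>q. \<gamma> q (Y q) (Z q)) = \<gamma> p (D p v Y) (Z p) + \<gamma> p (Y p) (D p v Z))"

definition tindependent :: "('a, 'n::finite) tvec \<Rightarrow> ('a, 'n) tvec \<Rightarrow> bool" where
  "tindependent v w \<longleftrightarrow> (\<forall>a b. tadd (tscale a v) (tscale b w) = tzero \<longrightarrow> a = 0 \<and> b = 0)"

(* Sectional curvature at p of the plane spanned by X p and Y p, for the Levi-Civita connection D. *)
definition sectional_curvature ::
  "('a, 'n::finite) manifold \<Rightarrow> ('a \<Rightarrow> ('a, 'n) tvec \<Rightarrow> ('a, 'n) tvec \<Rightarrow> real) \<Rightarrow>
     ('a, 'n) connection \<Rightarrow> ('a \<Rightarrow> ('a, 'n) tvec) \<Rightarrow> ('a \<Rightarrow> ('a, 'n) tvec) \<Rightarrow> 'a \<Rightarrow> real" where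
  "sectional_curvature M \<gamma> D X Y p =
     \<gamma> p (curvature M D X Y Y p) (X p) /
       (\<gamma> p (X p) (X p) * \<gamma> p (Y p) (Y p) - (\<gamma> p (X p) (Y p))\<^sup>2)"

definition constant_sectional_curvature ::
  "('a, 'n::finite) manifold \<Rightarrow> ('a \<Rightarrow> ('a, 'n) tvec \<Rightarrow> ('a, 'n) tvec \<Rightarrow> real) \<Rightarrow> real \<Rightarrow> bool" where
  "constant_sectional_curvature M \<gamma> \<kappa> \<longleftrightarrow>
     riemannian_metric M \<gamma> \<and>
     (\<exists>D. levi_civita M \<gamma> D \<and>
       (\<forall>W X Y p. openin (mtop M) W \<and> smooth_field M W X \<and> smooth_field M W Y \<and> p \<in> W \<and>
          tindependent (X p) (Y p) \<longrightarrow> sectional_curvature M \<gamma> D X Y p = \<kappa>))"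

section \<open>Finsler metrics\<close>

definition energy :: "('a \<Rightarrow> ('a, 'n::finite) tvec \<Rightarrow> real) \<Rightarrow> 'a \<Rightarrow> ('a, 'n) tvec \<Rightarrow> real" where
  "energy F p v = (F p v)\<^sup>2 / 2"

(* The matrix of the g_ij at the tangent vector at p with fibre coordinates y in the chart c. *)
definition fund_tensor ::
  "('a, 'n::finite) manifold \<Rightarrow> ('a \<Rightarrow> ('a, 'n) tvec \<Rightarrow> real) \<Rightarrow> ('a, 'n) chart \<Rightarrow> 'a \<Rightarrow> real^'n \<Rightarrow> real^'n^'n" where
  "fund_tensor M F c p y =
     (\<chi> i j. partial i (partial j (\<lambda>z. energy F p (tvec_of M c p z))) y)"

definition finsler_metric :: "('a, 'n::finite) manifold \<Rightarrow> ('a \<Rightarrow> ('a, 'n) tvec \<Rightarrow> real) \<Rightarrow> bool" where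
  "finsler_metric M F \<longleftrightarrow>
     (\<forall>p\<in>topspace (mtop M). \<forall>v\<in>tangent_space M p.
        F p v \<ge> 0 \<and> (\<forall>t>0. F p (tscale t v) = t * F p v)) \<and>
     (\<forall>c\<in>atlas M.
        continuous_on (cmap c ` cdom c \<times> UNIV)
          (\<lambda>(x, y). F (cinv c x) (tvec_of M c (cinv c x) y)) \<and>
        smooth_on (cmap c ` cdom c \<times> (UNIV - {0}))
          (\<lambda>(x, y). F (cinv c x) (tvec_of M c (cinv c x) y)) \<and>
        (\<forall>p\<in>cdom c. \<forall>y. y \<noteq> 0 \<longrightarrow>
           (\<forall>w. w \<noteq> 0 \<longrightarrow> w \<bullet> (fund_tensor M F c p y *v w) > 0)))"

definition is_riemannian :: "('a, 'n::finite) manifold \<Rightarrow> ('a \<Rightarrow> ('a, 'n) tvec \<Rightarrow> real) \<Rightarrow> bool" where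
  "is_riemannian M F \<longleftrightarrow>
     (\<forall>p\<in>topspace (mtop M). \<exists>B. sym_bilinear_at M p B \<and>
        (\<forall>v\<in>tangent_space M p. (F p v)\<^sup>2 = B v v))"

section \<open>The averaged Riemannian metric\<close>

(* The volume form of the indicatrix at p in the fibre coordinates of c, as an alternating
   2-form at the point y, evaluated on a and b. *)
definition indicatrix_form ::
  "('a, 3) manifold \<Rightarrow> ('a \<Rightarrow> ('a, 3) tvec \<Rightarrow> real) \<Rightarrow> ('a, 3) chart \<Rightarrow> 'a \<Rightarrow>
     real^3 \<Rightarrow> real^3 \<Rightarrow> real^3 \<Rightarrow> real" where
  "indicatrix_form M F c p y a b =
     sqrt (det (fund_tensor M F c p y)) *
       (y $ 1 / F p (tvec_of M c p y) * (a $ 2 * b $ 3 - a $ 3 * b $ 2)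
      - y $ 2 / F p (tvec_of M c p y) * (a $ 1 * b $ 3 - a $ 3 * b $ 1)
      + y $ 3 / F p (tvec_of M c p y) * (a $ 1 * b $ 2 - a $ 2 * b $ 1))"

definition sphere_param :: "real \<Rightarrow> real \<Rightarrow> real^3" where
  "sphere_param s t = vector [sin s * cos t, sin s * sin t, cos s]"

(* Radial projection of the spherical coordinates to the indicatrix; in the order (s, t) it is
   positively oriented with respect to the volume form above. *)
definition indicatrix_param ::
  "('a, 3) manifold \<Rightarrow> ('a \<Rightarrow> ('a, 3) tvec \<Rightarrow> real) \<Rightarrow> ('a, 3) chart \<Rightarrow> 'a \<Rightarrow> real \<Rightarrow> real \<Rightarrow> real^3" where
  "indicatrix_param M F c p s t =
     sphere_param s t /\<^sub>R F p (tvec_of M c p (sphere_param s t))"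

definition indicatrix_integral ::
  "('a, 3) manifold \<Rightarrow> ('a \<Rightarrow> ('a, 3) tvec \<Rightarrow> real) \<Rightarrow> ('a, 3) chart \<Rightarrow> 'a \<Rightarrow> (real^3 \<Rightarrow> real) \<Rightarrow> real" where
  "indicatrix_integral M F c p h =
     integral ({0..pi} \<times> {0..2*pi})
       (\<lambda>(s, t). h (indicatrix_param M F c p s t) *
          indicatrix_form M F c p (indicatrix_param M F c p s t)
            (vector_derivative (\<lambda>s'. indicatrix_param M F c p s' t) (at s))
            (vector_derivative (\<lambda>t'. indicatrix_param M F c p s t') (at t)))"

definition averaged_metric ::
  "('a, 3) manifold \<Rightarrow> ('a \<Rightarrow> ('a, 3) tvec \<Rightarrow> real) \<Rightarrow> 'a \<Rightarrow> ('a, 3) tvec \<Rightarrow> ('a, 3) tvec \<Rightarrow> real" where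
  "averaged_metric M F p v w =
     (let c = chart_at M p in
        \<Sum>i\<in>UNIV. \<Sum>j\<in>UNIV. v c $ i * w c $ j *
          indicatrix_integral M F c p (\<lambda>y. fund_tensor M F c p y $ i $ j))"

section \<open>Generalized Berwald manifolds\<close>

definition compatible ::
  "('a, 'n::finite) manifold \<Rightarrow> ('a \<Rightarrow> ('a, 'n) tvec \<Rightarrow> real) \<Rightarrow> ('a, 'n) connection \<Rightarrow> bool" where
  "compatible M F D \<longleftrightarrow>
     (\<forall>J \<sigma> a b v w. smooth_curve M J \<sigma> \<and> a \<in> J \<and> b \<in> J \<and>
        parallel_transport M D J \<sigma> a b v w \<longrightarrow> F (\<sigma> b) w = F (\<sigma> a) v)"

definition generalized_berwald ::
  "('a, 'n::finite) manifold \<Rightarrow> ('a \<Rightarrow> ('a, 'n) tvec \<Rightarrow> real) \<Rightarrow> bool" where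
  "generalized_berwald M F \<longleftrightarrow>
     finsler_metric M F \<and> (\<exists>D. linear_connection M D \<and> compatible M F D)"

definition classical_berwald ::
  "('a, 'n::finite) manifold \<Rightarrow> ('a \<Rightarrow> ('a, 'n) tvec \<Rightarrow> real) \<Rightarrow> bool" where
  "classical_berwald M F \<longleftrightarrow>
     finsler_metric M F \<and> (\<exists>D. linear_connection M D \<and> compatible M F D \<and> torsion_free M D)"

definition proper_generalized_berwald ::
  "('a, 'n::finite) manifold \<Rightarrow> ('a \<Rightarrow> ('a, 'n) tvec \<Rightarrow> real) \<Rightarrow> bool" where
  "proper_generalized_berwald M F \<longleftrightarrow> generalized_berwald M F \<and> \<not> classical_berwald M F"

definition lowered_torsion ::
  "('a, 'n::finite) manifold \<Rightarrow> ('a \<Rightarrow> ('a, 'n) tvec \<Rightarrow> ('a, 'n) tvec \<Rightarrow> real) \<Rightarrow>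
     ('a, 'n) connection \<Rightarrow> ('a \<Rightarrow> ('a, 'n) tvec) \<Rightarrow> ('a \<Rightarrow> ('a, 'n) tvec) \<Rightarrow>
     ('a \<Rightarrow> ('a, 'n) tvec) \<Rightarrow> 'a \<Rightarrow> real" where
  "lowered_torsion M \<gamma> D X Y Z p = \<gamma> p (torsion M D X Y p) (Z p)"

(* The lowered torsion is a smooth tensor in any case, so being a 3-form means being alternating. *)
definition totally_antisymmetric_torsion ::
  "('a, 'n::finite) manifold \<Rightarrow> ('a \<Rightarrow> ('a, 'n) tvec \<Rightarrow> ('a, 'n) tvec \<Rightarrow> real) \<Rightarrow>
     ('a, 'n) connection \<Rightarrow> bool" where
  "totally_antisymmetric_torsion M \<gamma> D \<longleftrightarrow>
     (\<forall>W X Y Z p. openin (mtop M) W \<and> smooth_field M W X \<and> smooth_field M W Y \<and>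
        smooth_field M W Z \<and> p \<in> W \<longrightarrow>
        lowered_torsion M \<gamma> D Y X Z p = - lowered_torsion M \<gamma> D X Y Z p \<and>
        lowered_torsion M \<gamma> D X Z Y p = - lowered_torsion M \<gamma> D X Y Z p)"

end

theory Submission
  imports Defs
begin

text \<open>Integration over the indicatrix is, up to a factor, integration of a function homogeneous of
  degree zero over the Finslerian unit ball and therefore commutes with linear isomorphisms of the
  tangent spaces.  So a compatible connection is metric for the averaged metric \<open>\<gamma>\<close>.  Its torsion being
  a 3-form, the Levi-Civita connection of \<open>\<gamma>\<close> is \<open>\<nabla> - T/2\<close>.  As \<open>\<nabla>\<close> is flat, the first Bianchi
  identity reads \<open>\<nabla>\<^sub>uT(v,w) + T(T(u,v),w) + cyclic = 0\<close>; pairing it with \<open>u\<close> cancels the quadratic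
  terms, and in dimension three what remains says that \<open>T\<close> is parallel.  Hence
  \<open>|T(u,v)|\<^sup>2 = \<kappa> (|u|\<^sup>2|v|\<^sup>2 - \<gamma>(u,v)\<^sup>2)\<close> with \<open>\<kappa>\<close> constant, and the curvature
  \<open>R(u,v)v = - T(T(u,v),v)/4\<close> of \<open>\<gamma>\<close> is constant and equal to \<open>\<kappa>/4\<close>.  If \<open>\<kappa> = 0\<close>, then \<open>\<nabla>\<close> has no torsion.
  If \<open>\<kappa> > 0\<close>, a compatible connection without torsion would also be the Levi-Civita connection of
  \<open>\<gamma>\<close>, so its difference \<open>T/2\<close> to \<open>\<nabla>\<close> would annihilate \<open>F\<close>; since the \<open>T(h,\<cdot>)\<close> are all the infinitesimal
  rotations, \<open>F\<close> would be Riemannian.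

  Everything is done in charts, and no parallel frames are needed: the covariant constancy of
  \<open>\<gamma>\<close> is read off from parallel transport along short coordinate segments.\<close>

text \<open>The averaged metric is given as an integral in spherical coordinates of an arbitrarily
  chosen chart, a formula that shows neither its invariance nor its smoothness. Invariance becomes
  visible for the volume integral over the unit ball, where a linear isomorphism contributes the
  absolute value of its determinant and \<open>sqrt (det g)\<close> absorbs exactly this factor.
  Smoothness is not obtained by differentiating under the integral sign: since \<gamma> is parallel,
  the derivative of its Gram matrix is an expression in that matrix and the Christoffel symbols, and
  induction on the order applies. Subtracting \<open>T/2\<close> removes the torsion because
  \<open>T\<close> is skew in its two arguments, and keeps \<gamma> parallel because each
  \<open>T(h,_)\<close> is skew for \<gamma>. An alternating 3-form on a three-dimensional space is
  a multiple of the determinant. So the covariant derivative of \<open>T\<close> in one direction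
  amounts to a single number, which the one surviving term of the Bianchi identity forces to
  vanish.\<close>

abbreviation fd :: "('a::real_normed_vector \<Rightarrow> 'b::real_normed_vector) \<Rightarrow> 'a \<Rightarrow> 'a \<Rightarrow> 'b" where
  "fd f x \<equiv> frechet_derivative f (at x)"

section \<open>Frechet derivatives on open sets\<close>

lemma fd_eqI: "(f has_derivative f') (at x) \<Longrightarrow> fd f x = f'"
  using frechet_derivative_at by metis

lemma fd_apply: "(f has_derivative f') (at x) \<Longrightarrow> fd f x v = f' v"
  by (simp add: fd_eqI)

lemma has_derivative_fd: "f differentiable (at x) \<Longrightarrow> (f has_derivative fd f x) (at x)"
  by (simp add: frechet_derivative_works)

lemma linear_fd: "f differentiable (at x) \<Longrightarrow> linear (fd f x)"
  by (rule linear_frechet_derivative)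

lemma has_derivative_cong_open:
  assumes "open S" "x \<in> S" "\<And>y. y \<in> S \<Longrightarrow> f y = g y"
  shows "(f has_derivative f') (at x) \<longleftrightarrow> (g has_derivative f') (at x)"
  using assms has_derivative_transform_within_open[of f f' x UNIV S g]
    has_derivative_transform_within_open[of g f' x UNIV S f] by auto

text \<open>Differentiability is no hypothesis here: \<open>frechet_derivative\<close> is a choice
  among all maps that are derivatives, and both functions have the same candidates.\<close>

lemma fd_cong_open:
  assumes "open S" "x \<in> S" "\<And>y. y \<in> S \<Longrightarrow> f y = g y"
  shows "fd f x = fd g x"
  using has_derivative_cong_open[OF assms] by (simp add: frechet_derivative_def)

lemma differentiable_cong_open:
  assumes "open S" "x \<in> S" "\<And>y. y \<in> S \<Longrightarrow> f y = g y"
  shows "f differentiable (at x) \<longleftrightarrow> g differentiable (at x)"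
  using has_derivative_cong_open[OF assms] by (simp add: differentiable_def)

lemma fd_inner_left:
  fixes f :: "'a::real_normed_vector \<Rightarrow> 'b::euclidean_space"
  assumes "f differentiable (at x)"
  shows "fd (\<lambda>x. f x \<bullet> b) x v = fd f x v \<bullet> b" "(\<lambda>x. f x \<bullet> b) differentiable (at x)"
proof -
  have "((\<lambda>x. f x \<bullet> b) has_derivative (\<lambda>v. fd f x v \<bullet> b)) (at x)"
    by (intro derivative_intros has_derivative_fd assms)
  then show "fd (\<lambda>x. f x \<bullet> b) x v = fd f x v \<bullet> b" "(\<lambda>x. f x \<bullet> b) differentiable (at x)"
    using fd_apply differentiableI by blast+
qed

subsection \<open>Functions of class C k\<close>

lemma Ck_on_cong:
  assumes "open S" "\<And>x. x \<in> S \<Longrightarrow> f x = g x"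
  shows "Ck_on k S f \<longleftrightarrow> Ck_on k S g"
  using assms(2)
proof (induction k arbitrary: f g)
  case 0
  then show ?case by (auto intro: continuous_on_eq)
next
  case (Suc k)
  have "\<And>v. Ck_on k S (\<lambda>x. fd f x v) \<longleftrightarrow> Ck_on k S (\<lambda>x. fd g x v)"
    by (intro Suc.IH) (metis fd_cong_open[OF assms(1)] Suc.prems)
  moreover have "\<And>x. x \<in> S \<Longrightarrow> f differentiable (at x) \<longleftrightarrow> g differentiable (at x)"
    by (rule differentiable_cong_open[OF assms(1)]) (use Suc.prems in auto)
  ultimately show ?case by auto
qed

lemma Ck_on_subset: "Ck_on k S f \<Longrightarrow> T \<subseteq> S \<Longrightarrow> Ck_on k T f"
  by (induction k arbitrary: f) (auto intro: continuous_on_subset)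

lemma Ck_on_imp_continuous: "Ck_on k S f \<Longrightarrow> continuous_on S f"
  by (cases k) (auto intro!: continuous_at_imp_continuous_on differentiable_imp_continuous_within)

lemma Ck_on_SucD: "Ck_on (Suc k) S f \<Longrightarrow> Ck_on k S f"
proof (induction k arbitrary: f)
  case 0
  then show ?case using Ck_on_imp_continuous[of "Suc 0"] by simp
next
  case (Suc k)
  then show ?case by (metis Ck_on.simps(2))
qed

lemma Ck_on_const: "Ck_on k S (\<lambda>x. c)"
  by (induction k arbitrary: c) auto

lemma Ck_on_add:
  assumes "open S"
  shows "Ck_on k S f \<Longrightarrow> Ck_on k S g \<Longrightarrow> Ck_on k S (\<lambda>x. f x + g x)"
proof (induction k arbitrary: f g)
  case 0
  then show ?case by (auto intro: continuous_on_add)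
next
  case (Suc k)
  have "((\<lambda>x. f x + g x) has_derivative (\<lambda>v. fd f x v + fd g x v)) (at x)" if "x \<in> S" for x
    using Suc.prems that by (intro derivative_intros has_derivative_fd) auto
  from fd_apply[OF this] differentiableI[OF this] have *: "x \<in> S \<Longrightarrow> fd (\<lambda>x. f x + g x) x v = fd f x v + fd g x v"
    "x \<in> S \<Longrightarrow> (\<lambda>x. f x + g x) differentiable (at x)" for x v
    by auto
  have "Ck_on k S (\<lambda>x. fd (\<lambda>x. f x + g x) x v)" for v
    using Suc.prems by (subst Ck_on_cong[OF assms *(1)]) (auto intro!: Suc.IH)
  then show ?case using *(2) by auto
qed

lemma Ck_on_bilinear:
  assumes "open S" "bounded_bilinear pr"
  shows "Ck_on k S f \<Longrightarrow> Ck_on k S g \<Longrightarrow> Ck_on k S (\<lambda>x. pr (f x) (g x))"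
proof (induction k arbitrary: f g)
  case 0
  then show ?case by (auto intro: bounded_bilinear.continuous_on[OF assms(2)])
next
  case (Suc k)
  have "((\<lambda>x. pr (f x) (g x)) has_derivative (\<lambda>v. pr (f x) (fd g x v) + pr (fd f x v) (g x))) (at x)"
    if "x \<in> S" for x
    using Suc.prems that by (intro bounded_bilinear.FDERIV[OF assms(2)] has_derivative_fd) auto
  from fd_apply[OF this] differentiableI[OF this] have *: "x \<in> S \<Longrightarrow> fd (\<lambda>x. pr (f x) (g x)) x v = pr (f x) (fd g x v) + pr (fd f x v) (g x)"
    "x \<in> S \<Longrightarrow> (\<lambda>x. pr (f x) (g x)) differentiable (at x)" for x v
    by auto
  \<comment> \<open>The product rule brings back \<open>f\<close> and \<open>g\<close>
    undifferentiated, so the step needs them at the lower order as well.\<close>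
  have "Ck_on k S (\<lambda>x. fd (\<lambda>x. pr (f x) (g x)) x v)" for v
    using Suc.prems Ck_on_SucD[OF Suc.prems(1)] Ck_on_SucD[OF Suc.prems(2)]
    by (subst Ck_on_cong[OF assms(1) *(1)]) (auto intro!: Ck_on_add[OF assms(1)] Suc.IH)
  then show ?case using *(2) by auto
qed

lemma Ck_on_linear:
  assumes "open S" "bounded_linear L"
  shows "Ck_on k S f \<Longrightarrow> Ck_on k S (\<lambda>x. L (f x))"
proof (induction k arbitrary: f)
  case 0
  then show ?case by (auto intro: bounded_linear.continuous_on[OF assms(2)])
next
  case (Suc k)
  have "((\<lambda>x. L (f x)) has_derivative (\<lambda>v. L (fd f x v))) (at x)" if "x \<in> S" for x
    using Suc.prems that by (intro bounded_linear.has_derivative[OF assms(2)] has_derivative_fd) auto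
  from fd_apply[OF this] differentiableI[OF this] have *: "x \<in> S \<Longrightarrow> fd (\<lambda>x. L (f x)) x v = L (fd f x v)"
    "x \<in> S \<Longrightarrow> (\<lambda>x. L (f x)) differentiable (at x)" for x v
    by auto
  have "Ck_on k S (\<lambda>x. fd (\<lambda>x. L (f x)) x v)" for v
    using Suc.prems by (subst Ck_on_cong[OF assms(1) *(1)]) (auto intro!: Suc.IH)
  then show ?case using *(2) by auto
qed

lemma Ck_on_ident: "Ck_on k S (\<lambda>x. x)"
proof (cases k)
  case (Suc m)
  then show ?thesis by (simp add: Ck_on_const)
qed simp

lemma Ck_on_sum:
  assumes "open S"
  shows "(\<And>i. i \<in> I \<Longrightarrow> Ck_on k S (f i)) \<Longrightarrow> Ck_on k S (\<lambda>x. \<Sum>i\<in>I. f i x)"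
  by (induction I rule: infinite_finite_induct) (auto intro: Ck_on_const Ck_on_add[OF assms])

lemma linear_euclidean_expansion:
  fixes L :: "'b::euclidean_space \<Rightarrow> 'c::real_vector"
  assumes "linear L"
  shows "L v = (\<Sum>b\<in>Basis. (v \<bullet> b) *\<^sub>R L b)"
  by (subst (1) euclidean_representation[of v, symmetric])
     (simp add: linear_sum[OF assms] linear_cmul[OF assms])

text \<open>In the chain rule the direction \<open>fd f x v\<close> moves with \<open>x\<close>,
  while \<open>Ck_on\<close> speaks of fixed directions only. Expanding it over \<open>Basis\<close>
  leaves the functions \<open>fd g _ b\<close> with \<open>b\<close> fixed, to which the induction
  hypothesis applies.\<close>

lemma Ck_on_compose:
  fixes f :: "'a::real_normed_vector \<Rightarrow> 'b::euclidean_space" and g :: "'b \<Rightarrow> 'c::real_normed_vector"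
  assumes "open S" "open T" "f ` S \<subseteq> T"
  shows "Ck_on k S f \<Longrightarrow> Ck_on k T g \<Longrightarrow> Ck_on k S (\<lambda>x. g (f x))"
proof (induction k arbitrary: g)
  case 0
  then show ?case using assms continuous_on_compose2 by auto
next
  case (Suc k)
  have d: "((\<lambda>x. g (f x)) has_derivative (\<lambda>v. fd g (f x) (fd f x v))) (at x)" if "x \<in> S" for x
    by (rule has_derivative_compose) (use Suc.prems that assms in \<open>auto intro!: has_derivative_fd\<close>)
  have l: "fd g (f x) v = (\<Sum>b\<in>Basis. (v \<bullet> b) *\<^sub>R fd g (f x) b)" if "x \<in> S" for x v
    using Suc.prems that assms by (intro linear_euclidean_expansion linear_fd) auto
  have *: "x \<in> S \<Longrightarrow> fd (\<lambda>x. g (f x)) x v = (\<Sum>b\<in>Basis. (fd f x v \<bullet> b) *\<^sub>R fd g (f x) b)"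
    "x \<in> S \<Longrightarrow> (\<lambda>x. g (f x)) differentiable (at x)" for x v
    using fd_apply[OF d[of x], of v] l[of x "fd f x v"] differentiableI[OF d[of x]] by simp_all
  have "Ck_on k S (\<lambda>x. fd (\<lambda>x. g (f x)) x v)" for v
    using Suc.prems Ck_on_SucD[OF Suc.prems(1)]
    by (subst Ck_on_cong[OF assms(1) *(1)])
      (auto intro!: Ck_on_sum Suc.IH Ck_on_bilinear[OF _ bounded_bilinear_scaleR]
         Ck_on_linear[OF _ bounded_linear_inner_left] assms)
  then show ?case using *(2) by auto
qed

lemma smooth_onI: "(\<And>k. Ck_on k S f) \<Longrightarrow> smooth_on S f"
  by (simp add: smooth_on_def)

lemma smooth_onD: "smooth_on S f \<Longrightarrow> Ck_on k S f"
  by (simp add: smooth_on_def)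

lemma smooth_on_cong: "open S \<Longrightarrow> (\<And>x. x \<in> S \<Longrightarrow> f x = g x) \<Longrightarrow> smooth_on S f \<longleftrightarrow> smooth_on S g"
  using Ck_on_cong unfolding smooth_on_def by blast

lemma smooth_on_subset: "smooth_on S f \<Longrightarrow> T \<subseteq> S \<Longrightarrow> smooth_on T f"
  using Ck_on_subset unfolding smooth_on_def by blast

lemma smooth_on_const: "smooth_on S (\<lambda>x. c)"
  by (simp add: smooth_on_def Ck_on_const)

lemma smooth_on_ident: "smooth_on S (\<lambda>x. x)"
  by (simp add: smooth_on_def Ck_on_ident)

lemma smooth_on_add: "open S \<Longrightarrow> smooth_on S f \<Longrightarrow> smooth_on S g \<Longrightarrow> smooth_on S (\<lambda>x. f x + g x)"
  by (simp add: smooth_on_def Ck_on_add)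

lemma smooth_on_linear: "open S \<Longrightarrow> bounded_linear L \<Longrightarrow> smooth_on S f \<Longrightarrow> smooth_on S (\<lambda>x. L (f x))"
  by (simp add: smooth_on_def Ck_on_linear)

lemma smooth_on_bilinear:
  "open S \<Longrightarrow> bounded_bilinear pr \<Longrightarrow> smooth_on S f \<Longrightarrow> smooth_on S g \<Longrightarrow> smooth_on S (\<lambda>x. pr (f x) (g x))"
  by (simp add: smooth_on_def Ck_on_bilinear)

lemmas smooth_on_scaleR = smooth_on_bilinear[OF _ bounded_bilinear_scaleR]
lemmas smooth_on_mult = smooth_on_bilinear[OF _ bounded_bilinear_mult]

lemma smooth_on_diff:
  "open S \<Longrightarrow> smooth_on S f \<Longrightarrow> smooth_on S g \<Longrightarrow> smooth_on S (\<lambda>x. f x - g x)"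
  using smooth_on_add[of S f "\<lambda>x. - g x"] smooth_on_linear[OF _ bounded_linear_minus[OF bounded_linear_ident], of S g]
  by simp

lemma smooth_on_sum:
  "open S \<Longrightarrow> (\<And>i. i \<in> I \<Longrightarrow> smooth_on S (f i)) \<Longrightarrow> smooth_on S (\<lambda>x. \<Sum>i\<in>I. f i x)"
  by (simp add: smooth_on_def Ck_on_sum)

lemma smooth_on_compose:
  fixes f :: "'a::real_normed_vector \<Rightarrow> 'b::euclidean_space"
  shows "open S \<Longrightarrow> open T \<Longrightarrow> f ` S \<subseteq> T \<Longrightarrow> smooth_on S f \<Longrightarrow> smooth_on T g \<Longrightarrow> smooth_on S (\<lambda>x. g (f x))"
  by (simp add: smooth_on_def Ck_on_compose)

lemma smooth_on_differentiable: "smooth_on S f \<Longrightarrow> x \<in> S \<Longrightarrow> f differentiable (at x)"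
  using smooth_onD[of S f "Suc 0"] by auto

lemma smooth_on_fd: "smooth_on S f \<Longrightarrow> smooth_on S (\<lambda>x. fd f x v)"
  unfolding smooth_on_def by (metis Ck_on.simps(2))

lemma smooth_on_continuous: "smooth_on S f \<Longrightarrow> continuous_on S f"
  using smooth_onD[of S f 0] by simp

text \<open>Used for Jacobians, Christoffel symbols and Gram matrices: smoothness is known for fixed
  vectors and is wanted for vectors that vary with the point.\<close>

lemma smooth_on_apply_linear:
  fixes f :: "'a::real_normed_vector \<Rightarrow> 'b::euclidean_space" and L :: "'a \<Rightarrow> 'b \<Rightarrow> 'c::real_normed_vector"
  assumes "open S" "smooth_on S f" "\<And>b. b \<in> Basis \<Longrightarrow> smooth_on S (\<lambda>x. L x b)" "\<And>x. x \<in> S \<Longrightarrow> linear (L x)"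
  shows "smooth_on S (\<lambda>x. L x (f x))"
proof -
  have "smooth_on S (\<lambda>x. \<Sum>b\<in>Basis. (f x \<bullet> b) *\<^sub>R L x b)"
    by (intro smooth_on_sum smooth_on_scaleR smooth_on_linear[OF _ bounded_linear_inner_left] assms)
  moreover have "L x (f x) = (\<Sum>b\<in>Basis. (f x \<bullet> b) *\<^sub>R L x b)" if "x \<in> S" for x
    by (rule linear_euclidean_expansion[OF assms(4)[OF that]])
  ultimately show ?thesis
    using smooth_on_cong[OF assms(1), of "\<lambda>x. L x (f x)" "\<lambda>x. \<Sum>b\<in>Basis. (f x \<bullet> b) *\<^sub>R L x b"] by simp
qed

text \<open>The product rule for \<open>L z (f z)\<close>. The first summand differentiates
  \<open>L\<close> with the vector frozen at \<open>f x\<close>, so only derivatives of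
  \<open>L\<close> at fixed vectors occur; all later covariant differentiation rests on this
  form.\<close>

lemma has_derivative_apply_linear:
  fixes f :: "'a::real_normed_vector \<Rightarrow> 'b::euclidean_space" and L :: "'a \<Rightarrow> 'b \<Rightarrow> 'c::real_normed_vector"
  assumes "open S" "x \<in> S" "f differentiable (at x)" "\<And>y. y \<in> S \<Longrightarrow> linear (L y)"
    and "\<And>b. (\<lambda>x. L x b) differentiable (at x)"
  shows "((\<lambda>z. L z (f z)) has_derivative (\<lambda>h. fd (\<lambda>z. L z (f x)) x h + L x (fd f x h))) (at x)"
proof -
  have 1: "((\<lambda>x. \<Sum>b\<in>Basis. (f x \<bullet> b) *\<^sub>R L x b) has_derivative
     (\<lambda>h. \<Sum>b\<in>Basis. (f x \<bullet> b) *\<^sub>R fd (\<lambda>x. L x b) x h + (fd f x h \<bullet> b) *\<^sub>R L x b)) (at x)"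
    by (intro derivative_intros has_derivative_fd assms)
  have lin: "fd (\<lambda>x. L x v) x h = (\<Sum>b\<in>Basis. (v \<bullet> b) *\<^sub>R fd (\<lambda>x. L x b) x h)" for v h
  proof -
    have "((\<lambda>x. \<Sum>b\<in>Basis. (v \<bullet> b) *\<^sub>R L x b) has_derivative
       (\<lambda>h. \<Sum>b\<in>Basis. (v \<bullet> b) *\<^sub>R fd (\<lambda>x. L x b) x h)) (at x)"
      by (intro derivative_intros has_derivative_fd assms)
    moreover have "L y v = (\<Sum>b\<in>Basis. (v \<bullet> b) *\<^sub>R L y b)" if "y \<in> S" for y
      by (rule linear_euclidean_expansion[OF assms(4)[OF that]])
    ultimately show ?thesis
      using fd_cong_open[OF assms(1,2), of "\<lambda>x. L x v" "\<lambda>x. \<Sum>b\<in>Basis. (v \<bullet> b) *\<^sub>R L x b"] fd_apply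
      by simp
  qed
  have 2: "(\<lambda>h. \<Sum>b\<in>Basis. (f x \<bullet> b) *\<^sub>R fd (\<lambda>x. L x b) x h + (fd f x h \<bullet> b) *\<^sub>R L x b) =
    (\<lambda>h. fd (\<lambda>z. L z (f x)) x h + L x (fd f x h))"
    by (rule ext) (simp only: sum.distrib lin[of "f x"]
        linear_euclidean_expansion[OF assms(4)[OF assms(2)], of "fd f x _"])
  have "L y (f y) = (\<Sum>b\<in>Basis. (f y \<bullet> b) *\<^sub>R L y b)" if "y \<in> S" for y
    by (rule linear_euclidean_expansion[OF assms(4)[OF that]])
  then show ?thesis
    using 1 2 has_derivative_cong_open[OF assms(1,2), of "\<lambda>x. L x (f x)"] by simp
qed

lemma linear_fd_apply:
  fixes L :: "'a::real_normed_vector \<Rightarrow> 'b::real_vector \<Rightarrow> 'c::real_normed_vector"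
  assumes "open S" "x \<in> S" "\<And>y. y \<in> S \<Longrightarrow> linear (L y)" "\<And>b. (\<lambda>x. L x b) differentiable (at x)"
  shows "linear (\<lambda>b. fd (\<lambda>x. L x b) x h)"
proof (rule linearI)
  fix u v :: 'b and a :: real
  have "((\<lambda>x. L x u + L x v) has_derivative (\<lambda>h. fd (\<lambda>x. L x u) x h + fd (\<lambda>x. L x v) x h)) (at x)"
    by (intro derivative_intros has_derivative_fd assms)
  from fd_apply[OF this] show "fd (\<lambda>x. L x (u + v)) x h = fd (\<lambda>x. L x u) x h + fd (\<lambda>x. L x v) x h"
    using fd_cong_open[OF assms(1,2) linear_add[OF assms(3)]] by simp
  have "((\<lambda>x. a *\<^sub>R L x u) has_derivative (\<lambda>h. a *\<^sub>R fd (\<lambda>x. L x u) x h)) (at x)"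
    by (intro derivative_intros has_derivative_fd assms)
  from fd_apply[OF this] show "fd (\<lambda>x. L x (a *\<^sub>R u)) x h = a *\<^sub>R fd (\<lambda>x. L x u) x h"
    using fd_cong_open[OF assms(1,2) linear_scale[OF assms(3)]] by simp
qed

subsection \<open>Symmetry of the second derivative\<close>

text \<open>The mean value theorem twice: in direction \<open>u\<close> for the difference of
  \<open>f\<close> along the two sides \<open>t = h\<close> and \<open>t = 0\<close> of the square,
  then in direction \<open>v\<close> for the derivative so obtained.\<close>

lemma second_difference:
  fixes f :: "'a::real_normed_vector \<Rightarrow> real"
  assumes "0 < h" "\<And>s t. 0 \<le> s \<Longrightarrow> s \<le> h \<Longrightarrow> 0 \<le> t \<Longrightarrow> t \<le> h \<Longrightarrow> x + s *\<^sub>R u + t *\<^sub>R v \<in> S"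
    and f: "\<And>z. z \<in> S \<Longrightarrow> f differentiable (at z)"
    and g: "\<And>z. z \<in> S \<Longrightarrow> (\<lambda>z. fd f z u) differentiable (at z)"
  obtains \<xi> \<eta> where "0 \<le> \<xi>" "\<xi> \<le> h" "0 \<le> \<eta>" "\<eta> \<le> h"
    "f (x + h *\<^sub>R u + h *\<^sub>R v) - f (x + h *\<^sub>R u) - f (x + h *\<^sub>R v) + f x
       = h * h * fd (\<lambda>z. fd f z u) (x + \<xi> *\<^sub>R u + \<eta> *\<^sub>R v) v"
proof -
  have df: "((\<lambda>s. f (x + s *\<^sub>R u + t *\<^sub>R v)) has_real_derivative fd f (x + s *\<^sub>R u + t *\<^sub>R v) u) (at s)"
    if "0 \<le> s" "s \<le> h" "0 \<le> t" "t \<le> h" for s t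
  proof -
    have "((\<lambda>s. f (x + s *\<^sub>R u + t *\<^sub>R v)) has_derivative (\<lambda>k. fd f (x + s *\<^sub>R u + t *\<^sub>R v) (k *\<^sub>R u))) (at s)"
      by (rule has_derivative_compose[of "\<lambda>s. x + s *\<^sub>R u + t *\<^sub>R v" "\<lambda>k. k *\<^sub>R u"])
         (auto intro!: derivative_eq_intros has_derivative_fd f assms(2) that)
    then show ?thesis
      by (simp add: has_field_derivative_def linear_scale[OF linear_fd[OF f[OF assms(2)]]] that mult.commute[of _ "fd f _ u"])
  qed
  have dg: "((\<lambda>t. fd f (x + s *\<^sub>R u + t *\<^sub>R v) u) has_real_derivative
      fd (\<lambda>z. fd f z u) (x + s *\<^sub>R u + t *\<^sub>R v) v) (at t)"
    if "0 \<le> s" "s \<le> h" "0 \<le> t" "t \<le> h" for s t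
  proof -
    have "((\<lambda>t. (\<lambda>z. fd f z u) (x + s *\<^sub>R u + t *\<^sub>R v)) has_derivative
        (\<lambda>k. fd (\<lambda>z. fd f z u) (x + s *\<^sub>R u + t *\<^sub>R v) (k *\<^sub>R v))) (at t)"
      by (rule has_derivative_compose[of "\<lambda>t. x + s *\<^sub>R u + t *\<^sub>R v" "\<lambda>k. k *\<^sub>R v"])
         (auto intro!: derivative_eq_intros has_derivative_fd g assms(2) that)
    then show ?thesis
      by (simp add: has_field_derivative_def linear_scale[OF linear_fd[OF g[OF assms(2)]]] that mult.commute[of _ "fd _ _ v"])
  qed
  obtain \<xi> where \<xi>: "0 < \<xi>" "\<xi> < h" and 1: "(f (x + h *\<^sub>R u + h *\<^sub>R v) - f (x + h *\<^sub>R u + 0 *\<^sub>R v)) - (f (x + 0 *\<^sub>R u + h *\<^sub>R v) - f (x + 0 *\<^sub>R u + 0 *\<^sub>R v))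
     = (h - 0) * (fd f (x + \<xi> *\<^sub>R u + h *\<^sub>R v) u - fd f (x + \<xi> *\<^sub>R u + 0 *\<^sub>R v) u)"
    using MVT2[OF \<open>0 < h\<close> DERIV_diff[OF df[where t = h] df[where t = 0]]] \<open>0 < h\<close> by auto
  obtain \<eta> where \<eta>: "0 < \<eta>" "\<eta> < h" and 2: "fd f (x + \<xi> *\<^sub>R u + h *\<^sub>R v) u - fd f (x + \<xi> *\<^sub>R u + 0 *\<^sub>R v) u
     = (h - 0) * fd (\<lambda>z. fd f z u) (x + \<xi> *\<^sub>R u + \<eta> *\<^sub>R v) v"
    using MVT2[OF \<open>0 < h\<close> dg[where s = \<xi>]] \<open>0 < h\<close> \<xi> by auto
  show ?thesis
    by (rule that[of \<xi> \<eta>]) (use \<xi> \<eta> 1 2 in \<open>auto simp: algebra_simps\<close>)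
qed

text \<open>The second difference of \<open>f\<close> over a small square is symmetric in
  \<open>u\<close> and \<open>v\<close>. Both mixed derivatives therefore take a common value at
  points of the square, and by continuity they agree in the limit.\<close>

lemma fd_fd_commute_real:
  fixes f :: "'a::real_normed_vector \<Rightarrow> real"
  assumes "open S" "x \<in> S" "Ck_on 2 S f"
  shows "fd (\<lambda>z. fd f z u) x v = fd (\<lambda>z. fd f z v) x u"
proof -
  have C: "Ck_on (Suc (Suc 0)) S f" using assms(3) by (simp add: numeral_2_eq_2)
  let ?a = "\<lambda>z. fd (\<lambda>z. fd f z u) z v" and ?b = "\<lambda>z. fd (\<lambda>z. fd f z v) z u"
  have ca: "isCont ?a x" and cb: "isCont ?b x"
    using C assms(1,2) by (auto simp: continuous_on_eq_continuous_at)
  have "\<bar>?a x - ?b x\<bar> < e" if "e > 0" for e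
  proof -
    obtain d where d: "d > 0" "\<And>z. dist z x < d \<Longrightarrow> dist (?a z) (?a x) < e / 2 \<and> dist (?b z) (?b x) < e / 2 \<and> z \<in> S"
    proof -
      have "eventually (\<lambda>z. dist (?a z) (?a x) < e / 2 \<and> dist (?b z) (?b x) < e / 2 \<and> z \<in> S) (nhds x)"
        using ca cb \<open>e > 0\<close> eventually_nhds assms(1,2) unfolding continuous_at tendsto_iff eventually_at_filter
        by (intro eventually_conj) (auto elim!: allE[of _ "e/2"] elim: eventually_mono)
      then show ?thesis using that unfolding eventually_nhds_metric by auto
    qed
    \<comment> \<open>With \<open>h = d / 2 / m\<close> the whole square lies within
      \<open>d / 2\<close> of \<open>x\<close>; the summand 1 keeps \<open>m\<close> positive when
      both directions vanish.\<close>
    define m where "m = norm u + norm v + 1"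
    define h where "h = d / 2 / m"
    have n: "m > 0" unfolding m_def by (meson add_nonneg_pos add_nonneg_nonneg norm_ge_zero zero_less_one)
    have h: "h > 0" using d n by (simp add: h_def)
    have near: "dist (x + s *\<^sub>R u + t *\<^sub>R v) x < d" if "0 \<le> s" "s \<le> h" "0 \<le> t" "t \<le> h" for s t
    proof -
      have "dist (x + s *\<^sub>R u + t *\<^sub>R v) x = norm (s *\<^sub>R u + t *\<^sub>R v)" by (simp add: dist_norm)
      also have "\<dots> \<le> s * norm u + t * norm v"
        using norm_triangle_ineq[of "s *\<^sub>R u" "t *\<^sub>R v"] that by simp
      also have "\<dots> \<le> h * norm u + h * norm v"
        using that by (intro add_mono mult_right_mono) auto
      also have "\<dots> \<le> h * m" using h by (simp add: m_def algebra_simps)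
      also have "\<dots> = d / 2" using n by (simp add: h_def)
      finally show ?thesis using d by simp
    qed
    obtain \<xi> \<eta> where 1: "0 \<le> \<xi>" "\<xi> \<le> h" "0 \<le> \<eta>" "\<eta> \<le> h"
      "f (x + h *\<^sub>R u + h *\<^sub>R v) - f (x + h *\<^sub>R u) - f (x + h *\<^sub>R v) + f x = h * h * ?a (x + \<xi> *\<^sub>R u + \<eta> *\<^sub>R v)"
      using second_difference[of h x u v S f] h near d C by (auto intro: that)
    have near': "\<And>s t. 0 \<le> s \<Longrightarrow> s \<le> h \<Longrightarrow> 0 \<le> t \<Longrightarrow> t \<le> h \<Longrightarrow> x + s *\<^sub>R v + t *\<^sub>R u \<in> S"
      using near d by (metis add.assoc add.commute)
    obtain \<xi>' \<eta>' where 2: "0 \<le> \<xi>'" "\<xi>' \<le> h" "0 \<le> \<eta>'" "\<eta>' \<le> h"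
      "f (x + h *\<^sub>R v + h *\<^sub>R u) - f (x + h *\<^sub>R v) - f (x + h *\<^sub>R u) + f x = h * h * ?b (x + \<xi>' *\<^sub>R v + \<eta>' *\<^sub>R u)"
      by (rule second_difference[OF h near', of f]) (use C in auto)
    have "h * h * ?a (x + \<xi> *\<^sub>R u + \<eta> *\<^sub>R v) = h * h * ?b (x + \<eta>' *\<^sub>R u + \<xi>' *\<^sub>R v)"
      using 1(5) 2(5) by (simp add: algebra_simps)
    then have "?a (x + \<xi> *\<^sub>R u + \<eta> *\<^sub>R v) = ?b (x + \<eta>' *\<^sub>R u + \<xi>' *\<^sub>R v)" using h by simp
    moreover have "dist (?a (x + \<xi> *\<^sub>R u + \<eta> *\<^sub>R v)) (?a x) < e / 2"
      "dist (?b (x + \<eta>' *\<^sub>R u + \<xi>' *\<^sub>R v)) (?b x) < e / 2"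
      using d(2)[OF near] 1 2 by blast+
    moreover have "\<bar>a - b\<bar> < e" if "A = B" "dist A a < e / 2" "dist B b < e / 2" for a b A B :: real
      using that unfolding dist_real_def by linarith
    ultimately show ?thesis by blast
  qed
  from this[of "\<bar>?a x - ?b x\<bar>"] show ?thesis by (cases "?a x = ?b x") auto
qed

lemma fd_fd_commute:
  fixes f :: "'a::real_normed_vector \<Rightarrow> 'b::euclidean_space"
  assumes "open S" "x \<in> S" "Ck_on 2 S f"
  shows "fd (\<lambda>z. fd f z u) x v = fd (\<lambda>z. fd f z v) x u"
proof (rule euclidean_eqI)
  fix b :: 'b
  have C: "Ck_on (Suc (Suc 0)) S f" using assms(3) by (simp add: numeral_2_eq_2)
  have *: "fd (\<lambda>z. fd (\<lambda>x. f x \<bullet> b) z u) x v = fd (\<lambda>z. fd f z u) x v \<bullet> b" for u v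
  proof -
    have "fd (\<lambda>x. f x \<bullet> b) z u = fd f z u \<bullet> b" if "z \<in> S" for z
      by (rule fd_inner_left) (use C that in auto)
    then have "fd (\<lambda>z. fd (\<lambda>x. f x \<bullet> b) z u) x v = fd (\<lambda>z. fd f z u \<bullet> b) x v"
      by (rule fun_cong[OF fd_cong_open[OF assms(1,2)]])
    also have "\<dots> = fd (\<lambda>z. fd f z u) x v \<bullet> b"
      by (rule fd_inner_left) (use C assms in auto)
    finally show ?thesis .
  qed
  have "Ck_on 2 S (\<lambda>x. f x \<bullet> b)"
    by (rule Ck_on_linear[OF assms(1) bounded_linear_inner_left assms(3)])
  from fd_fd_commute_real[OF assms(1,2) this] show "fd (\<lambda>z. fd f z u) x v \<bullet> b = fd (\<lambda>z. fd f z v) x u \<bullet> b"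
    by (simp add: *)
qed

lemma vec_axis_expansion: "v = (\<Sum>i\<in>UNIV. v $ i *\<^sub>R axis i 1)" for v :: "real^'n"
  by (simp add: vec_eq_iff axis_def if_distrib sum.If_cases cong: if_cong)

lemma linear_axis_expansion:
  fixes L :: "real^'n \<Rightarrow> 'c::real_vector"
  assumes "linear L"
  shows "L v = (\<Sum>i\<in>UNIV. v $ i *\<^sub>R L (axis i 1))"
  by (subst (1) vec_axis_expansion[of v]) (simp add: linear_sum[OF assms] linear_cmul[OF assms])

subsection \<open>Linear differential equations with small coefficients\<close>

lemma continuous_on_clamp: "continuous_on UNIV (\<lambda>t::real. max a (min b t))"
  by (intro continuous_intros)

text \<open>The coefficient is assumed so small that the Picard operator on the whole interval is a contraction.\<close>

lemma linear_ode:
  fixes L :: "real \<Rightarrow> 'e::euclidean_space \<Rightarrow> 'e" and x0 :: 'e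
  assumes lin: "\<And>t. linear (L t)"
    and cont: "\<And>x. continuous_on {-1..2} (\<lambda>t. L t x)"
    and bd: "\<And>t x. t \<in> {-1..2} \<Longrightarrow> norm (L t x) \<le> c * norm x" and c: "0 \<le> c" "c \<le> 1/4"
  obtains X where "X 0 = x0" "\<And>t. t \<in> {-1<..<2} \<Longrightarrow> (X has_vector_derivative L t (X t)) (at t)"
    "\<And>t. t \<in> {-1..2} \<Longrightarrow> norm (X t - x0) \<le> 4 * c * norm x0"
    "\<And>t. t \<in> {-1..2} \<Longrightarrow> ((\<lambda>s. L s (X s)) has_integral (X t - x0)) {0..t} \<or> t < 0"
proof -
  \<comment> \<open>Bounded continuous functions live on the whole line, so the Picard operator is
    evaluated at the clamped time.\<close>
  define cl where "cl t = max (-1) (min 2 t)" for t :: real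
  have cl: "cl t \<in> {-1..2}" for t by (auto simp: cl_def)
  have clid: "t \<in> {-1..2} \<Longrightarrow> cl t = t" for t by (auto simp: cl_def)
  have clc: "continuous_on UNIV cl" unfolding cl_def by (rule continuous_on_clamp)
  have contL: "continuous_on {-1..2} (\<lambda>t. L t (V t))" if "continuous_on {-1..2} V" for V :: "real \<Rightarrow> 'e"
  proof -
    have "continuous_on {-1..2} (\<lambda>t. \<Sum>b\<in>Basis. (V t \<bullet> b) *\<^sub>R L t b)"
      by (intro continuous_intros that cont)
    moreover have "(\<lambda>t. L t (V t)) = (\<lambda>t. \<Sum>b\<in>Basis. (V t \<bullet> b) *\<^sub>R L t b)"
      by (rule ext) (rule linear_euclidean_expansion[OF lin])
    ultimately show ?thesis by (simp only:)
  qed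
  have intL: "(\<lambda>t. L t (V t)) integrable_on {a..b}" if "continuous_on {-1..2} V" "-1 \<le> a" "b \<le> 2"
    for V :: "real \<Rightarrow> 'e" and a b
    by (rule integrable_continuous_real, rule continuous_on_subset[OF contL[OF that(1)]]) (use that in auto)
  \<comment> \<open>The integral from 0 to \<open>t\<close>, written as a difference of integrals
    from -1 so that negative \<open>t\<close> is covered by the same formula.\<close>
  define I where "I V t = integral {-1..t} (\<lambda>s. L s (V s)) - integral {-1..0} (\<lambda>s. L s (V s))" for V :: "real \<Rightarrow> 'e" and t
  have Ider: "(I V has_vector_derivative L t (V t)) (at t within {-1..2})"
    if "continuous_on {-1..2} V" "t \<in> {-1..2}" for V t
    unfolding I_def using integral_has_vector_derivative[OF contL[OF that(1)] that(2)]
    by (auto intro!: derivative_eq_intros)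
  have Icont: "continuous_on {-1..2} (I V)" if "continuous_on {-1..2} V" for V
    using Ider[OF that] has_vector_derivative_continuous continuous_on_eq_continuous_within by blast
  have Ibd: "norm (I V t) \<le> 2 * c * B" if V: "continuous_on {-1..2} V" "\<And>s. s \<in> {-1..2} \<Longrightarrow> norm (V s) \<le> B"
    and t: "t \<in> {-1..2}" and B: "B \<ge> 0" for V t B
  proof -
    have LB: "norm (L s (V s)) \<le> c * B" if "s \<in> {-1..2}" for s
      using bd[OF that, of "V s"] V(2)[OF that] c by (meson mult_left_mono order_trans)
    have cB: "c * B \<ge> 0" using c B by simp
    show ?thesis
    proof (cases "t \<ge> 0")
      case True
      then have "I V t = integral {0..t} (\<lambda>s. L s (V s))"
        unfolding I_def using Henstock_Kurzweil_Integration.integral_combine[OF _ _ intL[OF V(1)], of "-1" 0 t] t by (auto simp: algebra_simps)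
      also have "norm \<dots> \<le> (c * B) * (t - 0)"
        using t True LB by (intro integral_bound continuous_on_subset[OF contL[OF V(1)]]) auto
      also have "\<dots> \<le> (c * B) * 2" using t cB by (intro mult_left_mono) auto
      finally show ?thesis by (simp add: mult.commute)
    next
      case False
      then have "I V t = - integral {t..0} (\<lambda>s. L s (V s))"
        unfolding I_def using Henstock_Kurzweil_Integration.integral_combine[OF _ _ intL[OF V(1)], of "-1" t 0] t by (auto simp: algebra_simps)
      then have "norm (I V t) = norm (integral {t..0} (\<lambda>s. L s (V s)))" by simp
      also have "\<dots> \<le> (c * B) * (0 - t)"
        using t False LB by (intro integral_bound continuous_on_subset[OF contL[OF V(1)]]) auto
      also have "\<dots> \<le> (c * B) * 2" using t cB by (intro mult_left_mono) auto
      finally show ?thesis by (simp add: mult.commute)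
    qed
  qed
  define P where "P V = Bcontfun (\<lambda>t. x0 + I (apply_bcontfun V) (cl t))" for V :: "real \<Rightarrow>\<^sub>C 'e"
  have Vc: "continuous_on S (apply_bcontfun V)" for V :: "real \<Rightarrow>\<^sub>C 'e" and S
    using continuous_on_apply_bcontfun continuous_on_subset by blast
  have P: "apply_bcontfun (P V) t = x0 + I (apply_bcontfun V) (cl t)" for V t
  proof -
    have "continuous_on UNIV (\<lambda>t. I (apply_bcontfun V) (cl t))"
      by (rule continuous_on_compose2[OF Icont[OF Vc] clc]) (use cl in auto)
    moreover have "norm (I (apply_bcontfun V) (cl t)) \<le> 2 * c * norm V" for t
      by (rule Ibd[OF Vc _ cl]) (auto simp: norm_bounded)
    then have "norm (x0 + I (apply_bcontfun V) (cl t)) \<le> norm x0 + 2 * c * norm V" for t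
      by (meson norm_triangle_le add_left_mono)
    ultimately have "(\<lambda>t. x0 + I (apply_bcontfun V) (cl t)) \<in> bcontfun"
      by (intro bcontfun_normI continuous_intros) auto
    then show ?thesis by (simp add: P_def Bcontfun_inverse)
  qed
  have Idiff: "I V t - I W t = I (\<lambda>s. V s - W s) t" if "continuous_on {-1..2} V" "continuous_on {-1..2} W" "t \<in> {-1..2}" for V W t
    unfolding I_def using that intL[OF that(1)] intL[OF that(2)]
    by (auto simp: linear_diff[OF lin] integral_diff)
  \<comment> \<open>The integral runs over an interval of length at most 2, so the contraction
    factor is \<open>2 * c\<close>, at most 1/2.\<close>
  have contr: "dist (P V) (P W) \<le> 1/2 * dist V W" for V W
  proof (rule dist_bound)
    fix t
    have "dist (apply_bcontfun (P V) t) (apply_bcontfun (P W) t) = norm (I (\<lambda>s. apply_bcontfun V s - apply_bcontfun W s) (cl t))"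
      using Idiff[OF Vc Vc cl] by (simp add: P dist_norm)
    also have "\<dots> \<le> 2 * c * dist V W"
      by (rule Ibd[OF _ _ cl]) (auto intro!: continuous_intros Vc simp: dist_norm[symmetric] dist_bounded)
    also have "\<dots> \<le> 1/2 * dist V W" using c by (intro mult_right_mono) auto
    finally show "dist (apply_bcontfun (P V) t) (apply_bcontfun (P W) t) \<le> 1/2 * dist V W" .
  qed
  have "\<exists>!x. P x = x"
    using contr by (intro banach_fix_type[of "1/2"]) auto
  then obtain V where V: "P V = V" by auto
  define X where "X = apply_bcontfun V"
  have X: "X t = x0 + I X (cl t)" for t using P[of V t] V by (simp add: X_def)
  have Xc: "continuous_on S X" for S by (simp add: X_def Vc)
  have cl0: "cl 0 = 0" by (simp add: cl_def)
  have "X 0 = x0" using X[of 0] by (simp add: cl0 I_def)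
  moreover have "(X has_vector_derivative L t (X t)) (at t)" if t: "t \<in> {-1<..<2}" for t
  proof -
    have "((\<lambda>t. x0 + I X t) has_vector_derivative L t (X t)) (at t within {-1..2})"
      using Ider[OF Xc, of t] t by (auto intro!: derivative_eq_intros)
    then have "((\<lambda>t. x0 + I X t) has_vector_derivative L t (X t)) (at t)"
      using t by (simp add: at_within_Icc_at)
    then show ?thesis
      by (rule has_vector_derivative_transform_within_open[of _ _ _ "{-1<..<2}"]) (use t X clid in auto)
  qed
  moreover have "norm (X t - x0) \<le> 4 * c * norm x0" if t: "t \<in> {-1..2}" for t
  proof -
    have nb: "norm (X t) \<le> norm V" for t by (simp add: X_def norm_bounded)
    \<comment> \<open>An a priori bound: the fixed point equation bounds \<open>norm V\<close> by
      \<open>norm x0\<close> plus half of itself, hence by \<open>2 * norm x0\<close>. One more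
      application of \<open>Ibd\<close> gives the factor \<open>4 * c\<close>.\<close>
    have "norm V \<le> norm x0 + 2 * c * norm V"
    proof (rule norm_bound)
      fix t
      have "norm (I X (cl t)) \<le> 2 * c * norm V" by (rule Ibd[OF Xc nb cl]) auto
      then show "norm (apply_bcontfun V t) \<le> norm x0 + 2 * c * norm V"
        using X[of t] norm_triangle_ineq[of x0 "I X (cl t)"] by (simp add: X_def)
    qed
    also have "\<dots> \<le> norm x0 + 2 * (1/4) * norm V" using c by (intro add_left_mono mult_right_mono) auto
    finally have "norm V \<le> 2 * norm x0" by simp
    have "norm (X t - x0) \<le> 2 * c * norm V" using X[of t] Ibd[OF Xc nb cl, of t] by simp
    also have "\<dots> \<le> 2 * c * (2 * norm x0)" using \<open>norm V \<le> 2 * norm x0\<close> c by (intro mult_left_mono) auto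
    finally show ?thesis by simp
  qed
  moreover have "((\<lambda>s. L s (X s)) has_integral (X t - x0)) {0..t} \<or> t < 0" if t: "t \<in> {-1..2}" for t
  proof (cases "t < 0")
    case False
    then have "I X t = integral {0..t} (\<lambda>s. L s (X s))"
      unfolding I_def using Henstock_Kurzweil_Integration.integral_combine[OF _ _ intL[OF Xc], of "-1" 0 t] t by (auto simp: algebra_simps)
    then show ?thesis
      using X[of t] clid[OF t] integrable_integral[OF intL[OF Xc, of 0 t]] t by simp
  qed simp
  ultimately show ?thesis using that by blast
qed

subsection \<open>Charts and tangent vectors\<close>

definition cim :: "('a, 'n::finite) chart \<Rightarrow> (real^'n) set" where
  "cim c = cmap c ` cdom c"

definition jac :: "('a, 'n::finite) chart \<Rightarrow> ('a, 'n) chart \<Rightarrow> 'a \<Rightarrow> real^'n \<Rightarrow> real^'n" where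
  "jac c d p = fd (transition c d) (cmap c p)"

text \<open>The field with constant coordinates \<open>v\<close> in \<open>c\<close>. Its coordinate
  derivative vanishes, so a covariant derivative of it consists of the Christoffel term
  alone.\<close>

definition cfield :: "('a, 'n::finite) manifold \<Rightarrow> ('a, 'n) chart \<Rightarrow> real^'n \<Rightarrow> 'a \<Rightarrow> ('a, 'n) tvec" where
  "cfield M c v = (\<lambda>q. tvec_of M c q v)"

lemma tvec_simps [simp]:
  "tadd v w c = v c + w c" "tdiff v w c = v c - w c" "tscale a v c = a *\<^sub>R v c" "tzero c = 0"
  by (simp_all add: tadd_def tdiff_def tscale_def tzero_def)

locale smooth_mfd =
  fixes M :: "('a, 'n::finite) manifold"
  assumes mfd: "smooth_manifold M"
begin

lemma chart_inj: "c \<in> atlas M \<Longrightarrow> inj_on (cmap c) (cdom c)"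
  and open_cim: "c \<in> atlas M \<Longrightarrow> open (cim c)"
  and open_cdom: "c \<in> atlas M \<Longrightarrow> openin (mtop M) (cdom c)"
  and chart_homeo: "c \<in> atlas M \<Longrightarrow> homeomorphic_map (subtopology (mtop M) (cdom c)) (top_of_set (cim c)) (cmap c)"
  and cdom_subset: "c \<in> atlas M \<Longrightarrow> cdom c \<subseteq> topspace (mtop M)"
proof -
  assume c: "c \<in> atlas M"
  show h: "homeomorphic_map (subtopology (mtop M) (cdom c)) (top_of_set (cim c)) (cmap c)"
    and "open (cim c)" and o: "openin (mtop M) (cdom c)"
    using mfd c by (auto simp: smooth_manifold_def cim_def)
  show s: "cdom c \<subseteq> topspace (mtop M)" using o by (rule openin_subset)
  have "topspace (subtopology (mtop M) (cdom c)) = cdom c"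
    using s by auto
  then show "inj_on (cmap c) (cdom c)"
    using homeomorphic_imp_injective_map[OF h] by simp
qed

lemma cinv_cmap [simp]: "c \<in> atlas M \<Longrightarrow> p \<in> cdom c \<Longrightarrow> cinv c (cmap c p) = p"
  using chart_inj by (simp add: cinv_def)

lemma cmap_cinv [simp]: "x \<in> cim c \<Longrightarrow> cmap c (cinv c x) = x"
  by (simp add: cinv_def cim_def f_inv_into_f)

lemma cinv_cdom [simp]: "x \<in> cim c \<Longrightarrow> cinv c x \<in> cdom c"
  by (simp add: cinv_def cim_def inv_into_into)

lemma cmap_cim [simp]: "p \<in> cdom c \<Longrightarrow> cmap c p \<in> cim c"
  by (simp add: cim_def)

lemma open_image:
  assumes "c \<in> atlas M" "openin (mtop M) W"
  shows "open (cmap c ` (W \<inter> cdom c))"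
proof -
  have "openin (subtopology (mtop M) (cdom c)) (W \<inter> cdom c)"
    using assms(2) by (rule openin_subtopology_Int)
  then have "openin (top_of_set (cim c)) (cmap c ` (W \<inter> cdom c))"
    using homeomorphic_imp_open_map[OF chart_homeo[OF assms(1)]] by (simp add: open_map_def)
  then show ?thesis using open_cim[OF assms(1)] openin_open_trans by blast
qed

lemma image_iff_cinv:
  assumes "c \<in> atlas M"
  shows "x \<in> cmap c ` (W \<inter> cdom c) \<longleftrightarrow> x \<in> cim c \<and> cinv c x \<in> W"
  using assms by (force simp: image_iff)

lemma openin_cinv_image:
  assumes c: "c \<in> atlas M" and N: "open N" "N \<subseteq> cim c"
  shows "openin (mtop M) (cinv c ` N)"
proof -
  have top: "topspace (subtopology (mtop M) (cdom c)) = cdom c"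
    using cdom_subset[OF c] by auto
  have "cinv c ` N = {p \<in> topspace (subtopology (mtop M) (cdom c)). cmap c p \<in> N}"
    unfolding top using c N by (force simp: image_iff)
  moreover have "openin (subtopology (mtop M) (cdom c)) {p \<in> topspace (subtopology (mtop M) (cdom c)). cmap c p \<in> N}"
    using homeomorphic_imp_continuous_map[OF chart_homeo[OF c]] N
    by (intro openin_continuous_map_preimage[of _ "top_of_set (cim c)"]) (auto simp: openin_open)
  ultimately show ?thesis
    using openin_trans_full[OF _ open_cdom[OF c]] by (simp only:)
qed

lemma continuous_map_cinv:
  assumes c: "c \<in> atlas M"
  shows "continuous_map (top_of_set (cim c)) (mtop M) (cinv c)"
proof -
  have "openin (top_of_set (cim c)) {x \<in> cim c. cinv c x \<in> W}" if "openin (mtop M) W" for W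
  proof -
    have "{x \<in> cim c. cinv c x \<in> W} = cmap c ` (W \<inter> cdom c)"
      using image_iff_cinv[OF c] by blast
    then show ?thesis using open_image[OF c that] open_cim[OF c] by (auto simp: openin_open)
  qed
  then show ?thesis
    using cdom_subset[OF c] cinv_cdom by (auto simp: continuous_map_def)
qed

lemma chartsD: "c \<in> charts_at M p \<Longrightarrow> c \<in> atlas M" "c \<in> charts_at M p \<Longrightarrow> p \<in> cdom c"
  by (auto simp: charts_at_def)

lemma chartsI: "c \<in> atlas M \<Longrightarrow> p \<in> cdom c \<Longrightarrow> c \<in> charts_at M p"
  by (auto simp: charts_at_def)

lemma chart_at:
  assumes "p \<in> topspace (mtop M)"
  shows "chart_at M p \<in> charts_at M p"
proof -
  have "(\<Union>c\<in>atlas M. cdom c) = topspace (mtop M)" using mfd by (simp add: smooth_manifold_def)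
  then obtain c where "c \<in> charts_at M p" using assms by (auto simp: charts_at_def)
  then show ?thesis unfolding chart_at_def by (rule someI)
qed

lemma charts_at_topspace: "c \<in> charts_at M p \<Longrightarrow> p \<in> topspace (mtop M)"
  using cdom_subset by (auto simp: charts_at_def)

lemma open_overlap: "c \<in> atlas M \<Longrightarrow> d \<in> atlas M \<Longrightarrow> open (cmap c ` (cdom c \<inter> cdom d))"
  using open_image[of c "cdom d"] open_cdom[of d] by (simp add: Int_commute)

lemma smooth_transition:
  "c \<in> atlas M \<Longrightarrow> d \<in> atlas M \<Longrightarrow> smooth_on (cmap c ` (cdom c \<inter> cdom d)) (transition c d)"
  using mfd by (simp add: smooth_manifold_def)

lemma transition_apply: "c \<in> atlas M \<Longrightarrow> p \<in> cdom c \<Longrightarrow> transition c d (cmap c p) = cmap d p"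
  by (simp add: transition_def)

lemma jac_has_derivative:
  assumes "c \<in> charts_at M p" "d \<in> charts_at M p"
  shows "(transition c d has_derivative jac c d p) (at (cmap c p))"
  unfolding jac_def using chartsD[OF assms(1)] chartsD[OF assms(2)]
  by (intro has_derivative_fd smooth_on_differentiable[OF smooth_transition]) auto

lemma linear_jac: "c \<in> charts_at M p \<Longrightarrow> d \<in> charts_at M p \<Longrightarrow> linear (jac c d p)"
  using jac_has_derivative has_derivative_linear by blast

lemma jac_self [simp]:
  assumes "c \<in> charts_at M p"
  shows "jac c c p = (\<lambda>v. v)"
proof -
  have "((\<lambda>x. x) has_derivative (\<lambda>v. v)) (at (cmap c p))" by (rule has_derivative_ident)
  then have "(transition c c has_derivative (\<lambda>v. v)) (at (cmap c p))"
    using chartsD[OF assms] open_cim[OF chartsD(1)[OF assms]]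
    by (subst has_derivative_cong_open[of "cim c" _ _ "\<lambda>x. x"]) (auto simp: transition_def)
  then show ?thesis unfolding jac_def by (rule fd_eqI)
qed

lemma jac_jac:
  assumes c: "c \<in> charts_at M p" and d: "d \<in> charts_at M p" and e: "e \<in> charts_at M p"
  shows "jac d e p (jac c d p v) = jac c e p v"
proof -
  note C = chartsD[OF c] and D = chartsD[OF d] and E = chartsD[OF e]
  have "(transition d e has_derivative jac d e p) (at (transition c d (cmap c p)))"
    using jac_has_derivative[OF d e] C by (simp add: transition_apply)
  from has_derivative_compose[OF jac_has_derivative[OF c d] this]
  have "((\<lambda>x. transition d e (transition c d x)) has_derivative (\<lambda>v. jac d e p (jac c d p v))) (at (cmap c p))" .
  moreover have "transition d e (transition c d x) = transition c e x" if "x \<in> cmap c ` (cdom c \<inter> cdom d)" for x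
    using that C D by (auto simp: transition_def)
  ultimately have "(transition c e has_derivative (\<lambda>v. jac d e p (jac c d p v))) (at (cmap c p))"
    using has_derivative_cong_open[OF open_overlap[OF C(1) D(1)], of "cmap c p"
        "\<lambda>x. transition d e (transition c d x)" "transition c e"] C D by simp
  then show ?thesis unfolding jac_def[of c e] by (simp add: fd_eqI)
qed

lemma tvec_of_apply: "d \<in> charts_at M p \<Longrightarrow> tvec_of M c p y d = jac c d p y"
  and tvec_of_outside: "d \<notin> charts_at M p \<Longrightarrow> tvec_of M c p y d = 0"
  by (simp_all add: tvec_of_def jac_def)

lemma tvec_of_same [simp]: "c \<in> charts_at M p \<Longrightarrow> tvec_of M c p y c = y"
  by (simp add: tvec_of_apply)

lemma tvec_of_tangent [simp]: "c \<in> charts_at M p \<Longrightarrow> tvec_of M c p y \<in> tangent_space M p"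
  unfolding tangent_space_def jac_def[symmetric] by (auto simp: tvec_of_apply tvec_of_outside jac_jac)

lemma tangent_jac: "v \<in> tangent_space M p \<Longrightarrow> c \<in> charts_at M p \<Longrightarrow> d \<in> charts_at M p \<Longrightarrow> v d = jac c d p (v c)"
  unfolding tangent_space_def jac_def by blast

lemma tangent_outside: "v \<in> tangent_space M p \<Longrightarrow> c \<notin> charts_at M p \<Longrightarrow> v c = 0"
  unfolding tangent_space_def by blast

text \<open>One chart suffices: the Jacobians determine the tuple in every other chart around
  \<open>p\<close>, and the remaining charts carry 0.\<close>

lemma tangent_eqI:
  assumes "v \<in> tangent_space M p" "w \<in> tangent_space M p" "c \<in> charts_at M p" "v c = w c"
  shows "v = w"
proof
  fix d show "v d = w d"
    using assms tangent_jac tangent_outside by (cases "d \<in> charts_at M p") metis+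
qed

lemma tvec_of_tangent_eq [simp]:
  "v \<in> tangent_space M p \<Longrightarrow> c \<in> charts_at M p \<Longrightarrow> tvec_of M c p (v c) = v"
  by (rule tangent_eqI[of _ p _ c]) auto

lemma tvec_of_jac: "c \<in> charts_at M p \<Longrightarrow> d \<in> charts_at M p \<Longrightarrow> tvec_of M d p (jac c d p y) = tvec_of M c p y"
  by (rule tangent_eqI[of _ p _ d]) (auto simp: tvec_of_apply)

lemma tangentI:
  assumes "\<And>c d. c \<in> charts_at M p \<Longrightarrow> d \<in> charts_at M p \<Longrightarrow> v d = jac c d p (v c)"
    and "\<And>c. c \<notin> charts_at M p \<Longrightarrow> v c = 0"
  shows "v \<in> tangent_space M p"
  using assms unfolding tangent_space_def jac_def by blast

lemma tangent_add [simp]: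
  assumes "v \<in> tangent_space M p" "w \<in> tangent_space M p"
  shows "tadd v w \<in> tangent_space M p"
proof (rule tangentI)
  fix c d assume cd: "c \<in> charts_at M p" "d \<in> charts_at M p"
  show "tadd v w d = jac c d p (tadd v w c)"
    by (simp only: tvec_simps linear_add[OF linear_jac[OF cd]] tangent_jac[OF assms(1) cd] tangent_jac[OF assms(2) cd])
qed (simp add: tangent_outside[OF assms(1)] tangent_outside[OF assms(2)])

lemma tangent_diff [simp]:
  assumes "v \<in> tangent_space M p" "w \<in> tangent_space M p"
  shows "tdiff v w \<in> tangent_space M p"
proof (rule tangentI)
  fix c d assume cd: "c \<in> charts_at M p" "d \<in> charts_at M p"
  show "tdiff v w d = jac c d p (tdiff v w c)"
    by (simp only: tvec_simps linear_diff[OF linear_jac[OF cd]] tangent_jac[OF assms(1) cd] tangent_jac[OF assms(2) cd])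
qed (simp add: tangent_outside[OF assms(1)] tangent_outside[OF assms(2)])

lemma tangent_scale [simp]:
  assumes "v \<in> tangent_space M p"
  shows "tscale a v \<in> tangent_space M p"
proof (rule tangentI)
  fix c d assume cd: "c \<in> charts_at M p" "d \<in> charts_at M p"
  show "tscale a v d = jac c d p (tscale a v c)"
    by (simp only: tvec_simps linear_scale[OF linear_jac[OF cd]] tangent_jac[OF assms(1) cd])
qed (simp add: tangent_outside[OF assms(1)])

lemma tzero_tangent [simp]: "tzero \<in> tangent_space M p"
proof -
  have "jac c d p 0 = 0" if "c \<in> charts_at M p" "d \<in> charts_at M p" for c d
    using linear_0[OF linear_jac[OF that]] .
  then show ?thesis by (auto simp: tangent_space_def tzero_def jac_def)
qed

lemma tvec_of_linear:
  assumes "c \<in> charts_at M p"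
  shows "tvec_of M c p (u + v) = tadd (tvec_of M c p u) (tvec_of M c p v)"
    "tvec_of M c p (a *\<^sub>R u) = tscale a (tvec_of M c p u)"
    "tvec_of M c p 0 = tzero"
proof -
  show "tvec_of M c p (u + v) = tadd (tvec_of M c p u) (tvec_of M c p v)"
    using assms by (intro tangent_eqI[of _ p _ c]) simp_all
  show "tvec_of M c p (a *\<^sub>R u) = tscale a (tvec_of M c p u)"
    using assms by (intro tangent_eqI[of _ p _ c]) simp_all
  show "tvec_of M c p 0 = tzero"
    using assms by (intro tangent_eqI[of _ p _ c]) simp_all
qed

lemma smooth_field_chart:
  assumes "smooth_field M W X" "c \<in> atlas M"
  shows "smooth_on (cmap c ` (W \<inter> cdom c)) (\<lambda>x. X (cinv c x) c)"
  using assms by (simp add: smooth_field_def)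

lemma smooth_field_tangent: "smooth_field M W X \<Longrightarrow> p \<in> W \<Longrightarrow> X p \<in> tangent_space M p"
  by (simp add: smooth_field_def)

section \<open>Smoothness and derivatives tested in a single chart\<close>

lemma smooth_transfer:
  fixes f :: "'a \<Rightarrow> 'b::real_normed_vector"
  assumes c: "c \<in> atlas M" and d: "d \<in> atlas M" and W: "openin (mtop M) W" "W \<subseteq> cdom c"
    and f: "smooth_on (cmap c ` W) (\<lambda>x. f (cinv c x))"
  shows "smooth_on (cmap d ` (W \<inter> cdom d)) (\<lambda>x. f (cinv d x))"
proof -
  have Wc: "cmap c ` W = cmap c ` (W \<inter> cdom c)" using W(2) by (simp add: Int_absorb2)
  have o: "open (cmap d ` (W \<inter> cdom d))" by (rule open_image[OF d W(1)])
  have "smooth_on (cmap d ` (W \<inter> cdom d)) (\<lambda>x. f (cinv c (transition d c x)))"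
  proof (rule smooth_on_compose[OF o _ _ _ f])
    show "open (cmap c ` W)" unfolding Wc by (rule open_image[OF c W(1)])
    show "transition d c ` cmap d ` (W \<inter> cdom d) \<subseteq> cmap c ` W"
      using W(2) d by (auto simp: transition_def)
    show "smooth_on (cmap d ` (W \<inter> cdom d)) (transition d c)"
      by (rule smooth_on_subset[OF smooth_transition[OF d c]]) (use W(2) in auto)
  qed
  then show ?thesis
    using smooth_on_cong[OF o, of "\<lambda>x. f (cinv d x)" "\<lambda>x. f (cinv c (transition d c x))"] W(2) c d
    by (force simp: transition_def)
qed

text \<open>The coordinates in another chart \<open>d\<close> are the derivative of the transition,
  taken at a moving point, applied to the coordinates in \<open>c\<close>; both ingredients are
  smooth on the overlap.\<close>

lemma smooth_field_single_chart:
  assumes c: "c \<in> atlas M" and W: "openin (mtop M) W" "W \<subseteq> cdom c"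
    and t: "\<And>p. p \<in> W \<Longrightarrow> X p \<in> tangent_space M p"
    and s: "smooth_on (cmap c ` W) (\<lambda>x. X (cinv c x) c)"
  shows "smooth_field M W X"
  unfolding smooth_field_def
proof (intro conjI ballI t)
  fix d assume d: "d \<in> atlas M"
  have o: "open (cmap d ` (W \<inter> cdom d))" by (rule open_image[OF d W(1)])
  have *: "X (cinv d x) d = fd (transition c d) (transition d c x) (X (cinv d x) c)"
    if "x \<in> cmap d ` (W \<inter> cdom d)" for x
  proof -
    from that obtain p where p: "p \<in> W" "p \<in> cdom d" "x = cmap d p" by auto
    then show ?thesis
      using tangent_jac[OF t[OF p(1)], of c d] W(2) c d
      by (auto simp: jac_def transition_def intro: chartsI)
  qed
  have tr: "smooth_on (cmap d ` (W \<inter> cdom d)) (transition d c)"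
    by (rule smooth_on_subset[OF smooth_transition[OF d c]]) (use W(2) in auto)
  have "smooth_on (cmap d ` (W \<inter> cdom d)) (\<lambda>x. fd (transition c d) (transition d c x) (X (cinv d x) c))"
  proof (rule smooth_on_apply_linear[OF o, where L = "\<lambda>x. fd (transition c d) (transition d c x)" and f = "\<lambda>x. X (cinv d x) c"])
    show "smooth_on (cmap d ` (W \<inter> cdom d)) (\<lambda>x. X (cinv d x) c)"
      by (rule smooth_transfer[OF c d W s])
    show "smooth_on (cmap d ` (W \<inter> cdom d)) (\<lambda>x. fd (transition c d) (transition d c x) b)" for b
      by (rule smooth_on_compose[where g = "\<lambda>z. fd (transition c d) z b", OF o open_overlap[OF c d] _ tr smooth_on_fd[OF smooth_transition[OF c d]]])
        (use W(2) c d in \<open>auto simp: transition_def\<close>)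
    show "linear (fd (transition c d) (transition d c x))" if "x \<in> cmap d ` (W \<inter> cdom d)" for x
    proof -
      from that obtain p where p: "p \<in> W" "p \<in> cdom d" "x = cmap d p" by auto
      then have "p \<in> cdom c" using W(2) by auto
      with p show ?thesis
        using linear_jac[OF chartsI[OF c] chartsI[OF d], of p] transition_apply[OF d, of p c] by (simp add: jac_def)
    qed
  qed
  then show "smooth_on (cmap d ` (W \<inter> cdom d)) (\<lambda>x. X (cinv d x) d)"
    using smooth_on_cong[OF o, where f = "\<lambda>x. X (cinv d x) d", OF *] by (simp only:)
qed

lemma smooth_field_cfield:
  assumes c: "c \<in> atlas M"
  shows "smooth_field M (cdom c) (cfield M c v)"
proof (rule smooth_field_single_chart[OF c open_cdom[OF c] subset_refl])
  show "p \<in> cdom c \<Longrightarrow> cfield M c v p \<in> tangent_space M p" for p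
    using c by (simp add: cfield_def chartsI)
  have "smooth_on (cim c) (\<lambda>x. cfield M c v (cinv c x) c)"
    using c by (subst smooth_on_cong[OF open_cim[OF c], of _ "\<lambda>x. v"])
       (auto simp: cfield_def smooth_on_const chartsI)
  then show "smooth_on (cmap c ` cdom c) (\<lambda>x. cfield M c v (cinv c x) c)"
    by (simp add: cim_def)
qed

lemma smooth_field_subset: "smooth_field M W X \<Longrightarrow> V \<subseteq> W \<Longrightarrow> smooth_field M V X"
  unfolding smooth_field_def
  by (meson Int_mono image_mono smooth_on_subset subset_iff subset_refl)

lemma smooth_fun_single_chart:
  assumes "c \<in> atlas M" "openin (mtop M) W" "W \<subseteq> cdom c" "smooth_on (cmap c ` W) (\<lambda>x. f (cinv c x))"
  shows "smooth_fun M W f"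
  unfolding smooth_fun_def comp_def using smooth_transfer[OF assms(1) _ assms(2,3,4)] by blast

text \<open>\<open>vec_deriv\<close> is defined with an arbitrary chart; the chain rule moves it to
  the chart \<open>c\<close> in which one computes.\<close>

lemma vec_deriv_chart:
  assumes W: "openin (mtop M) W" "smooth_fun M W f" "p \<in> W"
    and v: "v \<in> tangent_space M p" and c: "c \<in> charts_at M p"
  shows "vec_deriv M p v f = fd (\<lambda>x. f (cinv c x)) (cmap c p) (v c)"
proof -
  define d where "d = chart_at M p"
  have d: "d \<in> charts_at M p"
    unfolding d_def using charts_at_topspace[OF c] by (rule chart_at)
  note C = chartsD[OF c] and D = chartsD[OF d]
  have "(\<lambda>x. f (cinv d x)) differentiable (at (cmap d p))"
    using W(2,3) D smooth_on_differentiable[of "cmap d ` (W \<inter> cdom d)" "f \<circ> cinv d" "cmap d p"]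
    by (auto simp: smooth_fun_def comp_def)
  then have "((\<lambda>x. f (cinv d x)) has_derivative fd (\<lambda>x. f (cinv d x)) (cmap d p)) (at (transition c d (cmap c p)))"
    using C by (simp add: transition_apply has_derivative_fd)
  from has_derivative_compose[OF jac_has_derivative[OF c d] this]
  have "((\<lambda>x. f (cinv d (transition c d x))) has_derivative (\<lambda>u. fd (\<lambda>x. f (cinv d x)) (cmap d p) (jac c d p u))) (at (cmap c p))" .
  moreover have "f (cinv d (transition c d x)) = f (cinv c x)" if "x \<in> cmap c ` (cdom c \<inter> cdom d)" for x
    using that C D by (auto simp: transition_def)
  ultimately have "((\<lambda>x. f (cinv c x)) has_derivative (\<lambda>u. fd (\<lambda>x. f (cinv d x)) (cmap d p) (jac c d p u))) (at (cmap c p))"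
    using has_derivative_cong_open[OF open_overlap[OF C(1) D(1)], of "cmap c p" "\<lambda>x. f (cinv d (transition c d x))" "\<lambda>x. f (cinv c x)"] C D by blast
  then have "fd (\<lambda>x. f (cinv c x)) (cmap c p) (v c) = fd (\<lambda>x. f (cinv d x)) (cmap d p) (v d)"
    using tangent_jac[OF v c d] by (simp add: fd_eqI)
  then show ?thesis by (simp add: vec_deriv_def d_def comp_def Let_def)
qed

end

subsection \<open>Linear connections in coordinates\<close>

text \<open>The Christoffel symbols in the chart \<open>c\<close>, as a bilinear map at the coordinate point \<open>x\<close>.\<close>

definition gam :: "('a, 'n::finite) manifold \<Rightarrow> ('a, 'n) connection \<Rightarrow> ('a, 'n) chart \<Rightarrow> real^'n \<Rightarrow> real^'n \<Rightarrow> real^'n \<Rightarrow> real^'n" where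
  "gam M D c x u v = (\<Sum>j\<in>UNIV. v $ j *\<^sub>R D (cinv c x) (tvec_of M c (cinv c x) u) (coord_field M c j) c)"

definition tor :: "('a, 'n::finite) manifold \<Rightarrow> ('a, 'n) connection \<Rightarrow> ('a, 'n) chart \<Rightarrow> real^'n \<Rightarrow> real^'n \<Rightarrow> real^'n \<Rightarrow> real^'n" where
  "tor M D c x u v = gam M D c x u v - gam M D c x v u"

locale lin_conn = smooth_mfd M for M :: "('a, 'n::finite) manifold" +
  fixes D :: "('a, 'n) connection"
  assumes conn: "linear_connection M D"
begin

abbreviation "\<Gamma> \<equiv> gam M D"

lemma D_smooth:
  assumes "openin (mtop M) W" "smooth_field M W X" "smooth_field M W Y"
  shows "smooth_field M W (\<lambda>p. D p (X p) Y)"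
  using assms conn[unfolded linear_connection_def, THEN conjunct1, rule_format, of W X Y] by simp

lemma D_linear:
  assumes "openin (mtop M) W" "smooth_field M W Y" "p \<in> W" "v \<in> tangent_space M p" "w \<in> tangent_space M p"
  shows "D p (tadd v w) Y = tadd (D p v Y) (D p w Y)" "D p (tscale a v) Y = tscale a (D p v Y)"
  using assms conn[unfolded linear_connection_def, THEN conjunct2, THEN conjunct1, rule_format, of W Y p v w a] by simp_all

lemma D_add:
  assumes "openin (mtop M) W" "smooth_field M W Y" "smooth_field M W Z" "p \<in> W" "v \<in> tangent_space M p"
  shows "D p v (\<lambda>q. tadd (Y q) (Z q)) = tadd (D p v Y) (D p v Z)"
  using assms conn[unfolded linear_connection_def, THEN conjunct2, THEN conjunct2, THEN conjunct1, rule_format, of W Y Z p v] by simp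

lemma D_leibniz:
  assumes "openin (mtop M) W" "smooth_field M W Y" "smooth_fun M W f" "p \<in> W" "v \<in> tangent_space M p"
  shows "D p v (\<lambda>q. tscale (f q) (Y q)) = tadd (tscale (vec_deriv M p v f) (Y p)) (tscale (f p) (D p v Y))"
  using assms conn[unfolded linear_connection_def, THEN conjunct2, THEN conjunct2, THEN conjunct2, rule_format, of W Y f p v] by simp

text \<open>Locality comes from the Leibniz rule for the indicator function of \<open>W\<close>, which is smooth on \<open>W\<close>.\<close>

lemma D_local:
  assumes W: "openin (mtop M) W" and Y: "smooth_field M W Y" and p: "p \<in> W" and v: "v \<in> tangent_space M p"
    and eq: "\<And>q. q \<in> W \<Longrightarrow> Y q = Z q" and Z: "smooth_field M W Z"
  shows "D p v Y = D p v Z"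
proof -
  obtain c where c: "c \<in> charts_at M p"
    using chart_at openin_subset[OF W] p by blast
  define f :: "'a \<Rightarrow> real" where "f = indicator W"
  have f: "smooth_fun M W f"
    unfolding smooth_fun_def
  proof
    fix c assume c: "c \<in> atlas M"
    show "smooth_on (cmap c ` (W \<inter> cdom c)) (f \<circ> cinv c)"
      using c by (subst smooth_on_cong[OF open_image[OF c W], of _ "\<lambda>_. 1"]) (auto simp: f_def smooth_on_const)
  qed
  have "fd (\<lambda>x. f (cinv c x)) (cmap c p) = fd (\<lambda>x. 1) (cmap c p)"
    by (rule fd_cong_open[OF open_image[OF chartsD(1)[OF c] W]]) (use p chartsD[OF c] in \<open>auto simp: f_def\<close>)
  then have vd: "vec_deriv M p v f = 0"
    using vec_deriv_chart[OF W f p v c] by simp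
  have fp: "f p = 1" using p by (simp add: f_def)
  have "D p v (\<lambda>q. tscale (f q) (Y q)) = D p v Y"
    unfolding D_leibniz[OF W Y f p v] vd fp by (rule ext) simp
  moreover have "D p v (\<lambda>q. tscale (f q) (Z q)) = D p v Z"
    unfolding D_leibniz[OF W Z f p v] vd fp by (rule ext) simp
  moreover have "(\<lambda>q. tscale (f q) (Y q)) = (\<lambda>q. tscale (f q) (Z q))"
  proof
    fix q show "tscale (f q) (Y q) = tscale (f q) (Z q)"
      using eq by (cases "q \<in> W") (auto simp: f_def tscale_def)
  qed
  ultimately show ?thesis by simp
qed

text \<open>\<open>D_smooth\<close> gives tangency only when the direction is the value of a field.
  The vector \<open>v\<close> is extended by the field with its coordinates in
  \<open>c\<close>.\<close>

lemma D_tangent: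
  assumes W: "openin (mtop M) W" and Y: "smooth_field M W Y" and p: "p \<in> W" and v: "v \<in> tangent_space M p"
  shows "D p v Y \<in> tangent_space M p"
proof -
  obtain c where c: "c \<in> charts_at M p"
    using chart_at openin_subset[OF W] p by blast
  have "smooth_field M (W \<inter> cdom c) (\<lambda>q. D q (cfield M c (v c) q) Y)"
    by (rule D_smooth) (use W open_cdom smooth_field_subset[OF Y] smooth_field_subset[OF smooth_field_cfield] chartsD[OF c] in auto)
  from smooth_field_tangent[OF this, of p] show ?thesis
    using p chartsD[OF c] c v by (simp add: cfield_def)
qed

lemma coord_field_eq: "coord_field M c j = cfield M c (axis j 1)"
  by (auto simp: coord_field_def cfield_def)

lemma smooth_coord: "c \<in> atlas M \<Longrightarrow> smooth_field M (cdom c) (coord_field M c j)"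
  unfolding coord_field_eq by (rule smooth_field_cfield)

lemma gam_axis:
  assumes c: "c \<in> charts_at M p" and v: "v \<in> tangent_space M p"
  shows "D p v (coord_field M c j) c = \<Gamma> c (cmap c p) (v c) (axis j 1)"
  using chartsD[OF c] c v
  by (simp add: gam_def axis_def if_distrib[of "\<lambda>a. a *\<^sub>R _"] sum.If_cases cong: if_cong)

lemma linear_gam_right: "linear (\<Gamma> c x u)"
  by (rule linearI) (auto simp: gam_def algebra_simps sum.distrib scaleR_sum_right)

lemma linear_gam_left:
  assumes c: "c \<in> atlas M" and x: "x \<in> cim c"
  shows "linear (\<lambda>u. \<Gamma> c x u v)"
proof -
  have p: "c \<in> charts_at M (cinv c x)" using c x by (simp add: chartsI)
  note L = D_linear[OF open_cdom[OF c] smooth_coord[OF c] cinv_cdom[OF x] tvec_of_tangent[OF p] tvec_of_tangent[OF p]]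
  show ?thesis
    by (rule linearI) (simp_all add: gam_def tvec_of_linear[OF p] L sum.distrib algebra_simps scaleR_sum_right)
qed

text \<open>The axioms know only binary sums, so a combination of coordinate fields is
  differentiated by induction, carrying smoothness of the partial sums along.\<close>

lemma D_sum:
  assumes W: "openin (mtop M) W" "p \<in> W" and v: "v \<in> tangent_space M p" and c: "c \<in> atlas M" "W \<subseteq> cdom c"
    and f: "\<And>j. smooth_fun M W (f j)" and A: "finite A"
  shows "smooth_field M W (\<lambda>q. \<lambda>d. \<Sum>j\<in>A. f j q *\<^sub>R coord_field M c j q d) \<and>
    D p v (\<lambda>q. \<lambda>d. \<Sum>j\<in>A. f j q *\<^sub>R coord_field M c j q d) c =
    (\<Sum>j\<in>A. vec_deriv M p v (f j) *\<^sub>R axis j 1 + f j p *\<^sub>R D p v (coord_field M c j) c)"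
  using A
proof (induction A rule: finite_induct)
  case empty
  have z: "(\<lambda>q. \<lambda>d. 0) = (\<lambda>q. tzero :: ('a, 'n) tvec)" by (auto simp: tzero_def fun_eq_iff)
  have s: "smooth_field M W (\<lambda>q. tzero)"
    unfolding smooth_field_def by (auto simp: smooth_on_const)
  \<comment> \<open>The zero field: additivity gives \<open>z = z + z\<close>, hence
    \<open>z = 0\<close>, for its covariant derivative \<open>z\<close>.\<close>
  have "D p v (\<lambda>q. tadd tzero tzero) = tadd (D p v (\<lambda>q. tzero)) (D p v (\<lambda>q. tzero))"
    by (rule D_add[OF W(1) s s W(2) v])
  moreover have "(\<lambda>q. tadd tzero tzero) = (\<lambda>q. tzero :: ('a, 'n) tvec)" by (auto simp: tzero_def tadd_def)
  ultimately have "D p v (\<lambda>q. tzero) c = D p v (\<lambda>q. tzero) c + D p v (\<lambda>q. tzero) c"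
    by (metis tvec_simps(1))
  then show ?case using s by (simp add: z)
next
  case (insert j A)
  define Y where "Y = (\<lambda>q. tscale (f j q) (coord_field M c j q))"
  define Z where "Z = (\<lambda>q. \<lambda>d. \<Sum>j\<in>A. f j q *\<^sub>R coord_field M c j q d)"
  have co: "smooth_field M W (coord_field M c j)"
    by (rule smooth_field_subset[OF smooth_coord[OF c(1)] c(2)])
  have tan: "coord_field M c j q \<in> tangent_space M q" if "q \<in> W" for q
    by (rule smooth_field_tangent[OF co that])
  have Y: "smooth_field M W Y"
    unfolding smooth_field_def
  proof (intro conjI ballI)
    fix d assume d: "d \<in> atlas M"
    show "smooth_on (cmap d ` (W \<inter> cdom d)) (\<lambda>x. Y (cinv d x) d)"
      using f[of j] d co
      by (auto simp: Y_def smooth_fun_def smooth_field_def comp_def intro!: smooth_on_scaleR open_image W)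
  qed (auto simp: Y_def tan)
  have Z: "smooth_field M W Z" using insert.IH by (simp add: Z_def)
  have YZ: "(\<lambda>q. \<lambda>d. \<Sum>j\<in>insert j A. f j q *\<^sub>R coord_field M c j q d) = (\<lambda>q. tadd (Y q) (Z q))"
    using insert.hyps by (auto simp: Y_def Z_def tadd_def tscale_def fun_eq_iff)
  have "smooth_field M W (\<lambda>q. tadd (Y q) (Z q))"
    unfolding smooth_field_def
  proof (intro conjI ballI)
    fix d assume d: "d \<in> atlas M"
    show "smooth_on (cmap d ` (W \<inter> cdom d)) (\<lambda>x. tadd (Y (cinv d x)) (Z (cinv d x)) d)"
      using Y Z d by (auto simp: smooth_field_def intro!: smooth_on_add open_image W)
  qed (use Y Z in \<open>auto simp: smooth_field_def\<close>)
  moreover have "D p v (\<lambda>q. tadd (Y q) (Z q)) c = D p v Y c + D p v Z c"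
    using D_add[OF W(1) Y Z W(2) v] by simp
  moreover have "D p v Y c = vec_deriv M p v (f j) *\<^sub>R axis j 1 + f j p *\<^sub>R D p v (coord_field M c j) c"
    using D_leibniz[OF W(1) co f W(2) v] W(2) c by (auto simp: Y_def coord_field_def chartsI)
  moreover have "D p v Z c = (\<Sum>j\<in>A. vec_deriv M p v (f j) *\<^sub>R axis j 1 + f j p *\<^sub>R D p v (coord_field M c j) c)"
    using insert.IH by (simp add: Z_def)
  ultimately show ?case unfolding YZ using insert.hyps by simp
qed

text \<open>On \<open>W \<inter> cdom c\<close> the field coincides with the combination of
  coordinate fields that has its components as coefficients. By \<open>D_local\<close> the two may
  be exchanged, and \<open>D_sum\<close> evaluates the second.\<close>

lemma D_chart:
  assumes W: "openin (mtop M) W" and Y: "smooth_field M W Y" and p: "p \<in> W" and v: "v \<in> tangent_space M p"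
    and c: "c \<in> charts_at M p"
  shows "D p v Y c = fd (\<lambda>x. Y (cinv c x) c) (cmap c p) (v c) + \<Gamma> c (cmap c p) (v c) (Y p c)"
proof -
  note C = chartsD[OF c]
  define V where "V = W \<inter> cdom c"
  have V: "openin (mtop M) V" "p \<in> V" "V \<subseteq> cdom c" "V \<subseteq> W"
    using W p C open_cdom by (auto simp: V_def)
  have YV: "smooth_field M V Y" by (rule smooth_field_subset[OF Y V(4)])
  define f where "f j q = Y q c $ j" for j q
  have sY: "smooth_on (cmap c ` V) (\<lambda>x. Y (cinv c x) c)"
    using smooth_field_chart[OF YV C(1)] V(3) by (simp add: Int_absorb2)
  have oV: "open (cmap c ` V)" using open_image[OF C(1) V(1)] V(3) by (simp add: Int_absorb2)
  have f: "smooth_fun M V (f j)" for j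
    unfolding f_def
    by (intro smooth_fun_single_chart[OF C(1) V(1,3)] smooth_on_linear[OF oV bounded_linear_vec_nth] sY)
  define Y' where "Y' = (\<lambda>q. \<lambda>d. \<Sum>j\<in>UNIV. f j q *\<^sub>R coord_field M c j q d)"
  note S = D_sum[OF V(1,2) v C(1) V(3) f finite]
  have Y': "smooth_field M V Y'" using S by (simp add: Y'_def)
  have eq: "Y q = Y' q" if q: "q \<in> V" for q
  proof (rule tangent_eqI[OF smooth_field_tangent[OF YV q] smooth_field_tangent[OF Y' q], of c])
    show cq: "c \<in> charts_at M q" using q V(3) C by (auto intro: chartsI)
    show "Y q c = Y' q c" using cq
      by (simp add: Y'_def f_def coord_field_def vec_eq_iff axis_def if_distrib sum.If_cases cong: if_cong)
  qed
  have dY: "(\<lambda>x. Y (cinv c x) c) differentiable (at (cmap c p))"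
    by (rule smooth_on_differentiable[OF sY]) (use V in auto)
  have vf: "vec_deriv M p v (f j) = fd (\<lambda>x. Y (cinv c x) c) (cmap c p) (v c) $ j" for j
    unfolding vec_deriv_chart[OF V(1) f V(2) v c] f_def
    by (rule fd_apply) (intro bounded_linear.has_derivative[OF bounded_linear_vec_nth] has_derivative_fd dY)
  have "D p v Y c = D p v Y' c"
    using D_local[OF V(1) YV V(2) v eq Y'] by simp
  also have "\<dots> = (\<Sum>j\<in>UNIV. vec_deriv M p v (f j) *\<^sub>R axis j 1 + f j p *\<^sub>R D p v (coord_field M c j) c)"
    using S by (simp add: Y'_def)
  also have "\<dots> = fd (\<lambda>x. Y (cinv c x) c) (cmap c p) (v c) + (\<Sum>j\<in>UNIV. f j p *\<^sub>R D p v (coord_field M c j) c)"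
    by (simp add: sum.distrib vf vec_eq_iff axis_def if_distrib sum.If_cases cong: if_cong)
  also have "(\<Sum>j\<in>UNIV. f j p *\<^sub>R D p v (coord_field M c j) c) = \<Gamma> c (cmap c p) (v c) (Y p c)"
    using C c v by (simp add: gam_def f_def)
  finally show ?thesis .
qed

lemma cfield_chart: "c \<in> atlas M \<Longrightarrow> x \<in> cim c \<Longrightarrow> cfield M c v (cinv c x) c = v"
  by (simp add: cfield_def chartsI)

lemma fd_cfield: "c \<in> atlas M \<Longrightarrow> x \<in> cim c \<Longrightarrow> fd (\<lambda>x. cfield M c v (cinv c x) c) x = (\<lambda>h. 0)"
  using fd_cong_open[OF open_cim, of c x "\<lambda>x. cfield M c v (cinv c x) c" "\<lambda>x. v"] by (simp add: cfield_chart)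

text \<open>For two fields with constant coordinates the covariant derivative is the Christoffel map
  itself, and the axioms make it a smooth field.\<close>

lemma smooth_gam:
  assumes c: "c \<in> atlas M"
  shows "smooth_on (cim c) (\<lambda>x. \<Gamma> c x u v)"
proof -
  have "smooth_field M (cdom c) (\<lambda>q. D q (cfield M c u q) (cfield M c v))"
    by (intro D_smooth open_cdom smooth_field_cfield c)
  from smooth_field_chart[OF this c]
  have "smooth_on (cim c) (\<lambda>x. D (cinv c x) (cfield M c u (cinv c x)) (cfield M c v) c)" by (simp add: cim_def)
  moreover have "D (cinv c x) (cfield M c u (cinv c x)) (cfield M c v) c = \<Gamma> c x u v" if x: "x \<in> cim c" for x
  proof -
    have p: "c \<in> charts_at M (cinv c x)" using c x by (simp add: chartsI)
    show ?thesis
      using D_chart[OF open_cdom[OF c] smooth_field_cfield[OF c] cinv_cdom[OF x] _ p, of "cfield M c u (cinv c x)" v] x c p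
      by (simp add: fd_cfield) (simp add: cfield_def)
  qed
  ultimately show ?thesis using smooth_on_cong[OF open_cim[OF c]] by (metis (no_types, lifting))
qed

lemma gam_differentiable: "c \<in> atlas M \<Longrightarrow> x \<in> cim c \<Longrightarrow> (\<lambda>x. \<Gamma> c x u v) differentiable (at x)"
  using smooth_on_differentiable[OF smooth_gam] by blast

text \<open>One covariant derivative computed in two charts. The field constant in \<open>c\<close>
  has in \<open>d\<close> the columns of the Jacobian as coordinates, whence the second derivative
  of the transition.\<close>

lemma gam_transform:
  assumes c: "c \<in> charts_at M p" and d: "d \<in> charts_at M p"
  shows "jac c d p (\<Gamma> c (cmap c p) u v) =
    fd (\<lambda>z. fd (transition c d) z v) (cmap c p) u + \<Gamma> d (cmap d p) (jac c d p u) (jac c d p v)"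
proof -
  note C = chartsD[OF c] and E = chartsD[OF d]
  let ?Y = "cfield M c v" and ?v = "tvec_of M c p u"
  note Dc = D_chart[OF open_cdom[OF C(1)] smooth_field_cfield[OF C(1)] C(2) tvec_of_tangent[OF c]]
  have 1: "D p ?v ?Y c = \<Gamma> c (cmap c p) u v"
    using Dc[OF c, of u v] C c by (simp add: fd_cfield) (simp add: cfield_def)
  have 2: "D p ?v ?Y d = fd (\<lambda>x. ?Y (cinv d x) d) (cmap d p) (jac c d p u) + \<Gamma> d (cmap d p) (jac c d p u) (jac c d p v)"
    using Dc[OF d, of u v] d by (simp add: tvec_of_apply) (simp add: cfield_def tvec_of_apply)
  have 3: "D p ?v ?Y d = jac c d p (D p ?v ?Y c)"
    by (rule tangent_jac[OF D_tangent[OF open_cdom[OF C(1)] smooth_field_cfield[OF C(1)] C(2) tvec_of_tangent[OF c]] c d])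
  let ?g = "\<lambda>z. fd (transition c d) z v"
  have "?g differentiable (at (cmap c p))"
    by (rule smooth_on_differentiable[OF smooth_on_fd[OF smooth_transition[OF C(1) E(1)]]]) (use C E in auto)
  then have "(?g has_derivative fd ?g (cmap c p)) (at (transition d c (cmap d p)))"
    using E by (simp add: transition_apply has_derivative_fd)
  from has_derivative_compose[OF jac_has_derivative[OF d c] this]
  have 4: "((\<lambda>x. ?g (transition d c x)) has_derivative (\<lambda>h. fd ?g (cmap c p) (jac d c p h))) (at (cmap d p))" .
  have 5: "?g (transition d c x) = ?Y (cinv d x) d" if "x \<in> cmap d ` (cdom d \<inter> cdom c)" for x
    using that C E by (auto simp: transition_def cfield_def tvec_of_apply jac_def chartsI)
  have "fd (\<lambda>x. ?Y (cinv d x) d) (cmap d p) = fd (\<lambda>x. ?g (transition d c x)) (cmap d p)"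
    by (rule fd_cong_open[OF open_overlap[OF E(1) C(1)]]) (use C E in \<open>auto simp: 5[symmetric]\<close>)
  then have "fd (\<lambda>x. ?Y (cinv d x) d) (cmap d p) (jac c d p u) = fd ?g (cmap c p) u"
    using fd_apply[OF 4, of "jac c d p u"] jac_jac[OF c d c] c by simp
  then show ?thesis using 1 2 3 by simp
qed

section \<open>Torsion and Lie bracket in coordinates\<close>

text \<open>The inhomogeneous term of \<open>gam_transform\<close> is symmetric in \<open>u\<close>
  and \<open>v\<close> and drops out of the difference.\<close>

lemma tor_transform:
  assumes c: "c \<in> charts_at M p" and d: "d \<in> charts_at M p"
  shows "jac c d p (tor M D c (cmap c p) u v) = tor M D d (cmap d p) (jac c d p u) (jac c d p v)"
proof -
  note C = chartsD[OF c] and E = chartsD[OF d]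
  have "fd (\<lambda>z. fd (transition c d) z v) (cmap c p) u = fd (\<lambda>z. fd (transition c d) z u) (cmap c p) v"
    by (rule fd_fd_commute[OF open_overlap[OF C(1) E(1)] _ smooth_onD[OF smooth_transition[OF C(1) E(1)]]]) (use C E in auto)
  then show ?thesis
    using gam_transform[OF c d] by (simp add: tor_def linear_diff[OF linear_jac[OF c d]])
qed

text \<open>Torsion as a pointwise map on tangent vectors, in contrast to \<open>torsion\<close>,
  which takes fields. The arbitrary chart is harmless by \<open>tor_transform\<close>.\<close>

definition tort :: "'a \<Rightarrow> ('a, 'n) tvec \<Rightarrow> ('a, 'n) tvec \<Rightarrow> ('a, 'n) tvec" where
  "tort p v w = tvec_of M (chart_at M p) p (tor M D (chart_at M p) (cmap (chart_at M p) p) (v (chart_at M p)) (w (chart_at M p)))"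

lemma tort_tangent [simp]: "p \<in> topspace (mtop M) \<Longrightarrow> tort p v w \<in> tangent_space M p"
  using chart_at by (simp add: tort_def)

lemma tort_chart:
  assumes "v \<in> tangent_space M p" "w \<in> tangent_space M p" "c \<in> charts_at M p"
  shows "tort p v w c = tor M D c (cmap c p) (v c) (w c)"
proof -
  have d: "chart_at M p \<in> charts_at M p" using chart_at charts_at_topspace[OF assms(3)] by blast
  show ?thesis
    using tor_transform[OF d assms(3)] tangent_jac[OF assms(1) d assms(3)] tangent_jac[OF assms(2) d assms(3)]
    by (simp add: tort_def tvec_of_apply[OF assms(3)])
qed

text \<open>Expresses the bracket through objects already known to be tangent vectors, so that its
  own transformation law comes for free.\<close>

lemma lie_bracket_eq:
  assumes W: "openin (mtop M) W" and X: "smooth_field M W X" and Y: "smooth_field M W Y" and p: "p \<in> W"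
  shows "lie_bracket M X Y p = tdiff (tdiff (D p (X p) Y) (D p (Y p) X)) (tort p (X p) (Y p))"
proof
  fix c
  note Xp = smooth_field_tangent[OF X p] and Yp = smooth_field_tangent[OF Y p]
  have pt: "p \<in> topspace (mtop M)" using openin_subset[OF W] p by blast
  show "lie_bracket M X Y p c = tdiff (tdiff (D p (X p) Y) (D p (Y p) X)) (tort p (X p) (Y p)) c"
  proof (cases "c \<in> charts_at M p")
    case True
    show ?thesis
      using True D_chart[OF W X p Yp True] D_chart[OF W Y p Xp True] tort_chart[OF Xp Yp True]
      by (simp add: lie_bracket_def tor_def)
  next
    case False
    then have "tdiff (tdiff (D p (X p) Y) (D p (Y p) X)) (tort p (X p) (Y p)) c = 0"
      using tangent_outside[OF D_tangent[OF W X p Yp] False] tangent_outside[OF D_tangent[OF W Y p Xp] False]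
        tangent_outside[OF tort_tangent[OF pt] False] by simp
    then show ?thesis using False by (simp add: lie_bracket_def)
  qed
qed

lemma lie_bracket_tangent:
  assumes W: "openin (mtop M) W" and X: "smooth_field M W X" and Y: "smooth_field M W Y" and p: "p \<in> W"
  shows "lie_bracket M X Y p \<in> tangent_space M p"
  using lie_bracket_eq[OF assms] D_tangent[OF W X p smooth_field_tangent[OF Y p]]
    D_tangent[OF W Y p smooth_field_tangent[OF X p]] openin_subset[OF W] p by auto

lemma torsion_eq:
  assumes W: "openin (mtop M) W" and X: "smooth_field M W X" and Y: "smooth_field M W Y" and p: "p \<in> W"
  shows "torsion M D X Y p = tort p (X p) (Y p)"
  unfolding torsion_def lie_bracket_eq[OF assms] by (rule ext) simp

section \<open>Curvature in coordinates\<close>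

lemma smooth_gam_fields:
  assumes c: "c \<in> atlas M" and S: "open S" "S \<subseteq> cim c" and X: "smooth_on S X" and Y: "smooth_on S Y"
  shows "smooth_on S (\<lambda>x. \<Gamma> c x (X x) (Y x))"
proof -
  have "smooth_on S (\<lambda>x. (\<lambda>x u. \<Gamma> c x u (Y x)) x (X x))"
  proof (rule smooth_on_apply_linear[OF S(1) X])
    show "linear (\<lambda>u. \<Gamma> c x u (Y x))" if "x \<in> S" for x
      using linear_gam_left[OF c, of x "Y x"] that S by auto
    fix b :: "real^'n"
    show "smooth_on S (\<lambda>x. \<Gamma> c x b (Y x))"
      by (rule smooth_on_apply_linear[OF S(1) Y, of "\<lambda>x. \<Gamma> c x b"])
        (auto intro: linear_gam_right smooth_on_subset[OF smooth_gam[OF c] S(2)])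
  qed
  then show ?thesis by simp
qed

text \<open>The curvature \<open>R(u,v)w\<close> on fields with constant coordinates, which commute,
  so that the bracket term is absent.\<close>

definition curv :: "('a, 'n) chart \<Rightarrow> real^'n \<Rightarrow> real^'n \<Rightarrow> real^'n \<Rightarrow> real^'n \<Rightarrow> real^'n" where
  "curv c x u v w = fd (\<lambda>x. \<Gamma> c x v w) x u - fd (\<lambda>x. \<Gamma> c x u w) x v
     + \<Gamma> c x u (\<Gamma> c x v w) - \<Gamma> c x v (\<Gamma> c x u w)"

lemma fd_gam:
  assumes c: "c \<in> atlas M" and x: "x \<in> cim c" and Y: "Y differentiable (at x)" and Z: "Z differentiable (at x)"
  shows "((\<lambda>z. \<Gamma> c z (Y z) (Z z)) has_derivative
     (\<lambda>h. fd (\<lambda>z. \<Gamma> c z (Y x) (Z x)) x h + \<Gamma> c x (fd Y x h) (Z x) + \<Gamma> c x (Y x) (fd Z x h))) (at x)"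
proof -
  note o = open_cim[OF c]
  have 1: "((\<lambda>z. \<Gamma> c z b (Z z)) has_derivative (\<lambda>h. fd (\<lambda>z. \<Gamma> c z b (Z x)) x h + \<Gamma> c x b (fd Z x h))) (at x)" for b
    by (rule has_derivative_apply_linear[OF o x Z linear_gam_right gam_differentiable[OF c x]])
  have "((\<lambda>z. (\<lambda>z u. \<Gamma> c z u (Z z)) z (Y z)) has_derivative
     (\<lambda>h. fd (\<lambda>z. (\<lambda>z u. \<Gamma> c z u (Z z)) z (Y x)) x h + (\<lambda>z u. \<Gamma> c z u (Z z)) x (fd Y x h))) (at x)"
    by (rule has_derivative_apply_linear[OF o x Y linear_gam_left[OF c] differentiableI[OF 1]])
  then show ?thesis unfolding fd_apply[OF 1] by (simp add: algebra_simps)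
qed

text \<open>Tensoriality by direct expansion. The derivatives of \<open>X\<close> and
  \<open>Y\<close> cancel against the bracket term, the second derivatives of \<open>Z\<close>
  cancel by symmetry, and the mixed terms with \<open>\<Gamma>\<close> and one derivative of
  \<open>Z\<close> are symmetric in \<open>X\<close> and \<open>Y\<close>.\<close>

lemma curvature_chart:
  assumes W: "openin (mtop M) W" and X: "smooth_field M W X" and Y: "smooth_field M W Y" and Z: "smooth_field M W Z"
    and p: "p \<in> W" and c: "c \<in> charts_at M p"
  shows "curvature M D X Y Z p c = curv c (cmap c p) (X p c) (Y p c) (Z p c)"
proof -
  note C = chartsD[OF c]
  define S where "S = cmap c ` (W \<inter> cdom c)"
  define x where "x = cmap c p"
  have S: "open S" "x \<in> S" "S \<subseteq> cim c" using open_image[OF C(1) W] p C by (auto simp: S_def x_def)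
  have xc: "x \<in> cim c" using S by auto
  define X' where "X' = (\<lambda>x. X (cinv c x) c)"
  define Y' where "Y' = (\<lambda>x. Y (cinv c x) c)"
  define Z' where "Z' = (\<lambda>x. Z (cinv c x) c)"
  have sm: "smooth_on S X'" "smooth_on S Y'" "smooth_on S Z'"
    unfolding S_def X'_def Y'_def Z'_def by (intro smooth_field_chart X Y Z C(1))+
  have at: "X p c = X' x" "Y p c = Y' x" "Z p c = Z' x" using C by (simp_all add: X'_def Y'_def Z'_def x_def)
  have dd: "X' differentiable (at x)" "Y' differentiable (at x)" "Z' differentiable (at x)"
    using smooth_on_differentiable sm S by blast+
  have second: "D p (V p) (\<lambda>q. D q (U q) Z) c =
      fd (\<lambda>z. fd Z' z (U' x)) x (V p c) + fd Z' x (fd U' x (V p c)) + fd (\<lambda>z. \<Gamma> c z (U' x) (Z' x)) x (V p c)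
      + \<Gamma> c x (fd U' x (V p c)) (Z' x) + \<Gamma> c x (U' x) (fd Z' x (V p c)) + \<Gamma> c x (V p c) (fd Z' x (U' x) + \<Gamma> c x (U' x) (Z' x))"
    if U: "smooth_field M W U" and V: "smooth_field M W V" and U': "U' = (\<lambda>x. U (cinv c x) c)" for U V U'
  proof -
    have dU: "U' differentiable (at x)"
      using smooth_on_differentiable[OF smooth_field_chart[OF U C(1)]] S unfolding U' S_def by blast
    have DU: "smooth_field M W (\<lambda>q. D q (U q) Z)" by (rule D_smooth[OF W U Z])
    have eq: "D (cinv c z) (U (cinv c z)) Z c = fd Z' z (U' z) + \<Gamma> c z (U' z) (Z' z)" if z: "z \<in> S" for z
    proof -
      have zc: "z \<in> cim c" "cinv c z \<in> W" using z image_iff_cinv[OF C(1)] by (auto simp: S_def)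
      show ?thesis
        using D_chart[OF W Z zc(2) smooth_field_tangent[OF U zc(2)], of c] zc C(1)
        by (simp add: chartsI U' Z'_def)
    qed
    have d1: "((\<lambda>z. fd Z' z (U' z)) has_derivative (\<lambda>h. fd (\<lambda>z. fd Z' z (U' x)) x h + fd Z' x (fd U' x h))) (at x)"
      by (rule has_derivative_apply_linear[OF S(1,2) dU])
        (auto intro: linear_fd smooth_on_differentiable[OF sm(3)] smooth_on_differentiable[OF smooth_on_fd[OF sm(3)] S(2)])
    have "((\<lambda>z. fd Z' z (U' z) + \<Gamma> c z (U' z) (Z' z)) has_derivative
        (\<lambda>h. (fd (\<lambda>z. fd Z' z (U' x)) x h + fd Z' x (fd U' x h)) +
          (fd (\<lambda>z. \<Gamma> c z (U' x) (Z' x)) x h + \<Gamma> c x (fd U' x h) (Z' x) + \<Gamma> c x (U' x) (fd Z' x h)))) (at x)"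
      by (rule has_derivative_add[OF d1 fd_gam[OF C(1) xc dU dd(3)]])
    from fd_apply[OF this]
    have "fd (\<lambda>z. D (cinv c z) (U (cinv c z)) Z c) x (V p c) = (fd (\<lambda>z. fd Z' z (U' x)) x (V p c) + fd Z' x (fd U' x (V p c))) +
          (fd (\<lambda>z. \<Gamma> c z (U' x) (Z' x)) x (V p c) + \<Gamma> c x (fd U' x (V p c)) (Z' x) + \<Gamma> c x (U' x) (fd Z' x (V p c)))"
      using fd_cong_open[OF S(1,2) eq] by simp
    moreover have "D (cinv c x) (U (cinv c x)) Z c = fd Z' x (U' x) + \<Gamma> c x (U' x) (Z' x)" by (rule eq[OF S(2)])
    ultimately show ?thesis
      using D_chart[OF W DU p smooth_field_tangent[OF V p] c] C by (simp add: x_def algebra_simps)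
  qed
  have br: "D p (lie_bracket M X Y p) Z c = fd Z' x (fd Y' x (X' x) - fd X' x (Y' x)) + \<Gamma> c x (fd Y' x (X' x) - fd X' x (Y' x)) (Z' x)"
    using D_chart[OF W Z p lie_bracket_tangent[OF W X Y p] c] c at
    by (simp add: lie_bracket_def x_def[symmetric] X'_def[symmetric] Y'_def[symmetric] Z'_def[symmetric])
  have sym: "fd (\<lambda>z. fd Z' z (Y' x)) x (X' x) = fd (\<lambda>z. fd Z' z (X' x)) x (Y' x)"
    by (rule fd_fd_commute[OF S(1,2) smooth_onD[OF sm(3)]])
  show ?thesis
    using second[OF Y X Y'_def] second[OF X Y X'_def] br sym
    by (simp add: curvature_def curv_def at x_def[symmetric] linear_diff[OF linear_fd[OF dd(3)]]
       linear_diff[OF linear_gam_left[OF C(1) xc]] linear_add[OF linear_gam_right])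
qed

lemma flat_curv:
  assumes fl: "flat M D" and c: "c \<in> atlas M" and x: "x \<in> cim c"
  shows "curv c x u v w = 0"
proof -
  have p: "c \<in> charts_at M (cinv c x)" using c x by (simp add: chartsI)
  have "curvature M D (cfield M c u) (cfield M c v) (cfield M c w) (cinv c x) = tzero"
    using fl open_cdom[OF c] smooth_field_cfield[OF c] cinv_cdom[OF x] unfolding flat_def by blast
  then show ?thesis
    using curvature_chart[OF open_cdom[OF c] smooth_field_cfield[OF c] smooth_field_cfield[OF c] smooth_field_cfield[OF c] cinv_cdom[OF x] p, of u v w] x
    by (simp add: cfield_chart[OF c x])
qed

end

subsection \<open>Infinitesimal parallel transport\<close>

context lin_conn
begin

lemma christoffel_sum:
  assumes d: "d \<in> charts_at M p"
  shows "(\<chi> k. \<Sum>i\<in>UNIV. \<Sum>j\<in>UNIV. christoffel M D d p k i j * a $ i * b $ j) = \<Gamma> d (cmap d p) a b"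
proof -
  note E = chartsD[OF d]
  have ch: "christoffel M D d p k i j = \<Gamma> d (cmap d p) (axis i 1) (axis j 1) $ k" for k i j
    using gam_axis[OF d, of "coord_field M d i p" j] d by (simp add: christoffel_def coord_field_def)
  have ll: "linear (\<lambda>u. \<Gamma> d (cmap d p) u v)" for v
    by (rule linear_gam_left) (use E in auto)
  have "\<Gamma> d (cmap d p) a b = (\<Sum>i\<in>UNIV. a $ i *\<^sub>R \<Gamma> d (cmap d p) (axis i 1) b)"
    by (rule linear_axis_expansion[OF ll])
  also have "\<dots> = (\<Sum>i\<in>UNIV. a $ i *\<^sub>R (\<Sum>j\<in>UNIV. b $ j *\<^sub>R \<Gamma> d (cmap d p) (axis i 1) (axis j 1)))"
    by (intro sum.cong refl arg_cong2[where f = scaleR] linear_axis_expansion[OF linear_gam_right])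
  finally show ?thesis by (simp add: vec_eq_iff ch sum_distrib_left mult_ac)
qed

text \<open>\<open>parallel_along\<close> demands the equation in every chart that the curve meets.
  It is assumed in \<open>c\<close> and carried to \<open>d\<close> by \<open>gam_transform\<close>:
  the second derivative of the transition there is what arises when the Jacobian is differentiated
  along the curve.\<close>

lemma line_transport:
  fixes a b :: "real^'n" and V :: "real \<Rightarrow> real^'n" and J :: "real set"
  assumes c: "c \<in> atlas M" and J: "open J" "is_interval J"
    and x: "\<And>t. t \<in> J \<Longrightarrow> a + t *\<^sub>R b \<in> cim c"
    and V: "\<And>t. t \<in> J \<Longrightarrow> (V has_vector_derivative - \<Gamma> c (a + t *\<^sub>R b) b (V t)) (at t)"
  defines "\<sigma> \<equiv> \<lambda>t. cinv c (a + t *\<^sub>R b)"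
  shows "smooth_curve M J \<sigma>" "parallel_along M D J \<sigma> (\<lambda>t. tvec_of M c (\<sigma> t) (V t))"
proof -
  define x where "x t = a + t *\<^sub>R b" for t
  have sx: "\<sigma> t = cinv c (x t)" for t by (simp add: \<sigma>_def x_def)
  have xJ: "t \<in> J \<Longrightarrow> x t \<in> cim c" for t using assms(4) by (simp add: x_def)
  have contx: "continuous_on S x" for S unfolding x_def by (intro continuous_intros)
  have dx: "(x has_vector_derivative b) (at t)" for t
    unfolding x_def by (auto intro!: derivative_eq_intros)
  \<comment> \<open>The times at which the curve lies in \<open>d\<close>. This set is open, so
    derivatives at its points can be computed from the formula in \<open>d\<close>.\<close>
  define N where "N d = {t \<in> J. \<sigma> t \<in> cdom d}" for d :: "('a, 'n) chart"
  have N: "N d = J \<inter> x -` (cmap c ` (cdom c \<inter> cdom d))" if "d \<in> atlas M" for d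
    using xJ c image_iff_cinv[OF c, of _ "cdom d"] by (auto simp: N_def sx Int_commute)
  have oN: "open (N d)" if "d \<in> atlas M" for d
    unfolding N[OF that] using J(1) contx open_overlap[OF c that] by (intro open_Int open_vimage) auto
  have cs: "cmap d (\<sigma> t) = transition c d (x t)" for d t
    by (simp add: sx transition_def)
  show "smooth_curve M J \<sigma>"
    unfolding smooth_curve_def
  proof (intro conjI ballI J)
    have "continuous_map (top_of_set J) (top_of_set (cim c)) x"
      using contx xJ by (auto simp: continuous_map_in_subtopology)
    from continuous_map_compose[OF this continuous_map_cinv[OF c]]
    show "continuous_map (top_of_set J) (mtop M) \<sigma>" by (simp add: comp_def sx[abs_def])
    fix d assume d: "d \<in> atlas M"
    have "smooth_on (N d) x"
      unfolding x_def by (intro smooth_on_add oN d smooth_on_const smooth_on_linear[OF oN[OF d] bounded_linear_scaleR_left smooth_on_ident])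
    then have "smooth_on (N d) (\<lambda>t. transition c d (x t))"
      by (rule smooth_on_compose[OF oN[OF d] open_overlap[OF c d] _ _ smooth_transition[OF c d], rotated]) (auto simp: N[OF d])
    then show "smooth_on {t \<in> J. \<sigma> t \<in> cdom d} (cmap d \<circ> \<sigma>)"
      by (simp add: comp_def cs N_def)
  qed
  show "parallel_along M D J \<sigma> (\<lambda>t. tvec_of M c (\<sigma> t) (V t))"
    unfolding parallel_along_def
  proof (intro ballI conjI)
    fix t assume t: "t \<in> J"
    have ct: "c \<in> charts_at M (\<sigma> t)" using c xJ[OF t] by (simp add: sx chartsI)
    show "tvec_of M c (\<sigma> t) (V t) \<in> tangent_space M (\<sigma> t)" using ct by simp
    fix d assume d: "d \<in> charts_at M (\<sigma> t)"
    note E = chartsD[OF d]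
    have tN: "t \<in> N d" using t E by (simp add: N_def)
    have xt: "cmap c (\<sigma> t) = x t" using xJ[OF t] by (simp add: sx)
    have xo: "x s \<in> cmap c ` (cdom c \<inter> cdom d)" if "s \<in> N d" for s using that N[OF E(1)] by auto
    let ?\<psi> = "transition c d"
    have eq: "tvec_of M c (\<sigma> s) (V s) d = fd ?\<psi> (x s) (V s)" if "s \<in> N d" for s
      using that xJ E by (simp add: N_def tvec_of_apply chartsI jac_def) (simp add: sx)
    have dg: "((\<lambda>s. fd ?\<psi> (x s) v) has_derivative (\<lambda>h. fd (\<lambda>z. fd ?\<psi> z v) (x t) (h *\<^sub>R b))) (at t)" for v
    proof -
      have "((\<lambda>z. fd ?\<psi> z v) has_derivative fd (\<lambda>z. fd ?\<psi> z v) (x t)) (at (x t))"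
        by (intro has_derivative_fd smooth_on_differentiable[OF smooth_on_fd[OF smooth_transition[OF c E(1)]]] xo tN)
      from has_derivative_compose[OF dx[unfolded has_vector_derivative_def] this] show ?thesis .
    qed
    have "((\<lambda>s. fd ?\<psi> (x s) (V s)) has_derivative (\<lambda>h. fd (\<lambda>s. fd ?\<psi> (x s) (V t)) t h + fd ?\<psi> (x t) (fd V t h))) (at t)"
    proof (rule has_derivative_apply_linear[OF oN[OF E(1)] tN])
      show "V differentiable (at t)" using V[OF t] by (auto simp: has_vector_derivative_def differentiable_def)
      show "linear (fd ?\<psi> (x s))" if "s \<in> N d" for s
        by (intro linear_fd smooth_on_differentiable[OF smooth_transition[OF c E(1)]] xo that)
      show "(\<lambda>s. fd ?\<psi> (x s) v) differentiable (at t)" for v using dg by (rule differentiableI)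
    qed
    then have "((\<lambda>s. tvec_of M c (\<sigma> s) (V s) d) has_derivative (\<lambda>h. fd (\<lambda>s. fd ?\<psi> (x s) (V t)) t h + fd ?\<psi> (x t) (fd V t h))) (at t)"
      using has_derivative_cong_open[OF oN[OF E(1)] tN eq] by simp
    moreover have "fd V t = (\<lambda>h. h *\<^sub>R (- \<Gamma> c (x t) b (V t)))"
      using V[OF t] by (intro fd_eqI) (simp add: has_vector_derivative_def x_def)
    moreover have "fd (\<lambda>s. fd ?\<psi> (x s) (V t)) t = (\<lambda>h. fd (\<lambda>z. fd ?\<psi> z (V t)) (x t) (h *\<^sub>R b))"
      by (rule fd_eqI[OF dg])
    ultimately have *: "((\<lambda>s. tvec_of M c (\<sigma> s) (V s) d) has_derivative
        (\<lambda>h. fd (\<lambda>z. fd ?\<psi> z (V t)) (x t) (h *\<^sub>R b) + jac c d (\<sigma> t) (h *\<^sub>R (- \<Gamma> c (x t) b (V t))))) (at t)"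
      by (simp add: jac_def xt)
    then show "(\<lambda>s. tvec_of M c (\<sigma> s) (V s) d) differentiable (at t)" by (rule differentiableI)
    have l: "linear (fd (\<lambda>z. fd ?\<psi> z (V t)) (x t))"
      by (intro linear_fd smooth_on_differentiable[OF smooth_on_fd[OF smooth_transition[OF c E(1)]]] xo tN)
    have "((\<lambda>s. tvec_of M c (\<sigma> s) (V s) d) has_vector_derivative
      (fd (\<lambda>z. fd ?\<psi> z (V t)) (x t) b - jac c d (\<sigma> t) (\<Gamma> c (x t) b (V t)))) (at t)"
      using * unfolding has_vector_derivative_def
      by (simp add: linear_scale[OF l] linear_scale[OF linear_jac[OF ct d]] linear_neg[OF linear_jac[OF ct d]] algebra_simps)
    then have vd: "vector_derivative (\<lambda>s. tvec_of M c (\<sigma> s) (V s) d) (at t) =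
      fd (\<lambda>z. fd ?\<psi> z (V t)) (x t) b - jac c d (\<sigma> t) (\<Gamma> c (x t) b (V t))"
      by (rule vector_derivative_at)
    have "(?\<psi> has_derivative jac c d (\<sigma> t)) (at (x t))"
      using jac_has_derivative[OF ct d] by (simp add: xt)
    from has_derivative_compose[OF dx[unfolded has_vector_derivative_def] this]
    have "((\<lambda>s. ?\<psi> (x s)) has_vector_derivative jac c d (\<sigma> t) b) (at t)"
      by (simp add: has_vector_derivative_def linear_scale[OF linear_jac[OF ct d]])
    then have vs: "vector_derivative (cmap d \<circ> \<sigma>) (at t) = jac c d (\<sigma> t) b"
      by (simp add: comp_def cs vector_derivative_at)
    show "cov_deriv_along M D \<sigma> (\<lambda>t. tvec_of M c (\<sigma> t) (V t)) t d = 0"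
      unfolding cov_deriv_along_def vd vs christoffel_sum[OF d]
      using gam_transform[OF ct d, of b "V t"] d by (simp add: xt tvec_of_apply)
  qed
qed

text \<open>Compactness bounds the finitely many maps \<open>\<Gamma> c x b b'\<close> with basis
  vectors; bilinearity gives the general case.\<close>

lemma gam_bound:
  assumes c: "c \<in> atlas M" and R: "cball x0 R \<subseteq> cim c"
  shows "\<exists>K\<ge>0. \<forall>x\<in>cball x0 R. \<forall>u v. norm (\<Gamma> c x u v) \<le> K * norm u * norm v"
proof -
  have "\<exists>B. \<forall>x\<in>cball x0 R. norm (\<Gamma> c x b b') \<le> B" for b b'
  proof -
    have "continuous_on (cball x0 R) (\<lambda>x. \<Gamma> c x b b')"
      using smooth_on_continuous[OF smooth_gam[OF c]] R continuous_on_subset by blast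
    from compact_imp_bounded[OF compact_continuous_image[OF this compact_cball]]
    show ?thesis unfolding bounded_iff by auto
  qed
  then obtain B where B: "\<And>x b b'. x \<in> cball x0 R \<Longrightarrow> norm (\<Gamma> c x b b') \<le> B b b'" by metis
  define K where "K = (\<Sum>b\<in>Basis. \<Sum>b'\<in>Basis. \<bar>B b b'\<bar>)"
  show ?thesis
  proof (intro exI[of _ K] conjI ballI allI)
    show "K \<ge> 0" unfolding K_def by (intro sum_nonneg) auto
    fix x u v assume x: "x \<in> cball x0 R"
    then have xc: "x \<in> cim c" using R by auto
    have "\<Gamma> c x u v = (\<Sum>b\<in>Basis. \<Sum>b'\<in>Basis. ((u \<bullet> b) * (v \<bullet> b')) *\<^sub>R \<Gamma> c x b b')"
    proof -
      have "\<Gamma> c x u v = (\<Sum>b\<in>Basis. (u \<bullet> b) *\<^sub>R \<Gamma> c x b v)"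
        by (rule linear_euclidean_expansion[OF linear_gam_left[OF c xc]])
      moreover have "\<Gamma> c x b v = (\<Sum>b'\<in>Basis. (v \<bullet> b') *\<^sub>R \<Gamma> c x b b')" for b
        by (rule linear_euclidean_expansion[OF linear_gam_right])
      ultimately show ?thesis by (simp only: scaleR_sum_right scaleR_scaleR)
    qed
    also have "norm \<dots> \<le> (\<Sum>b\<in>Basis. \<Sum>b'\<in>Basis. norm u * norm v * \<bar>B b b'\<bar>)"
    proof (intro sum_norm_le)
      fix b b' :: "real^'n" assume b: "b \<in> Basis" "b' \<in> Basis"
      have "\<bar>u \<bullet> b\<bar> * \<bar>v \<bullet> b'\<bar> \<le> norm u * norm v"
        using b by (intro mult_mono Basis_le_norm) auto
      moreover have "norm (\<Gamma> c x b b') \<le> \<bar>B b b'\<bar>" using B[OF x, of b b'] by linarith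
      ultimately have "(\<bar>u \<bullet> b\<bar> * \<bar>v \<bullet> b'\<bar>) * norm (\<Gamma> c x b b') \<le> (norm u * norm v) * \<bar>B b b'\<bar>"
        by (rule mult_mono) auto
      then show "norm (((u \<bullet> b) * (v \<bullet> b')) *\<^sub>R \<Gamma> c x b b') \<le> norm u * norm v * \<bar>B b b'\<bar>"
        by (simp add: abs_mult)
    qed
    also have "\<dots> = K * norm u * norm v"
      by (simp add: K_def sum_distrib_left sum_distrib_right mult_ac)
    finally show "norm (\<Gamma> c x u v) \<le> K * norm u * norm v" .
  qed
qed

text \<open>One \<delta> serves all \<open>h\<close>: by linearity in \<open>h\<close> only the
  finitely many basis directions have to be close.\<close>

lemma gam_equicontinuous:
  assumes c: "c \<in> atlas M" and x0: "x0 \<in> cim c" and e: "e > 0"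
  obtains \<delta> where "\<delta> > 0" "\<And>x h. dist x x0 < \<delta> \<Longrightarrow> x \<in> cim c \<Longrightarrow> norm (\<Gamma> c x h v - \<Gamma> c x0 h v) \<le> e * norm h"
proof -
  define g where "g x = (\<Sum>b\<in>Basis. norm (\<Gamma> c x b v - \<Gamma> c x0 b v))" for x
  have "isCont (\<lambda>x. \<Gamma> c x b v) x0" for b
    using gam_differentiable[OF c x0] differentiable_imp_continuous_within by blast
  then have "isCont g x0" unfolding g_def by (intro continuous_intros) auto
  then obtain \<delta> where \<delta>: "\<delta> > 0" "\<And>x. dist x x0 < \<delta> \<Longrightarrow> dist (g x) (g x0) < e"
    using e unfolding continuous_at_eps_delta by metis
  show ?thesis
  proof (rule that[OF \<delta>(1)])
    fix x h assume x: "dist x x0 < \<delta>" "x \<in> cim c"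
    have 1: "\<Gamma> c x h v - \<Gamma> c x0 h v = (\<Sum>b\<in>Basis. (h \<bullet> b) *\<^sub>R (\<Gamma> c x b v - \<Gamma> c x0 b v))"
      by (rule linear_euclidean_expansion) (intro linear_compose_sub linear_gam_left[OF c] x x0)
    have "norm (\<Gamma> c x h v - \<Gamma> c x0 h v) \<le> (\<Sum>b\<in>Basis. norm h * norm (\<Gamma> c x b v - \<Gamma> c x0 b v))"
      unfolding 1
    proof (rule sum_norm_le)
      fix b :: "real^'n" assume "b \<in> Basis"
      then have "\<bar>h \<bullet> b\<bar> \<le> norm h" by (rule Basis_le_norm)
      then show "norm ((h \<bullet> b) *\<^sub>R (\<Gamma> c x b v - \<Gamma> c x0 b v)) \<le> norm h * norm (\<Gamma> c x b v - \<Gamma> c x0 b v)"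
        by (simp add: mult_right_mono)
    qed
    also have "\<dots> = norm h * g x" by (simp add: g_def sum_distrib_left)
    also have "\<dots> \<le> norm h * e"
      using \<delta>(2)[OF x(1)] by (intro mult_left_mono) (auto simp: g_def dist_real_def)
    finally show "norm (\<Gamma> c x h v - \<Gamma> c x0 h v) \<le> e * norm h" by (simp add: mult.commute)
  qed
qed

text \<open>\<open>Z h\<close> is the parallel transport along the segment from \<open>x0 + h\<close> to \<open>x0\<close>.  Transporting towards the
  fixed point \<open>x0\<close> makes the averaged metric at \<open>x0 + h\<close> the pullback along \<open>Z h\<close> of the one at \<open>x0\<close>,
  so that no inverse of the transport has to be differentiated.\<close>

lemma transport:
  assumes comp: "compatible M F D" and c: "c \<in> atlas M" and x0: "x0 \<in> cim c"
  shows "\<exists>Z r. r > 0 \<and> (\<forall>y. ((\<lambda>h. Z h y) has_derivative (\<lambda>h. \<Gamma> c x0 h y)) (at 0)) \<and> (\<forall>h. linear (Z h)) \<and>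
    (\<forall>y. Z 0 y = y) \<and> (\<forall>h. norm h < r \<longrightarrow> x0 + h \<in> cim c) \<and>
    (\<forall>h y. norm h < r \<longrightarrow> F (cinv c x0) (tvec_of M c (cinv c x0) (Z h y)) =
       F (cinv c (x0 + h)) (tvec_of M c (cinv c (x0 + h)) y))"
proof -
  obtain R where R: "R > 0" "cball x0 R \<subseteq> cim c"
    using open_cim[OF c] x0 open_contains_cball by metis
  obtain K where K: "K \<ge> 0" "\<And>x u v. x \<in> cball x0 R \<Longrightarrow> norm (\<Gamma> c x u v) \<le> K * norm u * norm v"
    using gam_bound[OF c R(2)] by blast
  \<comment> \<open>For times between -1 and 2 the segment moves at most \<open>2 * norm h\<close>
    away from \<open>x0\<close>, hence \<open>R / 2\<close>. The second bound makes the coefficient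
    \<open>K * norm h\<close> at most 1/4, as \<open>linear_ode\<close> requires.\<close>
  define r where "r = min (R / 2) (1 / (4 * (K + 1)))"
  have r: "r > 0" using R K by (simp add: r_def)
  have rR: "2 * norm h \<le> R" and rK: "K * norm h \<le> 1 / 4" if "norm h < r" for h :: "real^'n"
  proof -
    show "2 * norm h \<le> R" using that by (simp add: r_def)
    have "K * norm h \<le> (K + 1) * (1 / (4 * (K + 1)))"
      using that K by (intro mult_mono) (auto simp: r_def)
    also have "\<dots> = 1 / 4" using K by simp
    finally show "K * norm h \<le> 1 / 4" .
  qed
  \<comment> \<open>Time 0 is the moving point \<open>x0 + h\<close> and time 1 the fixed point
    \<open>x0\<close>; the larger interval puts both in its interior.\<close>
  define x where "x h t = x0 + (1 - t) *\<^sub>R h" for h :: "real^'n" and t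
  have xin: "x h t \<in> cball x0 R" if "norm h < r" "t \<in> {-1..2}" for h t
  proof -
    have "dist x0 (x h t) = \<bar>1 - t\<bar> * norm h" by (simp add: x_def dist_norm)
    also have "\<dots> \<le> 2 * norm h" using that by (intro mult_right_mono) auto
    finally show ?thesis using rR[OF that(1)] by simp
  qed
  \<comment> \<open>Beside the equation, \<open>P\<close> keeps the estimate linear in
    \<open>norm h\<close> and the integral form, from which the derivative at \<open>h = 0\<close>
    is computed.\<close>
  define P where "P h e V \<longleftrightarrow> V 0 = e \<and>
     (\<forall>t\<in>{-1<..<2}. (V has_vector_derivative \<Gamma> c (x h t) h (V t)) (at t)) \<and>
     (\<forall>t\<in>{-1..2}. norm (V t - e) \<le> 4 * (K * norm h) * norm e) \<and>
     ((\<lambda>s. \<Gamma> c (x h s) h (V s)) has_integral (V 1 - e)) {0..1}" for h e and V :: "real \<Rightarrow> real^'n"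
  have "\<exists>V. P h e V" if h: "norm h < r" for h e
  proof -
    show ?thesis
    proof (rule linear_ode[of "\<lambda>t. \<Gamma> c (x h t) h" "K * norm h" e])
      show "continuous_on {-1..2} (\<lambda>t. \<Gamma> c (x h t) h v)" for v
        by (rule continuous_on_compose2[OF smooth_on_continuous[OF smooth_gam[OF c]], of _ "x h"])
           (use xin[OF h] R in \<open>auto simp: x_def[abs_def] intro!: continuous_intros\<close>)
      show "norm (\<Gamma> c (x h t) h v) \<le> K * norm h * norm v" if "t \<in> {-1..2}" for t v
        using K(2)[OF xin[OF h that]] .
      show "0 \<le> K * norm h" "K * norm h \<le> 1 / 4" using K rK[OF h] by auto
      fix V assume V: "V 0 = e" "\<And>t. t \<in> {-1<..<2} \<Longrightarrow> (V has_vector_derivative \<Gamma> c (x h t) h (V t)) (at t)"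
        "\<And>t. t \<in> {-1..2} \<Longrightarrow> norm (V t - e) \<le> 4 * (K * norm h) * norm e"
        "\<And>t. t \<in> {-1..2} \<Longrightarrow> ((\<lambda>s. \<Gamma> c (x h s) h (V s)) has_integral (V t - e)) {0..t} \<or> t < 0"
      show "\<exists>V. P h e V"
        unfolding P_def using V V(4)[of 1] by (intro exI[of _ V]) simp
    qed (rule linear_gam_right)
  qed
  then have "\<exists>V. \<forall>h e. norm h < r \<longrightarrow> P h e (V h e)" by metis
  then obtain V where V: "\<And>h e. norm h < r \<Longrightarrow> P h e (V h e)" by blast
  \<comment> \<open>Only basis vectors are transported. \<open>Z h\<close> is their linear
    extension, which makes it linear by construction for every \<open>h\<close>.\<close>
  define Z where "Z h y = (\<Sum>b\<in>Basis. (y \<bullet> b) *\<^sub>R V h b 1)" for h y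
  show ?thesis
  proof (intro exI[of _ Z] exI[of _ r] conjI allI impI r)
    show "linear (Z h)" for h
      by (rule linearI) (auto simp: Z_def inner_add_left scaleR_add_left sum.distrib scaleR_sum_right)
    have V0: "V 0 e 1 = e" for e
      using V[of 0 e] r unfolding P_def by (auto dest!: bspec[of _ _ 1])
    show "Z 0 y = y" for y by (simp add: Z_def V0 euclidean_representation)
    show xh: "x0 + h \<in> cim c" if "norm h < r" for h
      using xin[OF that, of 0] R by (auto simp: x_def)
    show "F (cinv c x0) (tvec_of M c (cinv c x0) (Z h y)) = F (cinv c (x0 + h)) (tvec_of M c (cinv c (x0 + h)) y)"
      if h: "norm h < r" for h y
    proof -
      define U where "U t = (\<Sum>b\<in>Basis. (y \<bullet> b) *\<^sub>R V h b t)" for t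
      \<comment> \<open>The velocity of the segment is \<open>- h\<close>, which turns
        \<open>V' = \<Gamma> h V\<close> into the transport equation of
        \<open>line_transport\<close>.\<close>
      have xeq: "x h t = (x0 + h) + t *\<^sub>R (- h)" for t by (simp add: x_def algebra_simps)
      have U: "(U has_vector_derivative - \<Gamma> c ((x0 + h) + t *\<^sub>R (- h)) (- h) (U t)) (at t)" if t: "t \<in> {-1<..<2}" for t
      proof -
        have "t \<in> {-1..2}" using t by simp
        then have xc: "x h t \<in> cim c" using xin[OF h] R by blast
        have "(U has_vector_derivative (\<Sum>b\<in>Basis. (y \<bullet> b) *\<^sub>R \<Gamma> c (x h t) h (V h b t))) (at t)"
          unfolding U_def
          by (intro has_vector_derivative_sum bounded_linear.has_vector_derivative[OF bounded_linear_scaleR_right])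
            (use V[OF h] t in \<open>auto simp: P_def\<close>)
        also have "(\<Sum>b\<in>Basis. (y \<bullet> b) *\<^sub>R \<Gamma> c (x h t) h (V h b t)) = \<Gamma> c (x h t) h (U t)"
          by (simp add: U_def linear_sum[OF linear_gam_right] linear_cmul[OF linear_gam_right])
        also have "\<dots> = - \<Gamma> c (x h t) (- h) (U t)"
          using linear_neg[OF linear_gam_left[OF c xc], of h "U t"] by simp
        finally show ?thesis by (simp only: xeq)
      qed
      have xJ: "(x0 + h) + t *\<^sub>R (- h) \<in> cim c" if "t \<in> {-1<..<2}" for t
        using xin[OF h, of t] that R unfolding xeq by auto
      note L = line_transport[OF c open_greaterThanLessThan is_interval_oo xJ U]
      let ?\<sigma> = "\<lambda>t. cinv c ((x0 + h) + t *\<^sub>R (- h))"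
      have "parallel_transport M D {-1<..<2} ?\<sigma> 0 1 (tvec_of M c (?\<sigma> 0) (U 0)) (tvec_of M c (?\<sigma> 1) (U 1))"
        unfolding parallel_transport_def using L(2) by blast
      then have "F (?\<sigma> 1) (tvec_of M c (?\<sigma> 1) (U 1)) = F (?\<sigma> 0) (tvec_of M c (?\<sigma> 0) (U 0))"
        using comp[unfolded compatible_def, rule_format, of "{-1<..<2}" ?\<sigma> 0 1] L(1) by simp
      moreover have "U 0 = y" using V[OF h] by (simp add: U_def P_def euclidean_representation)
      moreover have "U 1 = Z h y" by (simp add: U_def Z_def)
      ultimately show ?thesis by simp
    qed
    \<comment> \<open>In the integral of \<open>\<Gamma> c (x h s) h (V h b s)\<close> two
      replacements lead to \<open>\<Gamma> c x0 h b\<close>: that of \<open>V h b s\<close> by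
      \<open>b\<close> costs a term quadratic in \<open>norm h\<close>, and that of the base point
      costs \<open>e / 2 * norm h\<close> by equicontinuity.\<close>
    have Vd: "((\<lambda>h. V h b 1) has_derivative (\<lambda>h. \<Gamma> c x0 h b)) (at 0)" for b
      unfolding has_derivative_at_alt
    proof (intro conjI allI impI)
      show "bounded_linear (\<lambda>h. \<Gamma> c x0 h b)"
        using linear_gam_left[OF c x0] by (simp add: linear_conv_bounded_linear)
      fix e :: real assume e: "e > 0"
      obtain \<delta> where \<delta>: "\<delta> > 0" "\<And>x h. dist x x0 < \<delta> \<Longrightarrow> x \<in> cim c \<Longrightarrow> norm (\<Gamma> c x h b - \<Gamma> c x0 h b) \<le> e / 2 * norm h"
        using gam_equicontinuous[OF c x0, of "e / 2" b] e by auto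
      \<comment> \<open>The quadratic error is \<open>K * norm h\<close> times
        \<open>4 * K * norm h * norm b\<close>, which is at most \<open>m / 2\<close> times the
        square of \<open>norm h\<close>. For \<open>norm h < e / m\<close> it stays below
        \<open>e / 2 * norm h\<close>; the summand 1 keeps \<open>m\<close> positive.\<close>
      define m where "m = 8 * K * K * norm b + 1"
      have m: "m > 0" using K by (auto simp: m_def intro!: add_nonneg_pos)
      define d where "d = min r (min \<delta> (e / m))"
      have d: "d > 0" using r \<delta> e m by (simp add: d_def)
      show "\<exists>d>0. \<forall>h. norm (h - 0) < d \<longrightarrow> norm (V h b 1 - V 0 b 1 - \<Gamma> c x0 (h - 0) b) \<le> e * norm (h - 0)"
      proof (intro exI conjI allI impI)
        fix h :: "real^'n" assume "norm (h - 0) < d"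
        then have h: "norm h < r" "norm h < \<delta>" "norm h < e / m" by (auto simp: d_def)
        have Vh: "norm (V h b t - b) \<le> 4 * (K * norm h) * norm b" if "t \<in> {-1..2}" for t
          using V[OF h(1)] that by (simp add: P_def)
        have int: "((\<lambda>s. \<Gamma> c (x h s) h (V h b s)) has_integral (V h b 1 - b)) {0..1}"
          using V[OF h(1)] by (simp add: P_def)
        have "((\<lambda>s. \<Gamma> c (x h s) h (V h b s) - \<Gamma> c x0 h b) has_integral (V h b 1 - b - (1 - 0) *\<^sub>R \<Gamma> c x0 h b)) {0..1}"
          using has_integral_const_real[of "\<Gamma> c x0 h b" 0 1] by (intro has_integral_diff int) simp
        moreover have "norm (\<Gamma> c (x h s) h (V h b s) - \<Gamma> c x0 h b) \<le> e * norm h" if s: "s \<in> {0..1}" for s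
        proof -
          have s': "s \<in> {-1..2}" using s by auto
          have xs: "x h s \<in> cim c" using xin[OF h(1) s'] R by blast
          have "dist (x h s) x0 = \<bar>1 - s\<bar> * norm h" by (simp add: x_def dist_norm)
          also have "\<dots> \<le> 1 * norm h" using s by (intro mult_right_mono) auto
          finally have ds: "dist (x h s) x0 < \<delta>" using h by simp
          have "\<Gamma> c (x h s) h (V h b s) - \<Gamma> c x0 h b = \<Gamma> c (x h s) h (V h b s - b) + (\<Gamma> c (x h s) h b - \<Gamma> c x0 h b)"
            by (simp add: linear_diff[OF linear_gam_right])
          also have "norm \<dots> \<le> K * norm h * norm (V h b s - b) + e / 2 * norm h"
            by (intro norm_triangle_mono K(2)[OF xin[OF h(1) s']] \<delta>(2)[OF ds xs])
          also have "K * norm h * norm (V h b s - b) \<le> K * norm h * (4 * (K * norm h) * norm b)"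
            using K(1) by (intro mult_left_mono Vh[OF s']) auto
          also have "\<dots> = (8 * K * K * norm b) * norm h * norm h / 2" by simp
          also have "\<dots> \<le> m * norm h * norm h / 2"
            by (intro divide_right_mono mult_right_mono) (auto simp: m_def)
          also have "\<dots> = (m * norm h) * (norm h / 2)" by simp
          also have "\<dots> \<le> e * (norm h / 2)"
            using h(3) m by (intro mult_right_mono) (auto simp: field_simps)
          finally show ?thesis by simp
        qed
        ultimately have "norm (V h b 1 - b - (1 - 0) *\<^sub>R \<Gamma> c x0 h b) \<le> e * norm h * measure lborel {0..1::real}"
          using e by (intro has_integral_bound_real[of "e * norm h" "{}"]) auto
        then show "norm (V h b 1 - V 0 b 1 - \<Gamma> c x0 (h - 0) b) \<le> e * norm (h - 0)" by (simp add: V0)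
      qed (rule d)
    qed
    show "((\<lambda>h. Z h y) has_derivative (\<lambda>h. \<Gamma> c x0 h y)) (at 0)" for y
    proof -
      have "((\<lambda>h. Z h y) has_derivative (\<lambda>h. \<Sum>b\<in>Basis. (y \<bullet> b) *\<^sub>R \<Gamma> c x0 h b)) (at 0)"
        unfolding Z_def by (intro has_derivative_sum has_derivative_scaleR_right Vd)
      moreover have "(\<Sum>b\<in>Basis. (y \<bullet> b) *\<^sub>R \<Gamma> c x0 h b) = \<Gamma> c x0 h y" for h
        by (rule linear_euclidean_expansion[OF linear_gam_right, symmetric])
      ultimately show ?thesis by (simp only:)
    qed
  qed
qed

end

subsection \<open>The Hessian of the energy\<close>

definition hes :: "(real^'n \<Rightarrow> real) \<Rightarrow> real^'n \<Rightarrow> real^'n^'n" where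
  "hes f y = (\<chi> i j. partial i (partial j (\<lambda>z. (f z)\<^sup>2 / 2)) y)"

definition hess2 :: "(real^'n \<Rightarrow> real) \<Rightarrow> real^'n \<Rightarrow> real^'n \<Rightarrow> real^'n \<Rightarrow> real" where
  "hess2 E y v w = fd (\<lambda>z. fd E z w) y v"

lemma open_punctured: "open (UNIV - {0 :: real^'n})"
  by (simp add: open_Diff)

lemma smooth_energy:
  assumes "smooth_on S f" "open S"
  shows "smooth_on S (\<lambda>z. (f z :: real)\<^sup>2 / 2)"
proof -
  have "smooth_on S (\<lambda>z. (1 / 2) * (f z * f z))"
    by (intro smooth_on_mult smooth_on_const assms)
  then show ?thesis by (simp add: power2_eq_square)
qed

lemma hess2_linear:
  assumes E: "smooth_on (UNIV - {0}) E" and y: "y \<noteq> (0::real^'n)"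
  shows "linear (\<lambda>v. hess2 E y v w)" "linear (\<lambda>w. hess2 E y v w)"
proof -
  have yS: "y \<in> UNIV - {0}" using y by simp
  show "linear (\<lambda>v. hess2 E y v w)"
    unfolding hess2_def by (rule linear_fd[OF smooth_on_differentiable[OF smooth_on_fd[OF E] yS]])
  show "linear (\<lambda>w. hess2 E y v w)"
    unfolding hess2_def
    by (rule linear_fd_apply[OF open_punctured yS linear_fd[OF smooth_on_differentiable[OF E]]
          smooth_on_differentiable[OF smooth_on_fd[OF E] yS]])
qed

lemma hess2_sym:
  assumes E: "smooth_on (UNIV - {0}) E" and y: "y \<noteq> (0::real^'n)"
  shows "hess2 E y v w = hess2 E y w v"
  unfolding hess2_def by (rule fd_fd_commute[OF open_punctured _ smooth_onD[OF E]]) (use y in simp)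

lemma hes_hess2:
  assumes f: "smooth_on (UNIV - {0}) f" and y: "y \<noteq> (0::real^'n)"
  shows "v \<bullet> (hes f y *v w) = hess2 (\<lambda>z. (f z)\<^sup>2 / 2) y v w"
proof -
  let ?E = "\<lambda>z. (f z)\<^sup>2 / 2"
  have E: "smooth_on (UNIV - {0}) ?E" by (rule smooth_energy[OF f open_punctured])
  note l = hess2_linear[OF E y]
  have "hess2 ?E y v w = (\<Sum>i\<in>UNIV. v $ i *\<^sub>R hess2 ?E y (axis i 1) w)"
    by (rule linear_axis_expansion[OF l(1)])
  also have "\<dots> = (\<Sum>i\<in>UNIV. v $ i *\<^sub>R (\<Sum>j\<in>UNIV. w $ j *\<^sub>R hess2 ?E y (axis i 1) (axis j 1)))"
    by (intro sum.cong refl arg_cong2[where f = scaleR] linear_axis_expansion[OF l(2)])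
  finally show ?thesis
    by (simp add: inner_vec_def matrix_vector_mult_def hes_def partial_def[abs_def] hess2_def sum_distrib_left mult_ac)
qed

text \<open>Injectivity keeps \<open>A z\<close> away from 0, where \<open>E\<close> need not be
  smooth.\<close>

lemma hess2_covariant:
  fixes A :: "real^'n \<Rightarrow> real^'n"
  assumes A: "linear A" "inj A" and E: "smooth_on (UNIV - {0}) E" and eq: "\<And>z. E' z = E (A z)" and y: "y \<noteq> 0"
  shows "hess2 E' y v w = hess2 E (A y) (A v) (A w)"
proof -
  have A0: "z \<noteq> 0 \<Longrightarrow> A z \<in> UNIV - {0}" for z
    using A linear_0[OF A(1)] injD[OF A(2), of z 0] by auto
  have dA: "(A has_derivative A) (at z)" for z
    using A(1) by (simp add: linear_conv_bounded_linear bounded_linear_imp_has_derivative)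
  have E': "E' = (\<lambda>z. E (A z))" using eq by auto
  have 1: "fd E' z w = fd E (A z) (A w)" if "z \<noteq> 0" for z
    unfolding E' by (rule fd_apply, rule has_derivative_compose[OF dA has_derivative_fd[OF smooth_on_differentiable[OF E A0[OF that]]]])
  have "fd (\<lambda>z. fd E' z w) y v = fd (\<lambda>z. fd E (A z) (A w)) y v"
    by (rule fun_cong[OF fd_cong_open[OF open_punctured]]) (use y 1 in auto)
  also have "\<dots> = fd (\<lambda>z. fd E z (A w)) (A y) (A v)"
    by (rule fd_apply, rule has_derivative_compose[OF dA has_derivative_fd[OF smooth_on_differentiable[OF smooth_on_fd[OF E] A0[OF y]]]])
  finally show ?thesis by (simp add: hess2_def)
qed

lemma inner_transpose: "v \<bullet> (transpose A *v x) = (A *v v) \<bullet> x" for A :: "real^'n^'m"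
  by (metis dot_lmul_matrix vector_transpose_matrix)

lemma det_nz_iff_inj_matrix: "det A \<noteq> 0 \<longleftrightarrow> inj ((*v) A)" for A :: "real^'n^'n"
  by (metis invertible_det_nz invertible_left_inverse matrix_left_invertible_injective)

text \<open>The segment from the identity to \<open>H\<close> consists of positive definite, hence
  invertible, matrices. A nonpositive determinant at \<open>H\<close> would force a zero on the
  way.\<close>

lemma det_pos_def:
  fixes H :: "real^'n^'n"
  assumes pd: "\<And>w. w \<noteq> 0 \<Longrightarrow> w \<bullet> (H *v w) > 0"
  shows "det H > 0"
proof (rule ccontr)
  assume "\<not> det H > 0"
  define P where "P t = t *\<^sub>R H + (1 - t) *\<^sub>R mat 1" for t :: real
  have "continuous_on {0..1} (\<lambda>t. det (P t))"
    unfolding P_def det_def by (intro continuous_intros)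
  moreover have "det (P 1) \<le> 0" "det (P 0) \<ge> 0" using \<open>\<not> det H > 0\<close> by (simp_all add: P_def det_I)
  ultimately obtain t where t: "0 \<le> t" "t \<le> 1" "det (P t) = 0"
    using IVT2'[of "\<lambda>t. det (P t)" 1 0 0] by auto
  then obtain w where w: "w \<noteq> 0" "P t *v w = 0"
    using det_nz_iff_inj_matrix[of "P t"] linear_injective_0[OF matrix_vector_mul_linear, of "P t"] by auto
  have "0 = w \<bullet> (P t *v w)" by (simp add: w)
  also have "\<dots> = t * (w \<bullet> (H *v w)) + (1 - t) * (w \<bullet> w)"
    by (simp add: P_def matrix_vector_mult_add_rdistrib scaleR_matrix_vector_assoc[symmetric] inner_add_right)
  also have "\<dots> > 0"
  proof (cases "t = 0")
    case True then show ?thesis using w by simp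
  next
    case False
    then have "t * (w \<bullet> (H *v w)) > 0" using t pd[OF w(1)] by simp
    moreover have "(1 - t) * (w \<bullet> w) \<ge> 0" using t by simp
    ultimately show ?thesis by simp
  qed
  finally show False by simp
qed

section \<open>Minkowski norms on a single tangent space\<close>

locale minkowski_norm =
  fixes f :: "real^'n \<Rightarrow> real"
  assumes smooth: "smooth_on (UNIV - {0}) f"
    and hom: "\<And>t y. t > 0 \<Longrightarrow> f (t *\<^sub>R y) = t * f y"
    and nonneg: "\<And>y. f y \<ge> 0"
    and pd: "\<And>y w. y \<noteq> 0 \<Longrightarrow> w \<noteq> 0 \<Longrightarrow> w \<bullet> (hes f y *v w) > 0"
begin

abbreviation "E \<equiv> \<lambda>z. (f z)\<^sup>2 / 2"
abbreviation "H \<equiv> hes f"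

lemma smooth_E: "smooth_on (UNIV - {0}) E"
  by (rule smooth_energy[OF smooth open_punctured])

lemma f0: "f 0 = 0"
  using hom[of 2 0] by simp

lemma euler:
  assumes y: "y \<noteq> 0"
  shows "fd f y y = f y"
proof -
  have "((\<lambda>t. f (t *\<^sub>R y)) has_derivative (\<lambda>s. fd f y (s *\<^sub>R y))) (at 1)"
    by (rule has_derivative_compose[of "\<lambda>t. t *\<^sub>R y" "\<lambda>s. s *\<^sub>R y"])
      (use y in \<open>auto intro!: derivative_eq_intros has_derivative_fd smooth_on_differentiable[OF smooth]\<close>)
  then have "((\<lambda>t. t * f y) has_derivative (\<lambda>s. fd f y (s *\<^sub>R y))) (at 1)"
    using has_derivative_cong_open[of "{0<..}" 1 "\<lambda>t. f (t *\<^sub>R y)" "\<lambda>t. t * f y"] hom by auto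
  moreover have "((\<lambda>t. t * f y) has_derivative (\<lambda>s. s * f y)) (at 1)"
    by (auto intro!: derivative_eq_intros)
  ultimately have "(\<lambda>s. fd f y (s *\<^sub>R y)) = (\<lambda>s. s * f y)"
    by (rule has_derivative_unique)
  from fun_cong[OF this, of 1] show ?thesis by simp
qed

text \<open>Positivity is forced by convexity: differentiating Euler's identity for \<open>E\<close>
  once more shows that the Hessian at \<open>y\<close>, evaluated twice on \<open>y\<close>, is the
  square of \<open>f y\<close>.\<close>

lemma f_pos:
  assumes y: "y \<noteq> 0"
  shows "f y > 0"
proof -
  have dE: "fd E z v = f z * fd f z v" if "z \<noteq> 0" for z v
  proof -
    have "(f has_derivative fd f z) (at z)"
      by (intro has_derivative_fd smooth_on_differentiable[OF smooth]) (use that in simp)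
    then have "(E has_derivative (\<lambda>v. f z * fd f z v)) (at z)"
      by (auto intro!: derivative_eq_intros simp: mult_ac)
    then show ?thesis by (rule fd_apply)
  qed
  have yS: "y \<in> UNIV - {0}" using y by simp
  have 1: "((\<lambda>z. fd E z z) has_derivative (\<lambda>h. fd (\<lambda>z. fd E z y) y h + fd E y (fd (\<lambda>z. z) y h))) (at y)"
    by (rule has_derivative_apply_linear[OF open_punctured yS _ linear_fd[OF smooth_on_differentiable[OF smooth_E]]
        smooth_on_differentiable[OF smooth_on_fd[OF smooth_E] yS]]) auto
  have "fd E z z = 2 * E z" if "z \<noteq> 0" for z
    using dE[OF that] euler[OF that] by (simp add: power2_eq_square)
  then have "fd (\<lambda>z. fd E z z) y = fd (\<lambda>z. 2 * E z) y"
    by (intro fd_cong_open[OF open_punctured yS]) auto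
  moreover have "fd (\<lambda>z. 2 * E z) y y = 2 * fd E y y"
    by (rule fd_apply) (rule has_derivative_mult_right[OF has_derivative_fd[OF smooth_on_differentiable[OF smooth_E yS]]])
  ultimately have "hess2 E y y y + fd E y y = 2 * fd E y y"
    using fd_apply[OF 1, of y] by (simp add: hess2_def)
  then have "hess2 E y y y = (f y)\<^sup>2" using dE[OF y] euler[OF y] by (simp add: power2_eq_square)
  then have "(f y)\<^sup>2 > 0" using pd[OF y y] hes_hess2[OF smooth y, of y y] by simp
  then show ?thesis using nonneg[of y] by (simp add: less_le)
qed

lemma f_eq_0_iff: "f y = 0 \<longleftrightarrow> y = 0"
  using f_pos[of y] f0 by (cases "y = 0") auto

text \<open>\<open>E\<close> is homogeneous of degree two, so its second derivatives have degree
  zero. This is \<open>hess2_covariant\<close> for the scaling by \<open>t\<close>, where the two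
  vector arguments supply the compensating square of \<open>t\<close>.\<close>

lemma H_hom:
  assumes t: "t > 0" and y: "y \<noteq> 0"
  shows "H (t *\<^sub>R y) = H y"
proof -
  have "v \<bullet> (H (t *\<^sub>R y) *v w) = v \<bullet> (H y *v w)" for v w
  proof -
    have ty: "t *\<^sub>R y \<noteq> 0" using t y by simp
    have e: "t\<^sup>2 * E z = E (t *\<^sub>R z)" for z using hom[OF t, of z] by (simp add: power_mult_distrib)
    have inj: "inj (\<lambda>z. t *\<^sub>R z :: real^'n)" using t by (simp add: inj_def)
    have "hess2 (\<lambda>z. t\<^sup>2 * E z) y v w = hess2 E (t *\<^sub>R y) (t *\<^sub>R v) (t *\<^sub>R w)"
      by (rule hess2_covariant[OF _ inj smooth_E e y]) (simp add: linear_scale_self)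
    also have "\<dots> = t\<^sup>2 * hess2 E (t *\<^sub>R y) v w"
      using linear_cmul[OF hess2_linear(1)[OF smooth_E ty]] linear_cmul[OF hess2_linear(2)[OF smooth_E ty]]
      by (simp add: power2_eq_square)
    also have "hess2 (\<lambda>z. t\<^sup>2 * E z) y v w = t\<^sup>2 * hess2 E y v w"
    proof -
      have 1: "fd (\<lambda>z. t\<^sup>2 * E z) z w = t\<^sup>2 * fd E z w" if "z \<noteq> 0" for z
        by (rule fd_apply) (rule has_derivative_mult_right[OF has_derivative_fd[OF smooth_on_differentiable[OF smooth_E]]], use that in simp)
      have "fd (\<lambda>z. fd (\<lambda>z. t\<^sup>2 * E z) z w) y v = fd (\<lambda>z. t\<^sup>2 * fd E z w) y v"
        by (rule fun_cong[OF fd_cong_open[OF open_punctured]]) (use y 1 in auto)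
      also have "\<dots> = t\<^sup>2 * fd (\<lambda>z. fd E z w) y v"
        by (rule fd_apply) (rule has_derivative_mult_right[OF has_derivative_fd[OF smooth_on_differentiable[OF smooth_on_fd[OF smooth_E]]]], use y in simp)
      finally show ?thesis by (simp add: hess2_def)
    qed
    finally have "hess2 E (t *\<^sub>R y) v w = hess2 E y v w" using t by simp
    then show ?thesis using hes_hess2[OF smooth ty] hes_hess2[OF smooth y] by simp
  qed
  then have "H (t *\<^sub>R y) *v w = H y *v w" for w by (metis vector_eq_rdot inner_commute)
  then show ?thesis by (metis matrix_eq)
qed

lemma H_continuous: "continuous_on (UNIV - {0}) H"
proof -
  have "continuous_on (UNIV - {0}) (\<lambda>y. H y $ i $ j)" for i j
    unfolding hes_def partial_def[abs_def]
    by (simp add: smooth_on_continuous smooth_on_fd smooth_E)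
  then show ?thesis
    unfolding continuous_on_def
    by (auto intro!: vec_tendstoI)
qed

lemma det_H_pos: "y \<noteq> 0 \<Longrightarrow> det (H y) > 0"
  using det_pos_def pd by blast

lemma det_H_continuous: "continuous_on (UNIV - {0}) (\<lambda>y. det (H y))"
  unfolding det_def by (intro continuous_intros H_continuous continuous_on_compose2[OF continuous_on_component])

end

text \<open>Invertibility of \<open>A\<close> comes out of the identity of norms:
  \<open>g (A *v z) = f z\<close> is positive for nonzero \<open>z\<close>, so \<open>A\<close> has
  no kernel.\<close>

lemma hes_covariant:
  fixes A :: "real^'n^'n"
  assumes "minkowski_norm f" "minkowski_norm g" and eq: "\<And>z. g (A *v z) = f z" and y: "y \<noteq> 0"
  shows "A *v y \<noteq> 0" "v \<bullet> (hes f y *v w) = (A *v v) \<bullet> (hes g (A *v y) *v (A *v w))"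
    "hes f y = transpose A ** hes g (A *v y) ** A" "det A \<noteq> 0"
proof -
  interpret f: minkowski_norm f by fact
  interpret g: minkowski_norm g by fact
  have Az: "A *v z \<noteq> 0" if "z \<noteq> 0" for z
    using f.f_pos[OF that] eq[of z] g.f0 by auto
  then show Ay: "A *v y \<noteq> 0" using y by simp
  have inj: "inj ((*v) A)"
    using Az by (simp add: linear_injective_0[OF matrix_vector_mul_linear]) blast
  then show "det A \<noteq> 0" by (simp add: det_nz_iff_inj_matrix)
  have "hess2 f.E y v w = hess2 g.E (A *v y) (A *v v) (A *v w)" for v w
    by (rule hess2_covariant[OF matrix_vector_mul_linear inj g.smooth_E _ y]) (simp add: eq)
  then show 1: "v \<bullet> (hes f y *v w) = (A *v v) \<bullet> (hes g (A *v y) *v (A *v w))" for v w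
    using hes_hess2[OF f.smooth y] hes_hess2[OF g.smooth Ay] by simp
  have "v \<bullet> (hes f y *v w) = v \<bullet> ((transpose A ** hes g (A *v y) ** A) *v w)" for v w
    unfolding 1 by (simp only: matrix_vector_mul_assoc[symmetric] inner_transpose)
  then have "hes f y *v w = (transpose A ** hes g (A *v y) ** A) *v w" for w
    by (metis vector_eq_rdot inner_commute)
  then show "hes f y = transpose A ** hes g (A *v y) ** A" by (metis matrix_eq)
qed

subsection \<open>Integration over the indicatrix\<close>

text \<open>The surface integral over the Euclidean unit sphere; \<open>sin s\<close> is its area
  density.\<close>

definition sph :: "(real^3 \<Rightarrow> real) \<Rightarrow> real" where
  "sph \<rho> = integral ({0..pi} \<times> {0..2*pi}) (\<lambda>(s, t). \<rho> (sphere_param s t) * sin s)"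

definition ds_sphere :: "real \<Rightarrow> real \<Rightarrow> real^3" where
  "ds_sphere s t = vector [cos s * cos t, cos s * sin t, - sin s]"

definition dt_sphere :: "real \<Rightarrow> real \<Rightarrow> real^3" where
  "dt_sphere s t = vector [- sin s * sin t, sin s * cos t, 0]"

lemma sphere_dot: "sphere_param s t \<bullet> sphere_param s t = 1"
proof -
  have "sphere_param s t \<bullet> sphere_param s t = (sin s)\<^sup>2 * ((sin t)\<^sup>2 + (cos t)\<^sup>2) + (cos s)\<^sup>2"
    unfolding sphere_param_def inner_vec_def sum_3 vector_3 inner_real_def by algebra
  then show ?thesis by simp
qed

lemma norm_sphere [simp]: "norm (sphere_param s t) = 1"
  by (simp add: norm_eq_sqrt_inner sphere_dot)

lemma sphere_nonzero [simp]: "sphere_param s t \<noteq> 0"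
  using norm_sphere[of s t] by force

lemma sphere_cross: "sphere_param s t \<bullet> (cross3 (ds_sphere s t) (dt_sphere s t)) = sin s"
proof -
  have "sphere_param s t \<bullet> (cross3 (ds_sphere s t) (dt_sphere s t)) =
    sin s * (((sin s)\<^sup>2 + (cos s)\<^sup>2) * ((sin t)\<^sup>2 + (cos t)\<^sup>2))"
    unfolding sphere_param_def ds_sphere_def dt_sphere_def cross3_def inner_vec_def sum_3 vector_3 inner_real_def
    by algebra
  then show ?thesis by simp
qed

text \<open>The partial derivatives of a radially rescaled sphere have components along
  \<open>n\<close> that involve the derivative of the norm. The triple product with \<open>n\<close>
  discards them.\<close>

lemma triple_product_radial:
  "(a *\<^sub>R n) \<bullet> cross3 (\<alpha> *\<^sub>R n + q *\<^sub>R u) (\<beta> *\<^sub>R n + q *\<^sub>R w) = a * q\<^sup>2 * (n \<bullet> cross3 u w)"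
  by (simp add: cross_add_left cross_add_right cross_mult_left cross_mult_right inner_add_right
      dot_cross_self power2_eq_square)

lemma vec3_has_derivative:
  fixes f g h :: "'a::real_normed_vector \<Rightarrow> real"
  assumes "(f has_derivative f') F" "(g has_derivative g') F" "(h has_derivative h') F"
  shows "((\<lambda>x. vector [f x, g x, h x] :: real^3) has_derivative (\<lambda>y. vector [f' y, g' y, h' y])) F"
proof -
  have e: "vector [a, b, c] = a *\<^sub>R axis 1 1 + b *\<^sub>R axis 2 1 + c *\<^sub>R (axis 3 1 :: real^3)" for a b c :: real
    by (simp add: vec_eq_iff forall_3 axis_def)
  show ?thesis unfolding e by (intro derivative_intros assms)
qed

lemma sphere_has_derivative:
  assumes "(\<sigma> has_derivative \<sigma>') (at x)" "(\<tau> has_derivative \<tau>') (at x)"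
  shows "((\<lambda>x. sphere_param (\<sigma> x) (\<tau> x)) has_derivative
    (\<lambda>h. \<sigma>' h *\<^sub>R ds_sphere (\<sigma> x) (\<tau> x) + \<tau>' h *\<^sub>R dt_sphere (\<sigma> x) (\<tau> x))) (at x)"
proof -
  have "((\<lambda>x. sphere_param (\<sigma> x) (\<tau> x)) has_derivative
    (\<lambda>h. vector [sin (\<sigma> x) * (- sin (\<tau> x) * \<tau>' h) + (cos (\<sigma> x) * \<sigma>' h) * cos (\<tau> x),
       sin (\<sigma> x) * (cos (\<tau> x) * \<tau>' h) + (cos (\<sigma> x) * \<sigma>' h) * sin (\<tau> x), - sin (\<sigma> x) * \<sigma>' h])) (at x)"
    unfolding sphere_param_def
    by (intro vec3_has_derivative) (auto intro!: derivative_eq_intros assms simp: mult_ac)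
  moreover have "vector [sin (\<sigma> x) * (- sin (\<tau> x) * \<tau>' h) + (cos (\<sigma> x) * \<sigma>' h) * cos (\<tau> x),
       sin (\<sigma> x) * (cos (\<tau> x) * \<tau>' h) + (cos (\<sigma> x) * \<sigma>' h) * sin (\<tau> x), - sin (\<sigma> x) * \<sigma>' h]
    = \<sigma>' h *\<^sub>R ds_sphere (\<sigma> x) (\<tau> x) + \<tau>' h *\<^sub>R dt_sphere (\<sigma> x) (\<tau> x)" for h
    by (simp add: vec_eq_iff forall_3 ds_sphere_def dt_sphere_def)
  ultimately show ?thesis by simp
qed

lemma continuous_on_sphere: "continuous_on S (\<lambda>(s, t). sphere_param s t)"
proof -
  have "isCont (\<lambda>p. sphere_param (fst p) (snd p)) x" for x
    by (rule has_derivative_continuous[OF sphere_has_derivative]) (auto intro: derivative_intros)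
  then show ?thesis by (simp add: case_prod_beta continuous_at_imp_continuous_on)
qed

lemma continuous_on_sphere_compose:
  fixes k :: "real^3 \<Rightarrow> 'b::topological_space"
  assumes "continuous_on (UNIV - {0}) k"
  shows "continuous_on S (\<lambda>(s, t). k (sphere_param s t))"
proof -
  have "continuous_on S (\<lambda>p. k ((\<lambda>(s, t). sphere_param s t) p))"
    by (rule continuous_on_compose2[OF assms continuous_on_sphere]) auto
  then show ?thesis by (simp add: case_prod_beta)
qed

lemma det_matrix_cross:
  fixes L :: "real^3 \<Rightarrow> real^3"
  shows "det (matrix L) = L (axis 1 1) \<bullet> cross3 (L (axis 2 1)) (L (axis 3 1))"
  by (simp add: det_3 matrix_def cross3_def inner_vec_def sum_3 algebra_simps)

text \<open>The change of variables is done in \<open>real^3\<close> and Fubini in a product type;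
  the bijection between the two preserves boxes and their volumes.\<close>

lemma has_integral_vec3:
  fixes D :: "real^3 \<Rightarrow> real"
  assumes i: "(D has_integral i) (cbox (vector [a1, a2, a3]) (vector [b1, b2, b3]))"
  shows "((\<lambda>(r, s, t). D (vector [r, s, t])) has_integral i) (cbox (a1, a2, a3) (b1, b2, b3))"
proof -
  define \<iota> :: "real \<times> real \<times> real \<Rightarrow> real^3" where "\<iota> = (\<lambda>(r, s, t). vector [r, s, t])"
  define \<kappa> :: "real^3 \<Rightarrow> real \<times> real \<times> real" where "\<kappa> v = (v $ 1, v $ 2, v $ 3)" for v
  have \<kappa>\<iota>: "\<kappa> (\<iota> x) = x" for x by (simp add: \<kappa>_def \<iota>_def case_prod_beta)
  have \<iota>\<kappa>: "\<iota> (\<kappa> v) = v" for v by (simp add: \<kappa>_def \<iota>_def vec_eq_iff forall_3)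
  have \<iota>d: "(\<iota> has_derivative \<iota>) (at x)" for x
    unfolding \<iota>_def case_prod_beta by (intro vec3_has_derivative derivative_intros)
  have mem: "v \<in> cbox (\<iota> u) (\<iota> w) \<longleftrightarrow> \<kappa> v \<in> cbox u w" for u v w
    by (cases u; cases w) (auto simp: \<kappa>_def \<iota>_def mem_box_cart forall_3 cbox_Pair_eq)
  have im: "\<iota> ` cbox u w = cbox (\<iota> u) (\<iota> w)" for u w
  proof (rule set_eqI)
    fix v
    have "v \<in> \<iota> ` cbox u w \<longleftrightarrow> \<kappa> v \<in> cbox u w"
      by (auto simp: \<kappa>\<iota> \<iota>\<kappa> intro!: image_eqI[of v \<iota> "\<kappa> v"])
    then show "v \<in> \<iota> ` cbox u w \<longleftrightarrow> v \<in> cbox (\<iota> u) (\<iota> w)" by (simp only: mem)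
  qed
  have im': "\<kappa> ` cbox (\<iota> u) (\<iota> w) = cbox u w" for u w
    unfolding im[symmetric] image_image by (simp add: \<kappa>\<iota>)
  have p3: "(\<Prod>i\<in>UNIV. q i) = q 1 * q 2 * q 3" for q :: "3 \<Rightarrow> real"
    unfolding UNIV_3 by (simp add: mult.assoc)
  have ex_3: "(\<exists>i::3. P i) \<longleftrightarrow> P 1 \<or> P 2 \<or> P 3" for P by (metis exhaust_3)
  have c: "measure lborel (\<iota> ` cbox u w) = 1 * measure lborel (cbox u w)" for u w
  proof -
    obtain a b c where u: "u = (a, b, c)" by (metis surj_pair)
    obtain a' b' c' where w: "w = (a', b', c')" by (metis surj_pair)
    have "\<iota> ` cbox u w = cbox (vector [a, b, c]) (vector [a', b', c'])"
      unfolding im by (simp add: \<iota>_def u w)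
    also have "measure lborel \<dots> = measure lborel {a..a'} * (measure lborel {b..b'} * measure lborel {c..c'})"
      by (auto simp: content_cbox_if_cart interval_eq_empty_cart ex_3 p3)
    also have "\<dots> = measure lborel (cbox u w)" by (simp add: u w content_Pair)
    finally show ?thesis by simp
  qed
  have "((\<lambda>x. D (\<iota> x)) has_integral (1 / 1) *\<^sub>R i) (\<kappa> ` cbox (\<iota> (a1, a2, a3)) (\<iota> (b1, b2, b3)))"
  proof (rule has_integral_twiddle[of 1 \<kappa> \<iota>])
    show "continuous (at x) \<iota>" for x using has_derivative_continuous[OF \<iota>d] .
    show "\<exists>w z. \<iota> ` cbox u v = cbox w z" for u v using im by blast
    show "\<exists>w z. \<kappa> ` cbox u v = cbox w z" for u v
      using im'[of "\<kappa> u" "\<kappa> v"] unfolding \<iota>\<kappa> by blast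
    show "(D has_integral i) (cbox (\<iota> (a1, a2, a3)) (\<iota> (b1, b2, b3)))" using i by (simp add: \<iota>_def)
  qed (auto simp: \<kappa>\<iota> \<iota>\<kappa> c)
  then show ?thesis unfolding im' by (simp add: \<iota>_def case_prod_unfold)
qed

context
  fixes f :: "real^3 \<Rightarrow> real" and k :: "real^3 \<Rightarrow> real"
  assumes mn: "minkowski_norm f"
    and k: "continuous_on (UNIV - {0}) k" and khom: "\<And>t y. t > 0 \<Longrightarrow> y \<noteq> 0 \<Longrightarrow> k (t *\<^sub>R y) = k y"
begin

interpretation minkowski_norm f by (rule mn)

text \<open>Polar coordinates adapted to \<open>f\<close>: the radius is the value of
  \<open>f\<close>. Since \<open>k\<close> is constant along rays, the radial integral of the square
  of \<open>r\<close> over the unit interval gives the factor 1/3.\<close>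

lemma polar_integral:
  "k absolutely_integrable_on {y. f y < 1}" "3 * integral {y. f y < 1} k = sph (\<lambda>y. k y / f y ^ 3)"
proof -
  define N where "N v = sphere_param (v $ 2) (v $ 3)" for v :: "real^3"
  define g where "g v = (v $ 1 / f (N v)) *\<^sub>R N v" for v
  define N' where "N' v h = h $ 2 *\<^sub>R ds_sphere (v $ 2) (v $ 3) + h $ 3 *\<^sub>R dt_sphere (v $ 2) (v $ 3)" for v h :: "real^3"
  define q' where "q' v h = (h $ 1 * f (N v) - v $ 1 * fd f (N v) (N' v h)) / (f (N v) * f (N v))" for v h :: "real^3"
  define g' where "g' v h = q' v h *\<^sub>R N v + (v $ 1 / f (N v)) *\<^sub>R (N' v h)" for v h :: "real^3"
  have N0 [simp]: "N v \<noteq> 0" for v by (simp add: N_def)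
  have fN: "f (N v) > 0" for v using f_pos by simp
  have Nd: "(N has_derivative N' v) (at v)" for v
    unfolding N_def N'_def by (intro sphere_has_derivative bounded_linear_imp_has_derivative bounded_linear_vec_nth)
  have fNd: "((\<lambda>v. f (N v)) has_derivative (\<lambda>h. fd f (N v) (N' v h))) (at v)" for v
    by (rule has_derivative_compose[OF Nd has_derivative_fd[OF smooth_on_differentiable[OF smooth]]]) simp
  have qd: "((\<lambda>v. v $ 1 / f (N v)) has_derivative q' v) (at v)" for v
  proof -
    have "((\<lambda>v. v $ 1) has_derivative (\<lambda>h. h $ 1)) (at v)"
      by (intro bounded_linear_imp_has_derivative bounded_linear_vec_nth)
    from has_derivative_divide'[OF this fNd] fN[of v] show ?thesis
      unfolding q'_def by simp
  qed
  have gd: "(g has_derivative g' v) (at v)" for v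
    unfolding g_def g'_def
    by (rule has_derivative_eq_rhs[OF has_derivative_scaleR[OF qd Nd]]) (auto simp: N_def algebra_simps)
  \<comment> \<open>The first column is radial, so the radial parts of the other two, which contain
    the derivative of \<open>f\<close>, do not contribute.\<close>
  have det: "det (matrix (g' v)) = v $ 1 ^ 2 * sin (v $ 2) / f (N v) ^ 3" for v
  proof -
    have ax: "axis i 1 $ i = (1::real)" "i \<noteq> j \<Longrightarrow> axis i 1 $ j = (0::real)" for i j :: 3
      by (simp_all add: axis_def)
    have e1: "g' v (axis 1 1) = (1 / f (N v)) *\<^sub>R N v"
      using linear_0[OF linear_fd[OF smooth_on_differentiable[OF smooth]], of "N v"] by (simp add: g'_def q'_def N'_def ax)
    have e2: "g' v (axis 2 1) = q' v (axis 2 1) *\<^sub>R N v + (v $ 1 / f (N v)) *\<^sub>R ds_sphere (v $ 2) (v $ 3)"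
      and e3: "g' v (axis 3 1) = q' v (axis 3 1) *\<^sub>R N v + (v $ 1 / f (N v)) *\<^sub>R dt_sphere (v $ 2) (v $ 3)"
      by (simp_all add: g'_def N'_def ax)
    show ?thesis
      unfolding det_matrix_cross e1 e2 e3 triple_product_radial
      by (simp add: N_def sphere_cross power2_eq_square power3_eq_cube)
  qed
  \<comment> \<open>The open box, where the polar map is injective; the closed one is used for
    integrating the continuous density.\<close>
  define S where "S = box (0::real^3) (vector [1, pi, 2 * pi])"
  have S: "v \<in> S \<longleftrightarrow> 0 < v $ 1 \<and> v $ 1 < 1 \<and> 0 < v $ 2 \<and> v $ 2 < pi \<and> 0 < v $ 3 \<and> v $ 3 < 2 * pi" for v
    by (auto simp: S_def mem_box_cart forall_3)
  have fg: "f (g v) = v $ 1" if "v $ 1 > 0" for v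
    using fN[of v] that hom[of "v $ 1 / f (N v)" "N v"] by (simp add: g_def)
  have inj: "inj_on g S"
  proof (rule inj_onI)
    fix v w assume v: "v \<in> S" and w: "w \<in> S" and eq: "g v = g w"
    then have 1: "v $ 1 = w $ 1" using fg[of v] fg[of w] by (simp add: S)
    have "norm (g v) = v $ 1 / f (N v)" "norm (g w) = w $ 1 / f (N w)"
      using v w fN[of v] fN[of w] by (simp_all add: g_def N_def S)
    then have "f (N v) = f (N w)" using eq 1 v fN[of v] fN[of w] by (simp add: S field_simps)
    then have NN: "N v = N w" using eq 1 v fN[of v] fN[of w] by (simp add: g_def S)
    then have c: "cos (v $ 2) = cos (w $ 2)" "sin (v $ 2) * cos (v $ 3) = sin (w $ 2) * cos (w $ 3)"
      "sin (v $ 2) * sin (v $ 3) = sin (w $ 2) * sin (w $ 3)"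
      by (simp_all add: N_def sphere_param_def vec_eq_iff forall_3)
    have 2: "v $ 2 = w $ 2" using c(1) v w cos_inj_pi by (simp add: S)
    moreover have "sin (w $ 2) > 0" using w by (simp add: S sin_gt_zero)
    ultimately have "sin (v $ 3) = sin (w $ 3) \<and> cos (v $ 3) = cos (w $ 3)" using c by simp
    then obtain n :: int where n: "v $ 3 = w $ 3 + 2 * pi * n" using sin_cos_eq_iff by blast
    have d: "2 * pi * n = v $ 3 - w $ 3" using n by simp
    have "\<bar>2 * pi * n\<bar> < 2 * pi" unfolding d abs_less_iff using v w by (auto simp: S)
    then have "\<bar>real_of_int n\<bar> < 1" by (simp add: abs_mult)
    then have "n = 0" by linarith
    then show "v = w" using 1 2 n by (simp add: vec_eq_iff forall_3)
  qed
  have img: "g ` S \<subseteq> {y. f y < 1}" using fg by (auto simp: S)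
  \<comment> \<open>What the polar map misses lies in the half plane where the angle
    \<open>t\<close> would be 0, including the axis and the origin. The hyperplane containing it is
    negligible.\<close>
  have img2: "{y. f y < 1} - g ` S \<subseteq> {y. y $ 2 = 0}"
  proof
    fix y assume y: "y \<in> {y. f y < 1} - g ` S"
    show "y \<in> {y. y $ 2 = 0}"
    proof (rule ccontr)
      assume "y \<notin> {y. y $ 2 = 0}"
      then have y2: "y $ 2 \<noteq> 0" by simp
      then have y0: "y \<noteq> 0" by auto
      define m where "m = norm y"
      have m: "m > 0" using y0 by (simp add: m_def)
      have m2: "m\<^sup>2 = (y $ 1)\<^sup>2 + (y $ 2)\<^sup>2 + (y $ 3)\<^sup>2"
      proof -
        have "m\<^sup>2 = y \<bullet> y" by (simp add: m_def power2_norm_eq_inner)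
        also have "\<dots> = (y $ 1)\<^sup>2 + (y $ 2)\<^sup>2 + (y $ 3)\<^sup>2"
          by (simp add: inner_vec_def sum_3 power2_eq_square)
        finally show ?thesis .
      qed
      define \<rho> where "\<rho> = sqrt ((y $ 1)\<^sup>2 + (y $ 2)\<^sup>2)"
      have \<rho>: "\<rho> > 0" using y2 by (simp add: \<rho>_def sum_power2_gt_zero_iff)
      have \<rho>2: "\<rho>\<^sup>2 = (y $ 1)\<^sup>2 + (y $ 2)\<^sup>2" by (simp add: \<rho>_def)
      have unit: "(a / q)\<^sup>2 + (b / q)\<^sup>2 = 1" if "q > 0" "q\<^sup>2 = a\<^sup>2 + b\<^sup>2" for a b q :: real
      proof -
        have e: "(a / q)\<^sup>2 + (b / q)\<^sup>2 = (a\<^sup>2 + b\<^sup>2) / q\<^sup>2" by (simp add: power_divide add_divide_distrib)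
        show ?thesis unfolding e that(2)[symmetric] using that(1) by simp
      qed
      have "(y $ 3 / m)\<^sup>2 + (\<rho> / m)\<^sup>2 = 1" using m2 \<rho>2 by (intro unit m) simp
      then obtain s where s: "0 \<le> s" "s \<le> pi" "y $ 3 / m = cos s" "\<rho> / m = sin s"
        using sincos_total_pi[of "\<rho> / m" "y $ 3 / m"] \<rho> m by (auto simp: less_imp_le)
      obtain t where t: "0 \<le> t" "t < 2 * pi" "y $ 1 / \<rho> = cos t" "y $ 2 / \<rho> = sin t"
        by (rule sincos_total_2pi[OF unit[OF \<rho> \<rho>2]]) (rule that)
      have s': "0 < s" "s < pi" using s \<rho> m by (auto simp: less_le)
      have t': "0 < t" using t y2 \<rho> by (auto simp: less_le)
      define v :: "real^3" where "v = vector [f y, s, t]"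
      have ym: "y = m *\<^sub>R N v"
        using s t m \<rho> by (simp add: vec_eq_iff forall_3 N_def v_def sphere_param_def s(3)[symmetric] s(4)[symmetric] t(3)[symmetric] t(4)[symmetric])
      have fy: "f y = m * f (N v)" by (subst ym) (rule hom[OF m])
      have "v \<in> S" using y s' t' t f_pos[OF y0] by (simp add: S v_def)
      moreover have "g v = y"
      proof -
        have v1: "v $ 1 = f y" by (simp add: v_def)
        have "v $ 1 / f (N v) = m" unfolding v1 fy using fN[of v] by simp
        then show ?thesis unfolding g_def using ym by (simp only:)
      qed
      ultimately show False using y by blast
    qed
  qed
  define D where "D v = v $ 1 ^ 2 * (k (N v) / f (N v) ^ 3 * sin (v $ 2))" for v
  have contN: "continuous_on T N" for T
    using has_derivative_continuous[OF Nd] by (simp add: continuous_at_imp_continuous_on)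
  define K where "K = (\<lambda>(s, t). k (sphere_param s t) / f (sphere_param s t) ^ 3 * sin s)"
  have cD: "continuous_on T D" for T
    unfolding D_def
    by (intro continuous_intros continuous_on_compose2[OF k contN] continuous_on_compose2[OF smooth_on_continuous[OF smooth] contN])
      (use fN in \<open>auto simp: less_imp_neq[symmetric]\<close>)
  have DS: "\<bar>det (matrix (g' v))\<bar> * k (g v) = D v" if "v \<in> S" for v
  proof -
    have "sin (v $ 2) > 0" using that by (simp add: S sin_gt_zero)
    then show ?thesis
      using khom[of "v $ 1 / f (N v)" "N v"] that fN[of v] by (simp add: det D_def g_def S abs_mult)
  qed
  have ai: "D absolutely_integrable_on cbox 0 (vector [1, pi, 2 * pi])"
    by (rule absolutely_integrable_continuous[OF cD])
  then have aiS: "D absolutely_integrable_on S"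
    unfolding S_def by (simp add: absolutely_integrable_on_open_interval)
  \<comment> \<open>The change of variables concerns vector-valued functions, so the scalar
    integrand passes through \<open>real^1\<close>.\<close>
  have "(\<lambda>v. \<bar>det (matrix (g' v))\<bar> *\<^sub>R vec (k (g v)) :: real^1) absolutely_integrable_on S \<and>
      integral S (\<lambda>v. \<bar>det (matrix (g' v))\<bar> *\<^sub>R vec (k (g v))) = (vec (integral S D) :: real^1)
    \<longleftrightarrow> (\<lambda>y. vec (k y) :: real^1) absolutely_integrable_on (g ` S) \<and> integral (g ` S) (\<lambda>y. vec (k y)) = (vec (integral S D) :: real^1)"
  proof (rule has_absolute_integral_change_of_variables)
    show "S \<in> sets lebesgue" unfolding S_def by (simp add: fmeasurableD)
    show "(g has_derivative g' v) (at v within S)" for v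
      using gd has_derivative_at_withinI by blast
  qed (rule inj)
  then have *: "(\<lambda>v. \<bar>det (matrix (g' v))\<bar> * k (g v)) absolutely_integrable_on S \<and>
      integral S (\<lambda>v. \<bar>det (matrix (g' v))\<bar> * k (g v)) = integral S D
    \<longleftrightarrow> k absolutely_integrable_on (g ` S) \<and> integral (g ` S) k = integral S D"
    by (simp add: absolutely_integrable_on_1_iff integral_on_1_eq)
  have "(\<lambda>v. \<bar>det (matrix (g' v))\<bar> * k (g v)) absolutely_integrable_on S"
  proof -
    have "set_integrable lebesgue S (\<lambda>v. \<bar>det (matrix (g' v))\<bar> * k (g v)) \<longleftrightarrow> set_integrable lebesgue S D"
      by (intro set_integrable_cong refl DS)
    then show ?thesis using aiS by simp
  qed
  moreover have "integral S (\<lambda>v. \<bar>det (matrix (g' v))\<bar> * k (g v)) = integral S D"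
    by (rule integral_cong) (rule DS)
  ultimately have kS: "k absolutely_integrable_on (g ` S)" "integral (g ` S) k = integral S D"
    using * by auto
  have neg: "negligible (g ` S - {y. f y < 1})" "negligible ({y. f y < 1} - g ` S)"
    using img negligible_subset[OF negligible_standard_hyperplane_cart img2] by (simp_all add: Diff_eq_empty_iff[THEN iffD2])
  show "k absolutely_integrable_on {y. f y < 1}"
    by (rule absolutely_integrable_spike_set[OF kS(1)]) (rule negligible_subset[OF neg(1)] negligible_subset[OF neg(2)], blast)+
  have "integral {y. f y < 1} k = integral (g ` S) k"
    by (rule integral_spike_set) (rule negligible_subset[OF neg(1)] negligible_subset[OF neg(2)], blast)+
  also have "\<dots> = integral (cbox 0 (vector [1, pi, 2 * pi])) D"
    unfolding kS(2) unfolding S_def by (rule integral_open_interval)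
  also have "\<dots> = integral (cbox (0, 0, 0) (1, pi, 2 * pi)) (\<lambda>(r, s, t). D (vector [r, s, t]))"
  proof -
    have z: "(0::real^3) = vector [0, 0, 0]" by (simp add: vec_eq_iff forall_3)
    have "(D has_integral integral (cbox 0 (vector [1, pi, 2 * pi])) D) (cbox (vector [0, 0, 0]) (vector [1, pi, 2 * pi]))"
      unfolding z[symmetric] by (rule integrable_integral[OF integrable_continuous[OF cD]])
    from integral_unique[OF has_integral_vec3[OF this]] show ?thesis by simp
  qed
  also have "\<dots> = integral (cbox (0, 0, 0) (1, pi, 2 * pi)) (\<lambda>(r, p). r\<^sup>2 * K p)"
    by (rule integral_cong) (auto simp: D_def N_def K_def)
  also have "\<dots> = integral (cbox 0 1) (\<lambda>r. integral (cbox (0, 0) (pi, 2 * pi)) (\<lambda>p. r\<^sup>2 * K p))"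
  proof -
    have "continuous_on (cbox (0, 0) (pi, 2 * pi)) (\<lambda>p. (\<lambda>(s, t). k (sphere_param s t)) p / (\<lambda>(s, t). f (sphere_param s t)) p ^ 3 * sin (fst p))"
      by (intro continuous_intros continuous_on_sphere_compose k smooth_on_continuous[OF smooth])
        (auto simp: f_eq_0_iff)
    then have c: "continuous_on (cbox (0, 0) (pi, 2 * pi)) K"
      by (simp add: K_def case_prod_beta)
    have "continuous_on (cbox (0::real, 0, 0) (1, pi, 2 * pi)) (\<lambda>x. (fst x)\<^sup>2 * K (snd x))"
      by (intro continuous_intros continuous_on_compose2[OF c]) (auto simp: cbox_Pair_eq)
    then show ?thesis
      by (subst integral_prod_continuous) (simp_all add: case_prod_beta)
  qed
  also have "\<dots> = integral {0..1} (\<lambda>r. r\<^sup>2 * sph (\<lambda>y. k y / f y ^ 3))"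
  proof -
    have "integral (cbox (0, 0) (pi, 2 * pi)) K = sph (\<lambda>y. k y / f y ^ 3)"
      by (simp add: sph_def K_def cbox_Pair_eq)
    then show ?thesis by (simp only: integral_mult_right box_real)
  qed
  also have "\<dots> = integral {0..1} (\<lambda>r. r\<^sup>2) * sph (\<lambda>y. k y / f y ^ 3)"
    by (rule integral_mult_left)
  also have "integral {0..1} (\<lambda>r::real. r\<^sup>2) = 1 / 3"
  proof -
    have "((\<lambda>r::real. r\<^sup>2) has_integral (1 ^ 3 / 3 - 0 ^ 3 / 3)) {0..1}"
      by (rule fundamental_theorem_of_calculus)
        (auto intro!: derivative_eq_intros simp: has_real_derivative_iff_has_vector_derivative[symmetric])
    then show ?thesis by (simp add: integral_unique)
  qed
  finally show "3 * integral {y. f y < 1} k = sph (\<lambda>y. k y / f y ^ 3)" by simp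
qed

end

lemma sph_integrable:
  assumes "continuous_on (UNIV - {0}) \<rho>"
  shows "(\<lambda>(s, t). \<rho> (sphere_param s t) * sin s) integrable_on ({0..pi} \<times> {0..2*pi})"
    "continuous_on ({0..pi} \<times> {0..2*pi}) (\<lambda>(s, t). \<rho> (sphere_param s t) * sin s)"
proof -
  have "continuous_on S (\<lambda>p. (\<lambda>(s, t). \<rho> (sphere_param s t)) p * sin (fst p))" for S
    by (intro continuous_intros continuous_on_sphere_compose assms)
  then have c: "continuous_on S (\<lambda>(s, t). \<rho> (sphere_param s t) * sin s)" for S
    by (simp add: case_prod_unfold)
  then show "continuous_on ({0..pi} \<times> {0..2*pi}) (\<lambda>(s, t). \<rho> (sphere_param s t) * sin s)" .
  have "(\<lambda>(s, t). \<rho> (sphere_param s t) * sin s) integrable_on cbox (0, 0) (pi, 2 * pi)"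
    by (rule integrable_continuous[OF c])
  then show "(\<lambda>(s, t). \<rho> (sphere_param s t) * sin s) integrable_on ({0..pi} \<times> {0..2*pi})"
    by (simp add: cbox_Pair_eq)
qed

lemma sph_cmul: "sph (\<lambda>y. c * \<rho> y) = c * sph \<rho>"
proof -
  have "(\<lambda>(s, t). c * \<rho> (sphere_param s t) * sin s) = (\<lambda>p. c * (\<lambda>(s, t). \<rho> (sphere_param s t) * sin s) p)"
    by (auto simp: fun_eq_iff)
  then show ?thesis unfolding sph_def by (simp only: integral_mult_right)
qed

lemma sph_sum:
  assumes "finite A" "\<And>i. i \<in> A \<Longrightarrow> continuous_on (UNIV - {0}) (\<rho> i)"
  shows "sph (\<lambda>y. \<Sum>i\<in>A. \<rho> i y) = (\<Sum>i\<in>A. sph (\<rho> i))"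
proof -
  have "(\<lambda>(s, t). (\<Sum>i\<in>A. \<rho> i (sphere_param s t)) * sin s) = (\<lambda>p. \<Sum>i\<in>A. (\<lambda>(s, t). \<rho> i (sphere_param s t) * sin s) p)"
    by (auto simp: fun_eq_iff sum_distrib_right)
  then show ?thesis
    unfolding sph_def using integral_sum[OF assms(1) sph_integrable(1)[OF assms(2)]] by (simp only:)
qed

section \<open>The Gram matrix of the averaged metric\<close>

text \<open>The averaged metric in fibre coordinates in which the norm is \<open>f\<close>. The cube
  of \<open>f\<close> comes from projecting the indicatrix radially to the unit sphere, as
  \<open>indicatrix_integral_sph\<close> shows.\<close>

definition Gmat :: "(real^3 \<Rightarrow> real) \<Rightarrow> real^3^3" where
  "Gmat f = (\<chi> i j. sph (\<lambda>y. hes f y $ i $ j * sqrt (det (hes f y)) / f y ^ 3))"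

text \<open>The integrand without the cube of \<open>f\<close>: homogeneous of degree zero, so that
  \<open>polar_integral\<close> turns it into an integral over the unit ball.\<close>

definition gweight :: "(real^3 \<Rightarrow> real) \<Rightarrow> real^3 \<Rightarrow> real^3 \<Rightarrow> real^3 \<Rightarrow> real" where
  "gweight f v w y = (v \<bullet> (hes f y *v w)) * sqrt (det (hes f y))"

context
  fixes f :: "real^3 \<Rightarrow> real"
  assumes mn: "minkowski_norm f"
begin

interpretation minkowski_norm f by (rule mn)

lemma gweight_continuous: "continuous_on (UNIV - {0}) (gweight f v w)"
proof -
  have "continuous_on (UNIV - {0}) (\<lambda>y. v \<bullet> (H y *v w))"
  proof -
    have "v \<bullet> (A *v w) = (\<Sum>i\<in>UNIV. v $ i * (\<Sum>j\<in>UNIV. A $ i $ j * w $ j))" for A :: "real^3^3"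
      by (simp add: inner_vec_def matrix_vector_mult_def)
    then show ?thesis
      by (simp only:) (intro continuous_intros H_continuous continuous_on_compose2[OF continuous_on_component])
  qed
  then show ?thesis
    unfolding gweight_def by (rule continuous_on_mult[OF _ continuous_on_real_sqrt[OF det_H_continuous]])
qed

lemma gweight_f_continuous: "continuous_on (UNIV - {0}) (\<lambda>y. gweight f v w y / f y ^ 3)"
  by (intro continuous_intros gweight_continuous smooth_on_continuous[OF smooth]) (auto simp: f_eq_0_iff)

lemma gweight_hom: "t > 0 \<Longrightarrow> y \<noteq> 0 \<Longrightarrow> gweight f v w (t *\<^sub>R y) = gweight f v w y"
  by (simp add: gweight_def H_hom)

lemma Gmat_form: "v \<bullet> (Gmat f *v w) = sph (\<lambda>y. gweight f v w y / f y ^ 3)"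
proof -
  let ?\<rho> = "\<lambda>i j y. hes f y $ i $ j * sqrt (det (hes f y)) / f y ^ 3"
  have c: "continuous_on (UNIV - {0}) (?\<rho> i j)" for i j
  proof -
    have "axis i 1 \<bullet> (A *v axis j 1) = A $ i $ j" for A :: "real^3^3"
      by (simp add: inner_axis' matrix_vector_mul_component inner_axis)
    then show ?thesis using gweight_f_continuous[of "axis i 1" "axis j 1"] by (simp add: gweight_def)
  qed
  have "(\<lambda>y. gweight f v w y / f y ^ 3) = (\<lambda>y. \<Sum>i\<in>UNIV. \<Sum>j\<in>UNIV. (v $ i * w $ j) * ?\<rho> i j y)"
    by (auto simp: fun_eq_iff gweight_def inner_vec_def matrix_vector_mult_def sum_distrib_left sum_distrib_right sum_divide_distrib mult_ac)
  then have "sph (\<lambda>y. gweight f v w y / f y ^ 3) = (\<Sum>i\<in>UNIV. \<Sum>j\<in>UNIV. (v $ i * w $ j) * sph (?\<rho> i j))"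
    using c by (simp add: sph_sum sph_cmul continuous_on_sum continuous_on_mult_left del: times_divide_eq_right)
  also have "\<dots> = v \<bullet> (Gmat f *v w)"
    by (simp add: Gmat_def inner_vec_def matrix_vector_mult_def sum_distrib_left mult_ac)
  finally show ?thesis by simp
qed

lemma Gmat_sym: "v \<bullet> (Gmat f *v w) = w \<bullet> (Gmat f *v v)"
proof -
  have "gweight f v w (sphere_param s t) = gweight f w v (sphere_param s t)" for s t
    by (simp add: gweight_def hes_hess2[OF smooth] hess2_sym[OF smooth_E _])
  then show ?thesis unfolding Gmat_form sph_def by simp
qed

lemma Gmat_pos:
  assumes v: "v \<noteq> 0"
  shows "v \<bullet> (Gmat f *v v) > 0"
proof -
  let ?q = "\<lambda>(s, t). gweight f v v (sphere_param s t) / f (sphere_param s t) ^ 3 * sin s"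
  have p: "gweight f v v (sphere_param s t) / f (sphere_param s t) ^ 3 > 0" for s t
    using pd[OF sphere_nonzero v] det_H_pos[OF sphere_nonzero] f_pos[OF sphere_nonzero]
    by (simp add: gweight_def)
  have nn: "?q x \<ge> 0" if "x \<in> cbox (0, 0) (pi, 2 * pi)" for x
  proof -
    obtain s t where x: "x = (s, t)" by (metis surj_pair)
    then have "sin s \<ge> 0" using that by (auto simp: cbox_Pair_eq intro: sin_ge_zero)
    then have "gweight f v v (sphere_param s t) / f (sphere_param s t) ^ 3 * sin s \<ge> 0"
      by (intro mult_nonneg_nonneg less_imp_le[OF p])
    then show ?thesis by (simp only: x prod.case)
  qed
  have c: "continuous_on (cbox (0, 0) (pi, 2 * pi)) ?q"
    using sph_integrable(2)[OF gweight_f_continuous] by (simp add: cbox_Pair_eq)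
  have "integral (cbox (0, 0) (pi, 2 * pi)) ?q \<noteq> 0"
  proof
    assume "integral (cbox (0, 0) (pi, 2 * pi)) ?q = 0"
    moreover have "box (0, 0) (pi, 2 * pi) \<noteq> ({} :: (real \<times> real) set)"
      by (auto simp: box_ne_empty Basis_prod_def)
    \<comment> \<open>The density \<open>sin s\<close> vanishes at the poles, so the strict
      inequality is tested at a point of the equator.\<close>
    moreover have "(pi / 2, 0) \<in> cbox (0, 0) (pi, 2 * pi)" by (simp add: cbox_Pair_eq)
    ultimately have "?q (pi / 2, 0) = 0"
      using integral_cbox_eq_0_iff[OF c _ nn] by blast
    then show False using p[of "pi / 2" 0] by (simp only: prod.case sin_pi_half mult_1_right less_irrefl)
  qed
  moreover have "integral (cbox (0, 0) (pi, 2 * pi)) ?q \<ge> 0"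
    by (rule integral_nonneg[OF integrable_continuous[OF c] nn])
  ultimately show ?thesis unfolding Gmat_form sph_def by (simp add: cbox_Pair_eq)
qed

end

text \<open>The Hessian determinants differ by the square of \<open>det A\<close>, so the square
  roots differ by its absolute value, which is the Jacobian of the linear map between the two unit
  balls. The lemma serves both coordinate changes and parallel transport.\<close>

lemma Gmat_covariant:
  fixes A :: "real^3^3"
  assumes f: "minkowski_norm f" and g: "minkowski_norm g" and eq: "\<And>z. g (A *v z) = f z"
  shows "v \<bullet> (Gmat f *v w) = (A *v v) \<bullet> (Gmat g *v (A *v w))"
proof -
  interpret f: minkowski_norm f by (rule f)
  interpret g: minkowski_norm g by (rule g)
  note cov = hes_covariant[OF f g eq]
  have dA: "det A \<noteq> 0" using cov(4)[of "axis 1 1"] by (simp add: axis_eq_0_iff)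
  let ?k = "gweight f v w" and ?l = "gweight g (A *v v) (A *v w)"
  have kl: "?k y = \<bar>det A\<bar> * ?l (A *v y)" if "y \<noteq> 0" for y
  proof -
    have "det (hes f y) = (det A)\<^sup>2 * det (hes g (A *v y))"
      unfolding cov(3)[OF that] by (simp add: det_mul det_transpose power2_eq_square)
    then have "sqrt (det (hes f y)) = \<bar>det A\<bar> * sqrt (det (hes g (A *v y)))"
      by (simp add: real_sqrt_mult)
    then show ?thesis by (simp add: gweight_def cov(2)[OF that])
  qed
  have lin: "linear ((*v) A)" by (rule matrix_vector_mul_linear)
  have im: "(*v) A ` {y. f y < 1} = {y. g y < 1}"
  proof (intro set_eqI iffI)
    fix z assume "z \<in> {y. g y < 1}"
    moreover obtain y where "z = A *v y"
      using dA by (metis invertible_det_nz invertible_right_inverse matrix_vector_mul_assoc matrix_vector_mul_lid)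
    ultimately show "z \<in> (*v) A ` {y. f y < 1}" using eq by auto
  qed (use eq in auto)
  have pg: "?l absolutely_integrable_on {y. g y < 1}" "3 * integral {y. g y < 1} ?l = sph (\<lambda>y. ?l y / g y ^ 3)"
    by (rule polar_integral[OF g gweight_continuous[OF g]]; simp add: gweight_hom[OF g])+
  have pf: "3 * integral {y. f y < 1} ?k = sph (\<lambda>y. ?k y / f y ^ 3)"
    by (rule polar_integral(2)[OF f gweight_continuous[OF f]]) (simp add: gweight_hom[OF f])
  have cv: "(\<lambda>y. \<bar>det (matrix ((*v) A))\<bar> *\<^sub>R vec (?l (A *v y)) :: real^1) absolutely_integrable_on {y. f y < 1} \<and>
      integral {y. f y < 1} (\<lambda>y. \<bar>det (matrix ((*v) A))\<bar> *\<^sub>R vec (?l (A *v y))) = (vec (integral {y. g y < 1} ?l) :: real^1)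
    \<longleftrightarrow> (\<lambda>y. vec (?l y) :: real^1) absolutely_integrable_on ((*v) A ` {y. f y < 1}) \<and>
      integral ((*v) A ` {y. f y < 1}) (\<lambda>y. vec (?l y)) = (vec (integral {y. g y < 1} ?l) :: real^1)"
    by (rule has_absolute_integral_change_of_variables_linear[OF lin])
  have "(\<lambda>y. vec (?l y) :: real^1) absolutely_integrable_on {y. g y < 1} \<and>
      integral {y. g y < 1} (\<lambda>y. vec (?l y)) = (vec (integral {y. g y < 1} ?l) :: real^1)"
    using pg(1) by (simp add: absolutely_integrable_on_1_iff integral_on_1_eq)
  from cv[unfolded im, THEN iffD2, OF this, THEN conjunct2]
  have "integral {y. f y < 1} (\<lambda>y. \<bar>det A\<bar> * ?l (A *v y)) = integral {y. g y < 1} ?l"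
    by (simp only: integral_on_1_eq vec_eq_iff forall_1 vec_component vector_scaleR_component
        real_scaleR_def matrix_of_matrix_vector_mul)
  \<comment> \<open>The pointwise identity \<open>kl\<close> is available off the origin only, a
    negligible set.\<close>
  moreover have "integral {y. f y < 1} ?k = integral {y. f y < 1} (\<lambda>y. \<bar>det A\<bar> * ?l (A *v y))"
    by (rule integral_spike[of "{0}"]) (use kl in auto)
  ultimately have "integral {y. f y < 1} ?k = integral {y. g y < 1} ?l" by simp
  then show ?thesis unfolding Gmat_form[OF f] Gmat_form[OF g] pf[symmetric] pg(2)[symmetric] by simp
qed

text \<open>Where \<open>f y = 1\<close> the volume form is \<open>sqrt (det g)\<close> times the
  triple product with \<open>y\<close>. The rescaled point and the two rescaled partial derivatives
  each contribute one factor \<open>1 / f\<close>, and \<open>h\<close> and \<open>hes f\<close> are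
  constant along rays.\<close>

lemma indicatrix_integral_sph:
  fixes M :: "('a, 3) manifold"
  assumes f_def: "f = (\<lambda>z. F p (tvec_of M c p z))"
    and mn: "minkowski_norm f" and h: "\<And>t y. t > 0 \<Longrightarrow> y \<noteq> 0 \<Longrightarrow> h (t *\<^sub>R y) = h y"
  shows "indicatrix_integral M F c p h = sph (\<lambda>y. h y * sqrt (det (hes f y)) / f y ^ 3)"
proof -
  interpret minkowski_norm f by (rule mn)
  have F: "F p (tvec_of M c p z) = f z" for z by (simp add: f_def)
  have ft: "fund_tensor M F c p y = hes f y" for y
    by (simp add: fund_tensor_def hes_def energy_def f_def)
  \<comment> \<open>Only the tangential coefficient matters, so the radial one may stay an
    unspecified \<alpha>.\<close>
  have rad: "\<exists>\<alpha>. vector_derivative (\<lambda>x. N x /\<^sub>R f (N x)) (at x) = \<alpha> *\<^sub>R N x + (1 / f (N x)) *\<^sub>R N' 1"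
    if N: "(N has_derivative N') (at x)" and N0: "N x \<noteq> 0" for N :: "real \<Rightarrow> real^3" and N' x
  proof -
    have "((\<lambda>x. f (N x)) has_derivative (\<lambda>h. fd f (N x) (N' h))) (at x)"
      by (rule has_derivative_compose[OF N has_derivative_fd[OF smooth_on_differentiable[OF smooth]]]) (use N0 in simp)
    then have "(\<lambda>x. inverse (f (N x))) differentiable (at x)"
      using f_pos[OF N0] by (intro differentiable_inverse) (auto simp: differentiable_def)
    from has_derivative_scaleR[OF has_derivative_fd[OF this] N]
    have "((\<lambda>x. N x /\<^sub>R f (N x)) has_derivative (\<lambda>h. inverse (f (N x)) *\<^sub>R N' h + fd (\<lambda>x. inverse (f (N x))) x h *\<^sub>R N x)) (at x)" .
    from fd_apply[OF this, of 1] frechet_derivative_eq_vector_derivative[OF differentiableI[OF this]]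
    have "vector_derivative (\<lambda>x. N x /\<^sub>R f (N x)) (at x) = inverse (f (N x)) *\<^sub>R N' 1 + fd (\<lambda>x. inverse (f (N x))) x 1 *\<^sub>R N x" by simp
    then show ?thesis by (intro exI[of _ "fd (\<lambda>x. inverse (f (N x))) x 1"]) (simp add: divide_inverse)
  qed
  have pt: "h (indicatrix_param M F c p s t) *
      indicatrix_form M F c p (indicatrix_param M F c p s t)
        (vector_derivative (\<lambda>s'. indicatrix_param M F c p s' t) (at s))
        (vector_derivative (\<lambda>t'. indicatrix_param M F c p s t') (at t))
    = h (sphere_param s t) * sqrt (det (hes f (sphere_param s t))) / f (sphere_param s t) ^ 3 * sin s" for s t
  proof -
    let ?n = "sphere_param s t"
    define \<phi> where "\<phi> = 1 / f ?n"
    have fn: "f ?n > 0" using f_pos by simp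
    have \<phi>: "\<phi> > 0" using fn by (simp add: \<phi>_def)
    have u: "indicatrix_param M F c p s t = \<phi> *\<^sub>R ?n"
      by (simp add: indicatrix_param_def F \<phi>_def divide_inverse)
    have fu: "f (\<phi> *\<^sub>R ?n) = 1" using fn by (simp add: hom[OF \<phi>]) (simp add: \<phi>_def)
    have "((\<lambda>s'. sphere_param s' t) has_derivative (\<lambda>h. h *\<^sub>R ds_sphere s t + 0 *\<^sub>R dt_sphere s t)) (at s)"
      by (intro sphere_has_derivative derivative_intros)
    from rad[OF this] obtain \<alpha> where a:
      "vector_derivative (\<lambda>s'. indicatrix_param M F c p s' t) (at s) = \<alpha> *\<^sub>R ?n + \<phi> *\<^sub>R ds_sphere s t"
      by (auto simp: indicatrix_param_def F \<phi>_def)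
    have "((\<lambda>t'. sphere_param s t') has_derivative (\<lambda>h. 0 *\<^sub>R ds_sphere s t + h *\<^sub>R dt_sphere s t)) (at t)"
      by (intro sphere_has_derivative derivative_intros)
    from rad[OF this] obtain \<beta> where b:
      "vector_derivative (\<lambda>t'. indicatrix_param M F c p s t') (at t) = \<beta> *\<^sub>R ?n + \<phi> *\<^sub>R dt_sphere s t"
      by (auto simp: indicatrix_param_def F \<phi>_def)
    have form: "indicatrix_form M F c p y a b = sqrt (det (hes f y)) * (y \<bullet> cross3 a b)" if "f y = 1" for y a b
      using that by (simp add: indicatrix_form_def F ft cross3_def inner_vec_def sum_3 algebra_simps)
    show ?thesis
      unfolding u a b form[OF fu] triple_product_radial sphere_cross h[OF \<phi> sphere_nonzero] H_hom[OF \<phi> sphere_nonzero]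
      by (simp add: \<phi>_def power2_eq_square power3_eq_cube)
  qed
  show ?thesis unfolding indicatrix_integral_def sph_def pt ..
qed

lemma averaged_metric_Gmat:
  fixes M :: "('a, 3) manifold"
  assumes "minkowski_norm (\<lambda>z. F p (tvec_of M (chart_at M p) p z))"
  shows "averaged_metric M F p v w = v (chart_at M p) \<bullet> (Gmat (\<lambda>z. F p (tvec_of M (chart_at M p) p z)) *v w (chart_at M p))"
proof -
  let ?c = "chart_at M p" and ?f = "\<lambda>z. F p (tvec_of M (chart_at M p) p z)"
  interpret minkowski_norm ?f by (rule assms)
  have ft: "fund_tensor M F ?c p y = hes ?f y" for y
    by (simp add: fund_tensor_def hes_def energy_def)
  have "indicatrix_integral M F ?c p (\<lambda>y. hes ?f y $ i $ j) = Gmat ?f $ i $ j" for i j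
    by (subst indicatrix_integral_sph[where f = ?f and M = M and F = F and c = ?c and p = p, OF refl assms]) (simp_all add: H_hom Gmat_def)
  then show ?thesis
    by (simp add: averaged_metric_def Let_def ft inner_vec_def matrix_vector_mult_def sum_distrib_left mult_ac)
qed

subsection \<open>Alternating torsion in dimension three\<close>

text \<open>Expanding all three arguments over the standard basis leaves the six permutations of one
  value, which form the determinant.\<close>

lemma alternating3:
  fixes \<phi> :: "real^3 \<Rightarrow> real^3 \<Rightarrow> real^3 \<Rightarrow> real"
  assumes l: "\<And>v w. linear (\<lambda>u. \<phi> u v w)" "\<And>u w. linear (\<lambda>v. \<phi> u v w)" "\<And>u v. linear (\<lambda>w. \<phi> u v w)"
    and a: "\<And>u v w. \<phi> v u w = - \<phi> u v w" "\<And>u v w. \<phi> u w v = - \<phi> u v w"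
  shows "\<phi> u v w = \<phi> (axis 1 1) (axis 2 1) (axis 3 1) * (cross3 u v \<bullet> w)"
proof -
  have z: "\<phi> u u w = 0" "\<phi> u w w = 0" "\<phi> u w u = 0" for u w
  proof -
    show 1: "\<phi> u u w = 0" for u w using a(1)[of u u w] by simp
    show "\<phi> u w w = 0" using a(2)[of u w w] by simp
    show "\<phi> u w u = 0" using a(2)[of u u w] 1[of u w] by simp
  qed
  let ?e = "\<lambda>i. axis i (1::real) :: real^3"
  have b: "\<phi> (?e 2) (?e 1) (?e 3) = - \<phi> (?e 1) (?e 2) (?e 3)" "\<phi> (?e 1) (?e 3) (?e 2) = - \<phi> (?e 1) (?e 2) (?e 3)"
    "\<phi> (?e 2) (?e 3) (?e 1) = \<phi> (?e 1) (?e 2) (?e 3)" "\<phi> (?e 3) (?e 1) (?e 2) = \<phi> (?e 1) (?e 2) (?e 3)"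
    "\<phi> (?e 3) (?e 2) (?e 1) = - \<phi> (?e 1) (?e 2) (?e 3)"
  proof -
    show 1: "\<phi> (?e 2) (?e 1) (?e 3) = - \<phi> (?e 1) (?e 2) (?e 3)" by (rule a(1))
    show 2: "\<phi> (?e 1) (?e 3) (?e 2) = - \<phi> (?e 1) (?e 2) (?e 3)" by (rule a(2))
    show 3: "\<phi> (?e 2) (?e 3) (?e 1) = \<phi> (?e 1) (?e 2) (?e 3)" using a(2)[of "?e 2" "?e 3" "?e 1"] 1 by simp
    show 4: "\<phi> (?e 3) (?e 1) (?e 2) = \<phi> (?e 1) (?e 2) (?e 3)" using a(1)[of "?e 3" "?e 1" "?e 2"] 2 by simp
    show "\<phi> (?e 3) (?e 2) (?e 1) = - \<phi> (?e 1) (?e 2) (?e 3)" using a(1)[of "?e 3" "?e 2" "?e 1"] 3 by simp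
  qed
  have e1: "\<phi> u v w = u $ 1 * \<phi> (?e 1) v w + u $ 2 * \<phi> (?e 2) v w + u $ 3 * \<phi> (?e 3) v w" for u v w
    using linear_axis_expansion[OF l(1)[of v w], of u] by (simp add: sum_3)
  have e2: "\<phi> u v w = v $ 1 * \<phi> u (?e 1) w + v $ 2 * \<phi> u (?e 2) w + v $ 3 * \<phi> u (?e 3) w" for u v w
    using linear_axis_expansion[OF l(2)[of u w], of v] by (simp add: sum_3)
  have e3: "\<phi> u v w = w $ 1 * \<phi> u v (?e 1) + w $ 2 * \<phi> u v (?e 2) + w $ 3 * \<phi> u v (?e 3)" for u v w
    using linear_axis_expansion[OF l(3)[of u v], of w] by (simp add: sum_3)
  have "\<phi> u v w = u $ 1 * \<phi> (?e 1) v w + u $ 2 * \<phi> (?e 2) v w + u $ 3 * \<phi> (?e 3) v w" by (rule e1)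
  moreover have "\<phi> (?e i) v w = v $ 1 * \<phi> (?e i) (?e 1) w + v $ 2 * \<phi> (?e i) (?e 2) w + v $ 3 * \<phi> (?e i) (?e 3) w" for i
    by (rule e2)
  moreover have "\<phi> (?e i) (?e j) w = w $ 1 * \<phi> (?e i) (?e j) (?e 1) + w $ 2 * \<phi> (?e i) (?e j) (?e 2) + w $ 3 * \<phi> (?e i) (?e j) (?e 3)" for i j
    by (rule e3)
  ultimately show ?thesis
    by (simp only: z b) (simp add: cross3_def inner_vec_def sum_3 algebra_simps)
qed

lemma cross_dot_nonzero:
  fixes u :: "real^3"
  assumes "u \<noteq> 0"
  obtains v w where "cross3 v w \<bullet> u \<noteq> 0"
proof (rule ccontr)
  assume "\<not> thesis"
  then have *: "cross3 v w \<bullet> u = 0" for v w using that by blast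
  have "u $ 1 = 0" "u $ 2 = 0" "u $ 3 = 0"
    using *[of "axis 2 1" "axis 3 1"] *[of "axis 3 1" "axis 1 1"] *[of "axis 1 1" "axis 2 1"]
    by (simp_all add: cross_basis inner_axis')
  then show False using assms by (simp add: vec_eq_iff forall_3)
qed

text \<open>The linear algebra at one point: the Gram matrix \<open>A\<close> of \<gamma> and a map
  \<open>T\<close> whose lowering by \<open>A\<close> is a 3-form. It is applied to the torsion and
  also to its covariant derivative in a fixed direction.\<close>

locale metric_torsion =
  fixes A :: "real^3^3" and T :: "real^3 \<Rightarrow> real^3 \<Rightarrow> real^3"
  assumes sym: "\<And>v w. v \<bullet> (A *v w) = w \<bullet> (A *v v)"
    and pos: "\<And>v. v \<noteq> 0 \<Longrightarrow> v \<bullet> (A *v v) > 0"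
    and T_lin: "\<And>v. linear (\<lambda>u. T u v)" "\<And>u. linear (T u)"
    and T_skew: "\<And>u v. T v u = - T u v"
    and T_alt: "\<And>u v w. T u w \<bullet> (A *v v) = - (T u v \<bullet> (A *v w))"
begin

definition \<tau> :: real where "\<tau> = T (axis 1 1) (axis 2 1) \<bullet> (A *v axis 3 1)"

lemma inner_eqI: "(\<And>w. v \<bullet> (A *v w) = u \<bullet> (A *v w)) \<Longrightarrow> v = u"
  using pos[of "v - u"] by (force simp: inner_diff_left)

lemma detA: "det A > 0"
  using det_pos_def pos by blast

lemma transpose_A: "transpose A = A"
proof -
  have "v \<bullet> (transpose A *v w) = v \<bullet> (A *v w)" for v w
    using sym[of v w] by (metis dot_lmul_matrix inner_commute vector_transpose_matrix)
  then have "transpose A *v w = A *v w" for w by (metis vector_eq_rdot inner_commute)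
  then show ?thesis by (metis matrix_eq)
qed

lemma torsion_form: "T u v \<bullet> (A *v w) = \<tau> * (cross3 u v \<bullet> w)"
  unfolding \<tau>_def
proof (rule alternating3[of "\<lambda>u v w. T u v \<bullet> (A *v w)"])
  show "linear (\<lambda>u. T u v \<bullet> (A *v w))" for v w
    by (rule linearI) (simp_all add: linear_add[OF T_lin(1)] linear_cmul[OF T_lin(1)] inner_add_left)
  show "linear (\<lambda>v. T u v \<bullet> (A *v w))" for u w
    by (rule linearI) (simp_all add: linear_add[OF T_lin(2)] linear_cmul[OF T_lin(2)] inner_add_left)
  show "linear (\<lambda>w. T u v \<bullet> (A *v w))" for u v
    by (rule linearI) (simp_all add: matrix_vector_right_distrib matrix_vector_mult_scaleR inner_add_right)
  show "T v u \<bullet> (A *v w) = - (T u v \<bullet> (A *v w))" for u v w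
    unfolding T_skew[of v u] by simp
qed (rule T_alt)

lemma A_torsion: "A *v T u v = \<tau> *\<^sub>R cross3 u v"
proof -
  have "w \<bullet> (A *v T u v) = w \<bullet> (\<tau> *\<^sub>R cross3 u v)" for w
    using torsion_form[of u v w] sym[of w "T u v"] by (simp add: inner_commute)
  then show ?thesis by (metis vector_eq_rdot inner_commute)
qed

text \<open>The cofactor identity for the symmetric matrix \<open>A\<close>: it maps the cross
  product of \<open>A *v u\<close> and \<open>A *v v\<close> to \<open>det A\<close> times that of
  \<open>u\<close> and \<open>v\<close>.\<close>

lemma torsion_cross: "det A *\<^sub>R T u v = \<tau> *\<^sub>R cross3 (A *v u) (A *v v)"
proof (rule inner_eqI)
  fix w
  have "A *v cross3 (A *v u) (A *v v) = det A *\<^sub>R cross3 u v"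
    using cross_matrix_mult[of A u v] by (simp add: transpose_A)
  then have "w \<bullet> (A *v cross3 (A *v u) (A *v v)) = det A * (cross3 u v \<bullet> w)"
    by (simp add: inner_commute)
  then show "(det A *\<^sub>R T u v) \<bullet> (A *v w) = (\<tau> *\<^sub>R cross3 (A *v u) (A *v v)) \<bullet> (A *v w)"
    using torsion_form[of u v w] sym[of w "cross3 (A *v u) (A *v v)"] by simp
qed

text \<open>The volume form of \<gamma> is the determinant times \<open>sqrt (det A)\<close>, so
  this is the square of the coefficient of the torsion 3-form relative to it and does not depend on
  coordinates.\<close>

definition \<kappa> :: real where "\<kappa> = \<tau>\<^sup>2 / det A"

text \<open>\<open>torsion_cross\<close> for the first factor and \<open>A_torsion\<close> for the
  second produce an inner product of two cross products, which \<open>dot_cross\<close>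
  evaluates.\<close>

lemma torsion_inner:
  "T a b \<bullet> (A *v T c d) = \<kappa> * ((a \<bullet> (A *v c)) * (b \<bullet> (A *v d)) - (a \<bullet> (A *v d)) * (b \<bullet> (A *v c)))"
proof -
  have "det A * (T a b \<bullet> (A *v T c d)) = (\<tau> *\<^sub>R cross3 (A *v a) (A *v b)) \<bullet> (\<tau> *\<^sub>R cross3 c d)"
    unfolding torsion_cross[symmetric] A_torsion by simp
  also have "\<dots> = \<tau>\<^sup>2 * (((A *v a) \<bullet> c) * ((A *v b) \<bullet> d) - ((A *v a) \<bullet> d) * ((A *v b) \<bullet> c))"
    by (simp add: dot_cross power2_eq_square)
  also have "\<dots> = \<tau>\<^sup>2 * ((a \<bullet> (A *v c)) * (b \<bullet> (A *v d)) - (a \<bullet> (A *v d)) * (b \<bullet> (A *v c)))"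
    using sym by (simp add: inner_commute)
  finally show ?thesis using detA by (simp add: \<kappa>_def field_simps)
qed

lemma torsion_onto:
  assumes \<tau>: "\<tau> \<noteq> 0" and y: "y \<noteq> 0" and z: "z \<bullet> (A *v y) = 0"
  obtains h where "T h y = z"
proof -
  let ?b = "A *v y"
  have b: "?b \<noteq> 0" using pos[OF y] by auto
  have "\<exists>h. A *v h = x" for x
    using detA by (metis invertible_det_nz invertible_right_inverse matrix_vector_mul_assoc matrix_vector_mul_lid less_irrefl)
  \<comment> \<open>With \<open>?b = A *v y\<close> the vector \<open>z\<close> is Euclidean
    orthogonal to \<open>?b\<close>, and the double product of \<open>?b\<close>, \<open>z\<close>
    and \<open>?b\<close> returns \<open>z\<close> times \<open>?b \<bullet> ?b\<close>. The scalar
    compensates for this and for the factors of \<open>torsion_cross\<close>.\<close>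
  then obtain h where h: "A *v h = (det A / (\<tau> * (?b \<bullet> ?b))) *\<^sub>R cross3 ?b z" by blast
  have "cross3 (cross3 ?b z) ?b = (?b \<bullet> ?b) *\<^sub>R z"
    using Lagrange[of ?b ?b z] z cross_skew[of "cross3 ?b z" ?b] by (simp add: inner_commute)
  then have "det A *\<^sub>R T h y = det A *\<^sub>R z"
    unfolding torsion_cross h using b \<tau> by (simp add: cross_mult_left)
  then show ?thesis using detA that by simp
qed

lemma torsion_zero: "\<tau> = 0 \<Longrightarrow> T u v = 0"
  using torsion_cross[of u v] detA by simp

lemma area_pos:
  assumes "\<And>a b. a *\<^sub>R u + b *\<^sub>R v = 0 \<Longrightarrow> a = 0 \<and> b = 0"
  shows "(u \<bullet> (A *v u)) * (v \<bullet> (A *v v)) - (u \<bullet> (A *v v))\<^sup>2 > 0"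
proof -
  let ?g = "\<lambda>u v. u \<bullet> (A *v v)"
  have v: "v \<noteq> 0" using assms[of 0 1] by auto
  \<comment> \<open>A multiple of the component of \<open>u\<close> orthogonal to \<open>v\<close>;
    its squared length is the Gram determinant times \<open>?g v v\<close>.\<close>
  define x where "x = ?g v v *\<^sub>R u - ?g u v *\<^sub>R v"
  have "x \<noteq> 0" using assms[of "?g v v" "- ?g u v"] pos[OF v] by (auto simp: x_def)
  then have "0 < ?g x x" by (rule pos)
  also have "?g x x = ?g v v * (?g u u * ?g v v - (?g u v)\<^sup>2)"
    using sym[of v u] unfolding x_def
    by (simp add: matrix_vector_mult_diff_distrib matrix_vector_mult_scaleR inner_diff_left inner_diff_right algebra_simps power2_eq_square)
  finally show ?thesis using pos[OF v] by (simp add: zero_less_mult_iff)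
qed

end

section \<open>The Bianchi identity of a flat connection\<close>

text \<open>Pure algebra at one point, with \<open>d\<Gamma>\<close> standing for the derivative of
  the Christoffel map and flatness as the only relation between the two. The first claim is the
  cyclic sum of three such relations. The second computes the curvature of the symmetrised symbols,
  which are those of the Levi-Civita connection.\<close>

lemma flat_identities:
  fixes \<Gamma> :: "real^'n \<Rightarrow> real^'n \<Rightarrow> real^'n" and d\<Gamma> :: "real^'n \<Rightarrow> real^'n \<Rightarrow> real^'n \<Rightarrow> real^'n"
  assumes l: "\<And>v. linear (\<lambda>u. \<Gamma> u v)" "\<And>u. linear (\<Gamma> u)"
    and flat: "\<And>u v w. d\<Gamma> u v w - d\<Gamma> v u w + \<Gamma> u (\<Gamma> v w) - \<Gamma> v (\<Gamma> u w) = 0"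
  defines "T \<equiv> \<lambda>u v. \<Gamma> u v - \<Gamma> v u"
  defines "DT \<equiv> \<lambda>h u v. d\<Gamma> h u v - d\<Gamma> h v u + \<Gamma> h (T u v) - T (\<Gamma> h u) v - T u (\<Gamma> h v)"
  defines "\<Gamma>' \<equiv> \<lambda>u v. (1/2) *\<^sub>R (\<Gamma> u v + \<Gamma> v u)"
  defines "d\<Gamma>' \<equiv> \<lambda>h u v. (1/2) *\<^sub>R (d\<Gamma> h u v + d\<Gamma> h v u)"
  shows "DT u v w + DT v w u + DT w u v + T (T u v) w + T (T v w) u + T (T w u) v = 0"
    and "d\<Gamma>' u v v - d\<Gamma>' v u v + \<Gamma>' u (\<Gamma>' v v) - \<Gamma>' v (\<Gamma>' u v) = (1/2) *\<^sub>R DT v u v - (1/4) *\<^sub>R T (T u v) v"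
proof -
  note lin = linear_add[OF l(1)] linear_add[OF l(2)] linear_diff[OF l(1)] linear_diff[OF l(2)] linear_cmul[OF l(1)] linear_cmul[OF l(2)]
  have f: "d\<Gamma> u v w $ i - d\<Gamma> v u w $ i + \<Gamma> u (\<Gamma> v w) $ i - \<Gamma> v (\<Gamma> u w) $ i = 0" for u v w i
    using flat[of u v w] by (simp add: vec_eq_iff)
  show "DT u v w + DT v w u + DT w u v + T (T u v) w + T (T v w) u + T (T w u) v = 0"
    unfolding vec_eq_iff
  proof
    fix i
    show "(DT u v w + DT v w u + DT w u v + T (T u v) w + T (T v w) u + T (T w u) v) $ i = 0 $ i"
      using f[of u v w i] f[of v w u i] f[of w u v i] by (simp add: DT_def T_def lin)
  qed
  show "d\<Gamma>' u v v - d\<Gamma>' v u v + \<Gamma>' u (\<Gamma>' v v) - \<Gamma>' v (\<Gamma>' u v) = (1/2) *\<^sub>R DT v u v - (1/4) *\<^sub>R T (T u v) v"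
    unfolding vec_eq_iff
  proof
    fix i
    show "(d\<Gamma>' u v v - d\<Gamma>' v u v + \<Gamma>' u (\<Gamma>' v v) - \<Gamma>' v (\<Gamma>' u v)) $ i = ((1/2) *\<^sub>R DT v u v - (1/4) *\<^sub>R T (T u v) v) $ i"
      using f[of u v v i] by (simp add: DT_def T_def \<Gamma>'_def d\<Gamma>'_def lin algebra_simps)
  qed
qed

text \<open>Each \<open>DT h\<close> lowers to a 3-form, that is, to \<open>\<alpha> h\<close> times
  the determinant. Pairing the identity with \<open>u\<close> kills the terms in which
  \<open>u\<close> occurs twice, and the two other quadratic terms are opposite. What is left is
  \<open>\<alpha> u\<close> times the determinant of \<open>v\<close>, \<open>w\<close>,
  \<open>u\<close>, which can be made nonzero once \<open>u\<close> is.\<close>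

lemma (in metric_torsion) parallel_torsion:
  assumes l: "\<And>h v. linear (\<lambda>u. DT h u v)" "\<And>h u. linear (DT h u)"
    and skew: "\<And>h u v. DT h v u = - DT h u v"
    and alt: "\<And>h u v w. DT h u w \<bullet> (A *v v) = - (DT h u v \<bullet> (A *v w))"
    and bianchi: "\<And>u v w. DT u v w + DT v w u + DT w u v + T (T u v) w + T (T v w) u + T (T w u) v = 0"
    and h: "h \<noteq> 0"
  shows "DT h u v = 0"
proof -
  define \<alpha> where "\<alpha> h = DT h (axis 1 1) (axis 2 1) \<bullet> (A *v axis 3 1)" for h
  have DT_form: "DT h u v \<bullet> (A *v w) = \<alpha> h * (cross3 u v \<bullet> w)" for h u v w
  proof -
    interpret D: metric_torsion A "DT h"
      by (rule metric_torsion.intro[OF sym pos l(1) l(2) skew alt])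
    show ?thesis using D.torsion_form[of u v w] unfolding \<alpha>_def D.\<tau>_def .
  qed
  have "\<alpha> u * (cross3 v w \<bullet> u) = 0" for u v w
  proof -
    have cyc: "T a b \<bullet> (A *v c) = T b c \<bullet> (A *v a)" for a b c
      using cross_triple[of a b c] by (simp add: torsion_form)
    have "0 = (DT u v w + DT v w u + DT w u v + T (T u v) w + T (T v w) u + T (T w u) v) \<bullet> (A *v u)"
      by (simp add: bianchi)
    also have "\<dots> = \<alpha> u * (cross3 v w \<bullet> u) + (T (T u v) w \<bullet> (A *v u) + T (T w u) v \<bullet> (A *v u))"
      by (simp add: inner_add_left DT_form torsion_form[of _ u] dot_cross_self)
    also have "T (T u v) w \<bullet> (A *v u) = T w u \<bullet> (A *v T u v)" by (rule cyc)
    also have "T (T w u) v \<bullet> (A *v u) = T v u \<bullet> (A *v T w u)" by (rule cyc)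
    also have "\<dots> = - (T w u \<bullet> (A *v T u v))" using sym[of "T u v" "T w u"] by (simp add: T_skew[of u v])
    finally show ?thesis by simp
  qed
  moreover obtain v w where "cross3 v w \<bullet> h \<noteq> 0" using cross_dot_nonzero[OF h] .
  ultimately have "\<alpha> h = 0" by (metis mult_eq_0_iff)
  then show ?thesis by (intro inner_eqI) (simp add: DT_form)
qed

subsection \<open>The averaged metric in coordinates\<close>

lemma matrix_apply: "linear f \<Longrightarrow> matrix f *v x = f x" for f :: "real^'n \<Rightarrow> real^'m"
  by (simp add: matrix_works linear_matrix_vector_mul_eq)

locale finsler_mfd = smooth_mfd M for M :: "('a, 3) manifold" +
  fixes F :: "'a \<Rightarrow> ('a, 3) tvec \<Rightarrow> real"
  assumes fin: "finsler_metric M F"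
begin

definition Fc :: "('a, 3) chart \<Rightarrow> real^3 \<Rightarrow> real^3 \<Rightarrow> real" where
  "Fc c x y = F (cinv c x) (tvec_of M c (cinv c x) y)"

definition G :: "('a, 3) chart \<Rightarrow> real^3 \<Rightarrow> real^3^3" where
  "G c x = Gmat (Fc c x)"

lemma chart_at_cinv: "c \<in> atlas M \<Longrightarrow> x \<in> cim c \<Longrightarrow> c \<in> charts_at M (cinv c x)"
  by (simp add: chartsI)

lemma minkowski_Fc:
  assumes c: "c \<in> atlas M" and x: "x \<in> cim c"
  shows "minkowski_norm (Fc c x)"
proof -
  let ?p = "cinv c x"
  note p = chart_at_cinv[OF c x]
  have pt: "?p \<in> topspace (mtop M)" using charts_at_topspace[OF p] .
  have hom: "F ?p v \<ge> 0 \<and> (\<forall>t>0. F ?p (tscale t v) = t * F ?p v)" if "v \<in> tangent_space M ?p" for v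
    using fin pt that unfolding finsler_metric_def by blast
  have sm: "smooth_on (cim c \<times> (UNIV - {0})) (\<lambda>(x, y). F (cinv c x) (tvec_of M c (cinv c x) y))"
    and pd: "\<forall>p\<in>cdom c. \<forall>y. y \<noteq> 0 \<longrightarrow> (\<forall>w. w \<noteq> 0 \<longrightarrow> w \<bullet> (fund_tensor M F c p y *v w) > 0)"
    using fin c unfolding finsler_metric_def cim_def by blast+
  show ?thesis
  proof
    have "smooth_on (UNIV - {0}) (\<lambda>y::real^3. (x, 0::real^3) + (0, y))"
      by (intro smooth_on_add open_punctured smooth_on_const
          smooth_on_linear[OF open_punctured bounded_linear_Pair[OF bounded_linear_zero bounded_linear_ident] smooth_on_ident])
    then have s: "smooth_on (UNIV - {0}) (\<lambda>y::real^3. (x, y))" by simp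
    have "smooth_on (UNIV - {0}) (\<lambda>y. (\<lambda>(x, y). F (cinv c x) (tvec_of M c (cinv c x) y)) (x, y))"
      by (rule smooth_on_compose[OF open_punctured open_Times[OF open_cim[OF c] open_punctured] _ s sm]) (use x in auto)
    then show "smooth_on (UNIV - {0}) (Fc c x)" by (simp add: Fc_def[abs_def])
    show "Fc c x (t *\<^sub>R y) = t * Fc c x y" if "t > 0" for t y
      using hom[OF tvec_of_tangent[OF p, of y]] that by (simp add: Fc_def tvec_of_linear(2)[OF p])
    show "0 \<le> Fc c x y" for y using hom[OF tvec_of_tangent[OF p, of y]] by (simp add: Fc_def)
    show "0 < w \<bullet> (hes (Fc c x) y *v w)" if "y \<noteq> 0" "w \<noteq> 0" for y w
    proof -
      have "fund_tensor M F c ?p y = hes (Fc c x) y"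
        by (simp add: fund_tensor_def hes_def energy_def Fc_def)
      then show ?thesis using pd cinv_cdom[OF x] that by metis
    qed
  qed
qed

lemma G_sym: "c \<in> atlas M \<Longrightarrow> x \<in> cim c \<Longrightarrow> v \<bullet> (G c x *v w) = w \<bullet> (G c x *v v)"
  unfolding G_def by (rule Gmat_sym[OF minkowski_Fc])

lemma G_pos: "c \<in> atlas M \<Longrightarrow> x \<in> cim c \<Longrightarrow> v \<noteq> 0 \<Longrightarrow> v \<bullet> (G c x *v v) > 0"
  unfolding G_def by (rule Gmat_pos[OF minkowski_Fc])

lemma Fc_cmap: "c \<in> charts_at M p \<Longrightarrow> Fc c (cmap c p) y = F p (tvec_of M c p y)"
  using chartsD[of c p] by (simp add: Fc_def)

text \<open>The Jacobian carries the norm in one chart to the norm in the other, so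
  \<open>Gmat_covariant\<close> applies to it.\<close>

lemma G_transform:
  assumes c: "c \<in> charts_at M p" and d: "d \<in> charts_at M p"
  shows "u \<bullet> (G c (cmap c p) *v v) = jac c d p u \<bullet> (G d (cmap d p) *v jac c d p v)"
proof -
  note C = chartsD[OF c] and E = chartsD[OF d]
  have m: "matrix (jac c d p) *v z = jac c d p z" for z by (rule matrix_apply[OF linear_jac[OF c d]])
  have "Fc d (cmap d p) (matrix (jac c d p) *v z) = Fc c (cmap c p) z" for z
    by (simp add: m Fc_cmap c d tvec_of_jac)
  from Gmat_covariant[OF minkowski_Fc[OF C(1) cmap_cim[OF C(2)]] minkowski_Fc[OF E(1) cmap_cim[OF E(2)]] this]
  show ?thesis by (simp add: G_def m)
qed

lemma averaged_chart:
  assumes v: "v \<in> tangent_space M p" and w: "w \<in> tangent_space M p" and c: "c \<in> charts_at M p"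
  shows "averaged_metric M F p v w = v c \<bullet> (G c (cmap c p) *v w c)"
proof -
  have d: "chart_at M p \<in> charts_at M p" using chart_at charts_at_topspace[OF c] by blast
  note E = chartsD[OF d]
  have f: "Fc (chart_at M p) (cmap (chart_at M p) p) = (\<lambda>z. F p (tvec_of M (chart_at M p) p z))"
    by (rule ext) (rule Fc_cmap[OF d])
  have "minkowski_norm (\<lambda>z. F p (tvec_of M (chart_at M p) p z))"
    using minkowski_Fc[OF E(1) cmap_cim[OF E(2)]] by (simp add: f)
  from averaged_metric_Gmat[where F = F and p = p and M = M, OF this]
  have "averaged_metric M F p v w = v (chart_at M p) \<bullet> (G (chart_at M p) (cmap (chart_at M p) p) *v w (chart_at M p))"
    by (simp add: G_def f)
  then show ?thesis
    using G_transform[OF d c] tangent_jac[OF v d c] tangent_jac[OF w d c] by simp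
qed

lemma linear_G: "linear (\<lambda>u. u \<bullet> (A *v v))" "linear (\<lambda>v. u \<bullet> (A *v v))" for A :: "real^3^3"
  by (rule linearI; simp add: inner_add_left inner_add_right matrix_vector_right_distrib matrix_vector_mult_scaleR)+

text \<open>The condition that \<gamma> is parallel, in coordinates and including differentiability
  of \<open>G\<close>. It takes the Christoffel maps as argument so that it can be asked of
  \<open>D\<close> and of \<open>lc\<close>.\<close>

definition metric_gam :: "(('a, 3) chart \<Rightarrow> real^3 \<Rightarrow> real^3 \<Rightarrow> real^3 \<Rightarrow> real^3) \<Rightarrow> bool" where
  "metric_gam \<Gamma> \<longleftrightarrow> (\<forall>c\<in>atlas M. \<forall>x\<in>cim c. \<forall>u v. ((\<lambda>x. u \<bullet> (G c x *v v)) has_derivative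
     (\<lambda>h. \<Gamma> c x h u \<bullet> (G c x *v v) + u \<bullet> (G c x *v \<Gamma> c x h v))) (at x))"

end

locale finsler_conn = finsler_mfd M F + lin_conn M D
  for M :: "('a, 3) manifold" and F and D

locale compat_conn = finsler_conn M F D for M :: "('a, 3) manifold" and F and D +
  assumes comp: "compatible M F D"
begin

text \<open>The derivative of the norm in the base direction is a fibre derivative along
  \<open>\<Gamma> c x h y\<close>. The left side does not involve the connection, so any two
  compatible connections have the same right side.\<close>

lemma Fc_horizontal:
  assumes c: "c \<in> atlas M" and x: "x \<in> cim c" and y: "y \<noteq> 0"
  shows "((\<lambda>h. Fc c (x + h) y) has_derivative (\<lambda>h. fd (Fc c x) y (\<Gamma> c x h y))) (at 0)"
proof -
  obtain Z r where Z: "r > 0" "\<And>y. ((\<lambda>h. Z h y) has_derivative (\<lambda>h. \<Gamma> c x h y)) (at 0)" "\<And>h. linear (Z h)" "\<And>y. Z 0 y = y"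
    "\<And>h. norm h < r \<Longrightarrow> x + h \<in> cim c"
    "\<And>h y. norm h < r \<Longrightarrow> F (cinv c x) (tvec_of M c (cinv c x) (Z h y)) = F (cinv c (x + h)) (tvec_of M c (cinv c (x + h)) y)"
    using transport[OF comp c x] by blast
  interpret minkowski_norm "Fc c x" by (rule minkowski_Fc[OF c x])
  have "(Fc c x has_derivative fd (Fc c x) y) (at (Z 0 y))"
    using y by (simp add: Z(4) has_derivative_fd[OF smooth_on_differentiable[OF smooth]])
  from has_derivative_compose[OF Z(2) this]
  have "((\<lambda>h. Fc c x (Z h y)) has_derivative (\<lambda>h. fd (Fc c x) y (\<Gamma> c x h y))) (at 0)" .
  moreover have "Fc c x (Z h y) = Fc c (x + h) y" if "h \<in> ball 0 r" for h
    using Z(6)[of h y] that by (simp add: Fc_def)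
  ultimately show ?thesis
    using has_derivative_cong_open[of "ball 0 r" 0 "\<lambda>h. Fc c x (Z h y)" "\<lambda>h. Fc c (x + h) y"] Z(1) by simp
qed

lemma metric_gam_compat: "metric_gam \<Gamma>"
  unfolding metric_gam_def
proof (intro ballI allI)
  fix c x u v assume c: "c \<in> atlas M" and x: "x \<in> cim c"
  obtain Z r where Z: "r > 0" "\<And>y. ((\<lambda>h. Z h y) has_derivative (\<lambda>h. \<Gamma> c x h y)) (at 0)" "\<And>h. linear (Z h)" "\<And>y. Z 0 y = y"
    "\<And>h. norm h < r \<Longrightarrow> x + h \<in> cim c"
    "\<And>h y. norm h < r \<Longrightarrow> F (cinv c x) (tvec_of M c (cinv c x) (Z h y)) = F (cinv c (x + h)) (tvec_of M c (cinv c (x + h)) y)"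
    using transport[OF comp c x] by blast
  have eq: "u \<bullet> (G c (x + h) *v v) = Z h u \<bullet> (G c x *v Z h v)" if "h \<in> ball 0 r" for h
  proof -
    have h: "norm h < r" using that by simp
    have m: "matrix (Z h) *v z = Z h z" for z by (rule matrix_apply[OF Z(3)])
    have "Fc c x (matrix (Z h) *v z) = Fc c (x + h) z" for z
      using Z(6)[OF h, of z] by (simp add: Fc_def m)
    from Gmat_covariant[OF minkowski_Fc[OF c Z(5)[OF h]] minkowski_Fc[OF c x] this]
    show ?thesis by (simp add: G_def m)
  qed
  have "((\<lambda>h. Z h u \<bullet> (G c x *v Z h v)) has_derivative
      (\<lambda>h. Z 0 u \<bullet> (G c x *v \<Gamma> c x h v) + \<Gamma> c x h u \<bullet> (G c x *v Z 0 v))) (at 0)"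
    by (intro has_derivative_inner bounded_linear.has_derivative[OF matrix_vector_mul_bounded_linear] Z(2))
  then have "((\<lambda>h. u \<bullet> (G c (x + h) *v v)) has_derivative
      (\<lambda>h. \<Gamma> c x h u \<bullet> (G c x *v v) + u \<bullet> (G c x *v \<Gamma> c x h v))) (at 0)"
    using has_derivative_cong_open[of "ball 0 r" 0 "\<lambda>h. u \<bullet> (G c (x + h) *v v)" "\<lambda>h. Z h u \<bullet> (G c x *v Z h v)", OF _ _ eq] Z(1) by (simp add: Z(4) add.commute)
  \<comment> \<open>Writing 0 as \<open>x - x\<close> prepares the chain rule with the shift by
    \<open>x\<close>.\<close>
  then have d1: "((\<lambda>h. u \<bullet> (G c (x + h) *v v)) has_derivative
      (\<lambda>h. \<Gamma> c x h u \<bullet> (G c x *v v) + u \<bullet> (G c x *v \<Gamma> c x h v))) (at (x - x))" by simp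
  have d2: "((\<lambda>z. z - x) has_derivative (\<lambda>h. h)) (at x)"
    by (auto intro!: derivative_eq_intros)
  have "((\<lambda>z. u \<bullet> (G c (x + (z - x)) *v v)) has_derivative
      (\<lambda>h. \<Gamma> c x h u \<bullet> (G c x *v v) + u \<bullet> (G c x *v \<Gamma> c x h v))) (at x)"
    by (rule has_derivative_compose[where f = "\<lambda>z. z - x" and g = "\<lambda>h. u \<bullet> (G c (x + h) *v v)", OF d2 d1])
  then show "((\<lambda>x. u \<bullet> (G c x *v v)) has_derivative (\<lambda>h. \<Gamma> c x h u \<bullet> (G c x *v v) + u \<bullet> (G c x *v \<Gamma> c x h v))) (at x)"
    by simp
qed

end

section \<open>Connections for which the averaged metric is parallel\<close>

text \<open>Kept apart from \<open>compat_conn\<close> because it is also applied to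
  \<open>lc\<close>, which makes \<gamma> parallel but need not preserve \<open>F\<close>.\<close>

locale metric_conn = finsler_conn M F D for M :: "('a, 3) manifold" and F and D +
  assumes metric: "metric_gam (gam M D)"
begin

lemma G_const_deriv:
  assumes "c \<in> atlas M" "x \<in> cim c"
  shows "((\<lambda>x. u \<bullet> (G c x *v v)) has_derivative
     (\<lambda>h. \<Gamma> c x h u \<bullet> (G c x *v v) + u \<bullet> (G c x *v \<Gamma> c x h v))) (at x)"
  using metric assms unfolding metric_gam_def by blast

lemma G_deriv:
  assumes c: "c \<in> atlas M" and x: "x \<in> cim c" and s: "s differentiable (at x)" and r: "r differentiable (at x)"
  shows "((\<lambda>z. s z \<bullet> (G c z *v r z)) has_derivative
     (\<lambda>h. (fd s x h + \<Gamma> c x h (s x)) \<bullet> (G c x *v r x) + s x \<bullet> (G c x *v (fd r x h + \<Gamma> c x h (r x))))) (at x)"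
proof -
  note o = open_cim[OF c]
  have 1: "((\<lambda>z. b \<bullet> (G c z *v r z)) has_derivative (\<lambda>h. fd (\<lambda>z. b \<bullet> (G c z *v r x)) x h + b \<bullet> (G c x *v fd r x h))) (at x)" for b
    by (rule has_derivative_apply_linear[where L = "\<lambda>z v. b \<bullet> (G c z *v v)", OF o x r linear_G(2) differentiableI[OF G_const_deriv[OF c x]]])
  have "((\<lambda>z. (\<lambda>z u. u \<bullet> (G c z *v r z)) z (s z)) has_derivative
     (\<lambda>h. fd (\<lambda>z. (\<lambda>z u. u \<bullet> (G c z *v r z)) z (s x)) x h + (\<lambda>z u. u \<bullet> (G c z *v r z)) x (fd s x h))) (at x)"
    by (rule has_derivative_apply_linear[OF o x s linear_G(1) differentiableI[OF 1]])
  then show ?thesis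
    unfolding fd_apply[OF 1] fd_apply[OF G_const_deriv[OF c x]]
    by (simp add: inner_add_left inner_add_right matrix_vector_right_distrib algebra_simps)
qed

text \<open>Bootstrapping: the derivative of an entry of \<open>G\<close> is a combination of
  entries of \<open>G\<close> with Christoffel symbols as coefficients. The induction therefore
  treats all \<open>u\<close> and \<open>v\<close> together.\<close>

lemma smooth_G:
  assumes c: "c \<in> atlas M"
  shows "smooth_on (cim c) (\<lambda>x. u \<bullet> (G c x *v v))"
proof (rule smooth_onI)
  note o = open_cim[OF c]
  show "Ck_on k (cim c) (\<lambda>x. u \<bullet> (G c x *v v))" for k
  proof (induction k arbitrary: u v)
    case 0
    have "isCont (\<lambda>x. u \<bullet> (G c x *v v)) x" if "x \<in> cim c" for x
      using has_derivative_continuous[OF G_const_deriv[OF c that]] .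
    then show ?case by (simp add: continuous_at_imp_continuous_on)
  next
    case (Suc k)
    have d: "fd (\<lambda>x. u \<bullet> (G c x *v v)) x h =
      (\<Sum>b\<in>Basis. (\<Gamma> c x h u \<bullet> b) * (b \<bullet> (G c x *v v))) + (\<Sum>b\<in>Basis. (\<Gamma> c x h v \<bullet> b) * (u \<bullet> (G c x *v b)))"
      if "x \<in> cim c" for x h
    proof -
      have "\<Gamma> c x h u \<bullet> (G c x *v v) = (\<Sum>b\<in>Basis. (\<Gamma> c x h u \<bullet> b) * (b \<bullet> (G c x *v v)))"
        using linear_euclidean_expansion[OF linear_G(1), of "\<Gamma> c x h u"] by simp
      moreover have "u \<bullet> (G c x *v \<Gamma> c x h v) = (\<Sum>b\<in>Basis. (\<Gamma> c x h v \<bullet> b) * (u \<bullet> (G c x *v b)))"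
        using linear_euclidean_expansion[OF linear_G(2)[where u = u and A = "G c x"], of "\<Gamma> c x h v"] by simp
      ultimately show ?thesis unfolding fd_apply[OF G_const_deriv[OF c that]] by simp
    qed
    have gi: "Ck_on k (cim c) (\<lambda>x. \<Gamma> c x h w \<bullet> b)" for h w b
      by (rule Ck_on_linear[OF o bounded_linear_inner_left smooth_onD[OF smooth_gam[OF c]]])
    have "Ck_on k (cim c) (\<lambda>x. (\<Sum>b\<in>Basis. (\<Gamma> c x h u \<bullet> b) * (b \<bullet> (G c x *v v))) + (\<Sum>b\<in>Basis. (\<Gamma> c x h v \<bullet> b) * (u \<bullet> (G c x *v b))))" for h
      by (intro Ck_on_add o Ck_on_sum Ck_on_bilinear[OF o bounded_bilinear_mult] gi Suc.IH)
    then have "Ck_on k (cim c) (\<lambda>x. fd (\<lambda>x. u \<bullet> (G c x *v v)) x h)" for h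
      using Ck_on_cong[OF o, where f = "\<lambda>x. fd (\<lambda>x. u \<bullet> (G c x *v v)) x h", OF d] by (simp only:)
    then show ?case using differentiableI[OF G_const_deriv[OF c]] by auto
  qed
qed

lemma smooth_G_fields:
  assumes c: "c \<in> atlas M" and S: "open S" "S \<subseteq> cim c" and X: "smooth_on S X" and Y: "smooth_on S Y"
  shows "smooth_on S (\<lambda>x. X x \<bullet> (G c x *v Y x))"
proof -
  have "smooth_on S (\<lambda>x. (\<lambda>x u. u \<bullet> (G c x *v Y x)) x (X x))"
  proof (rule smooth_on_apply_linear[OF S(1) X _ linear_G(1)])
    fix b :: "real^3"
    show "smooth_on S (\<lambda>x. b \<bullet> (G c x *v Y x))"
      by (rule smooth_on_apply_linear[where L = "\<lambda>x v. b \<bullet> (G c x *v v)", OF S(1) Y _ linear_G(2)])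
        (rule smooth_on_subset[OF smooth_G[OF c] S(2)])
  qed
  then show ?thesis by simp
qed

lemma averaged_fields:
  assumes "smooth_field M W X" "smooth_field M W Y" "c \<in> atlas M" "x \<in> cim c" "cinv c x \<in> W"
  shows "averaged_metric M F (cinv c x) (X (cinv c x)) (Y (cinv c x)) = X (cinv c x) c \<bullet> (G c x *v Y (cinv c x) c)"
  using averaged_chart[OF smooth_field_tangent[OF assms(1,5)] smooth_field_tangent[OF assms(2,5)] chart_at_cinv[OF assms(3,4)]] assms(4)
  by simp

lemma smooth_averaged:
  assumes W: "openin (mtop M) W" and X: "smooth_field M W X" and Y: "smooth_field M W Y"
  shows "smooth_fun M W (\<lambda>p. averaged_metric M F p (X p) (Y p))"
  unfolding smooth_fun_def
proof
  fix c assume c: "c \<in> atlas M"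
  let ?S = "cmap c ` (W \<inter> cdom c)"
  have S: "open ?S" "?S \<subseteq> cim c" using open_image[OF c W] by auto
  have "smooth_on ?S (\<lambda>x. X (cinv c x) c \<bullet> (G c x *v Y (cinv c x) c))"
    by (intro smooth_G_fields c S smooth_field_chart X Y)
  moreover have "((\<lambda>p. averaged_metric M F p (X p) (Y p)) \<circ> cinv c) x = X (cinv c x) c \<bullet> (G c x *v Y (cinv c x) c)" if "x \<in> ?S" for x
    using averaged_fields[OF X Y c] that image_iff_cinv[OF c] by (simp add: comp_def)
  ultimately show "smooth_on ?S ((\<lambda>p. averaged_metric M F p (X p) (Y p)) \<circ> cinv c)"
    using smooth_on_cong[OF S(1), where f = "(\<lambda>p. averaged_metric M F p (X p) (Y p)) \<circ> cinv c" and g = "\<lambda>x. X (cinv c x) c \<bullet> (G c x *v Y (cinv c x) c)"]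
    by blast
qed

lemma riemannian_averaged: "riemannian_metric M (averaged_metric M F)"
  unfolding riemannian_metric_def
proof (intro conjI ballI allI impI)
  fix p assume p: "p \<in> topspace (mtop M)"
  note c = chart_at[OF p] and C = chartsD[OF chart_at[OF p]]
  note a = averaged_chart[OF _ _ c]
  show "sym_bilinear_at M p (averaged_metric M F p)"
    unfolding sym_bilinear_at_def
  proof (intro ballI allI conjI)
    fix u v w b assume t: "u \<in> tangent_space M p" "v \<in> tangent_space M p" "w \<in> tangent_space M p"
    show "averaged_metric M F p u v = averaged_metric M F p v u"
      using t by (simp only: a) (rule G_sym[OF C(1) cmap_cim[OF C(2)]])
    show "averaged_metric M F p (tadd u v) w = averaged_metric M F p u w + averaged_metric M F p v w"
      using t by (simp add: a inner_add_left)
    show "averaged_metric M F p (tscale b u) v = b * averaged_metric M F p u v"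
      using t by (simp add: a)
  qed
  fix v assume v: "v \<in> tangent_space M p" "v \<noteq> tzero"
  have "v (chart_at M p) \<noteq> 0"
    using v tangent_eqI[OF v(1) tzero_tangent c] by auto
  then show "0 < averaged_metric M F p v v"
    unfolding a[OF v(1) v(1)] by (rule G_pos[OF C(1) cmap_cim[OF C(2)]])
qed (use smooth_averaged in blast)

lemma metric_derivative:
  assumes W: "openin (mtop M) W" and Y: "smooth_field M W Y" and Z: "smooth_field M W Z" and p: "p \<in> W"
    and v: "v \<in> tangent_space M p"
  shows "vec_deriv M p v (\<lambda>q. averaged_metric M F q (Y q) (Z q)) =
    averaged_metric M F p (D p v Y) (Z p) + averaged_metric M F p (Y p) (D p v Z)"
proof -
  have pt: "p \<in> topspace (mtop M)" using openin_subset[OF W] p by blast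
  define c where "c = chart_at M p"
  have c: "c \<in> charts_at M p" unfolding c_def by (rule chart_at[OF pt])
  note C = chartsD[OF c]
  let ?S = "cmap c ` (W \<inter> cdom c)" and ?x = "cmap c p"
  have S: "open ?S" "?x \<in> ?S" using open_image[OF C(1) W] p C by auto
  let ?Y = "\<lambda>x. Y (cinv c x) c" and ?Z = "\<lambda>x. Z (cinv c x) c"
  have dd: "?Y differentiable (at ?x)" "?Z differentiable (at ?x)"
    using smooth_on_differentiable[OF smooth_field_chart[OF _ C(1)] S(2)] Y Z by blast+
  have "vec_deriv M p v (\<lambda>q. averaged_metric M F q (Y q) (Z q)) = fd (\<lambda>x. averaged_metric M F (cinv c x) (Y (cinv c x)) (Z (cinv c x))) ?x (v c)"
    by (rule vec_deriv_chart[OF W smooth_averaged[OF W Y Z] p v c])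
  also have "\<dots> = fd (\<lambda>x. ?Y x \<bullet> (G c x *v ?Z x)) ?x (v c)"
  proof (rule fun_cong[OF fd_cong_open[OF S]])
    fix x assume "x \<in> ?S"
    then show "averaged_metric M F (cinv c x) (Y (cinv c x)) (Z (cinv c x)) = ?Y x \<bullet> (G c x *v ?Z x)"
      using averaged_fields[OF Y Z C(1)] image_iff_cinv[OF C(1)] by blast
  qed
  also have "\<dots> = (fd ?Y ?x (v c) + \<Gamma> c ?x (v c) (?Y ?x)) \<bullet> (G c ?x *v ?Z ?x) + ?Y ?x \<bullet> (G c ?x *v (fd ?Z ?x (v c) + \<Gamma> c ?x (v c) (?Z ?x)))"
    by (rule fd_apply[OF G_deriv[OF C(1) cmap_cim[OF C(2)] dd]])
  also have "\<dots> = D p v Y c \<bullet> (G c ?x *v Z p c) + Y p c \<bullet> (G c ?x *v D p v Z c)"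
    using D_chart[OF W Y p v c] D_chart[OF W Z p v c] C by simp
  finally show ?thesis
    using averaged_chart[OF D_tangent[OF W Y p v] smooth_field_tangent[OF Z p] c]
      averaged_chart[OF smooth_field_tangent[OF Y p] D_tangent[OF W Z p v] c] by simp
qed

lemma levi_civita_averaged: "torsion_free M D \<Longrightarrow> levi_civita M (averaged_metric M F) D"
  unfolding levi_civita_def using conn metric_derivative by blast

end

subsection \<open>The Levi-Civita connection of a metric connection with alternating torsion\<close>

context lin_conn
begin

definition lc :: "('a, 'n) connection" where
  "lc p v Y = tdiff (D p v Y) (tscale (1/2) (tort p v (Y p)))"

lemma linear_tor:
  assumes c: "c \<in> atlas M" and x: "x \<in> cim c"
  shows "linear (\<lambda>u. tor M D c x u v)" "linear (tor M D c x u)"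
proof -
  show "linear (\<lambda>u. tor M D c x u v)"
    unfolding tor_def by (intro linear_compose_sub linear_gam_left[OF c x] linear_gam_right)
  have "linear (\<lambda>v. \<Gamma> c x u v - \<Gamma> c x v u)"
    by (intro linear_compose_sub linear_gam_left[OF c x] linear_gam_right)
  then show "linear (tor M D c x u)" by (simp add: tor_def[abs_def])
qed

lemma tort_linear:
  assumes v: "v \<in> tangent_space M p" "w \<in> tangent_space M p" "u \<in> tangent_space M p" and p: "p \<in> topspace (mtop M)"
  shows "tort p (tadd v w) u = tadd (tort p v u) (tort p w u)" "tort p (tscale a v) u = tscale a (tort p v u)"
    "tort p u (tadd v w) = tadd (tort p u v) (tort p u w)" "tort p u (tscale a v) = tscale a (tort p u v)"
proof -
  note c = chart_at[OF p] and C = chartsD[OF chart_at[OF p]]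
  note l = linear_tor[OF C(1) cmap_cim[OF C(2)]]
  show "tort p (tadd v w) u = tadd (tort p v u) (tort p w u)"
    by (rule tangent_eqI[OF _ _ c]) (simp_all add: p tort_chart[OF _ _ c] v linear_add[OF l(1)])
  show "tort p (tscale a v) u = tscale a (tort p v u)"
    by (rule tangent_eqI[OF _ _ c]) (simp_all add: p tort_chart[OF _ _ c] v linear_cmul[OF l(1)])
  show "tort p u (tadd v w) = tadd (tort p u v) (tort p u w)"
    by (rule tangent_eqI[OF _ _ c]) (simp_all add: p tort_chart[OF _ _ c] v linear_add[OF l(2)])
  show "tort p u (tscale a v) = tscale a (tort p u v)"
    by (rule tangent_eqI[OF _ _ c]) (simp_all add: p tort_chart[OF _ _ c] v linear_cmul[OF l(2)])
qed

lemma smooth_tort: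
  assumes W: "openin (mtop M) W" and X: "smooth_field M W X" and Y: "smooth_field M W Y" and c: "c \<in> atlas M"
  shows "smooth_on (cmap c ` (W \<inter> cdom c)) (\<lambda>x. tort (cinv c x) (X (cinv c x)) (Y (cinv c x)) c)"
proof -
  let ?S = "cmap c ` (W \<inter> cdom c)"
  have S: "open ?S" "?S \<subseteq> cim c" using open_image[OF c W] by auto
  let ?X = "\<lambda>x. X (cinv c x) c" and ?Y = "\<lambda>x. Y (cinv c x) c"
  have "smooth_on ?S (\<lambda>x. \<Gamma> c x (?X x) (?Y x) - \<Gamma> c x (?Y x) (?X x))"
    by (intro smooth_on_diff S smooth_gam_fields c smooth_field_chart X Y)
  moreover have "tort (cinv c x) (X (cinv c x)) (Y (cinv c x)) c = \<Gamma> c x (?X x) (?Y x) - \<Gamma> c x (?Y x) (?X x)" if "x \<in> ?S" for x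
  proof -
    have x: "x \<in> cim c" "cinv c x \<in> W" using that image_iff_cinv[OF c] by blast+
    show ?thesis
      using tort_chart[OF smooth_field_tangent[OF X x(2)] smooth_field_tangent[OF Y x(2)] chartsI[OF c cinv_cdom[OF x(1)]]] x(1)
      by (simp add: tor_def)
  qed
  ultimately show ?thesis
    using smooth_on_cong[OF S(1), where f = "\<lambda>x. tort (cinv c x) (X (cinv c x)) (Y (cinv c x)) c"
        and g = "\<lambda>x. \<Gamma> c x (?X x) (?Y x) - \<Gamma> c x (?Y x) (?X x)"] by blast
qed

lemma linear_connection_lc: "linear_connection M lc"
  unfolding linear_connection_def
proof (intro conjI allI impI)
  fix W X Y assume a: "openin (mtop M) W \<and> smooth_field M W X \<and> smooth_field M W Y"
  then have W: "openin (mtop M) W" and X: "smooth_field M W X" and Y: "smooth_field M W Y" by auto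
  have top: "p \<in> W \<Longrightarrow> p \<in> topspace (mtop M)" for p using openin_subset[OF W] by blast
  show "smooth_field M W (\<lambda>p. lc p (X p) Y)"
    unfolding smooth_field_def
  proof (intro conjI ballI)
    fix p assume p: "p \<in> W"
    show "lc p (X p) Y \<in> tangent_space M p"
      using D_tangent[OF W Y p smooth_field_tangent[OF X p]] top[OF p] by (simp add: lc_def)
  next
    fix c assume c: "c \<in> atlas M"
    have "smooth_on (cmap c ` (W \<inter> cdom c)) (\<lambda>x. D (cinv c x) (X (cinv c x)) Y c - (1/2) *\<^sub>R tort (cinv c x) (X (cinv c x)) (Y (cinv c x)) c)"
      by (intro smooth_on_diff open_image[OF c W] smooth_field_chart[OF D_smooth[OF W X Y] c]
          smooth_on_linear[OF _ bounded_linear_scaleR_right] smooth_tort[OF W X Y c])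
    then show "smooth_on (cmap c ` (W \<inter> cdom c)) (\<lambda>x. lc (cinv c x) (X (cinv c x)) Y c)" by (simp add: lc_def)
  qed
next
  fix W Y p v w a
  assume a: "openin (mtop M) W \<and> smooth_field M W Y \<and> p \<in> W \<and> v \<in> tangent_space M p \<and> w \<in> tangent_space M p"
  then have W: "openin (mtop M) W" and Y: "smooth_field M W Y" and p: "p \<in> W" and v: "v \<in> tangent_space M p" "w \<in> tangent_space M p" by auto
  have pt: "p \<in> topspace (mtop M)" using openin_subset[OF W] p by blast
  show "lc p (tadd v w) Y = tadd (lc p v Y) (lc p w Y)"
    unfolding lc_def D_linear(1)[OF W Y p v] tort_linear(1)[OF v smooth_field_tangent[OF Y p] pt]
    by (rule ext) (simp add: algebra_simps)
  show "lc p (tscale a v) Y = tscale a (lc p v Y)"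
    unfolding lc_def D_linear(2)[OF W Y p v] tort_linear(2)[OF v smooth_field_tangent[OF Y p] pt]
    by (rule ext) (simp add: algebra_simps)
next
  fix W Y Z p v
  assume a: "openin (mtop M) W \<and> smooth_field M W Y \<and> smooth_field M W Z \<and> p \<in> W \<and> v \<in> tangent_space M p"
  then have W: "openin (mtop M) W" and Y: "smooth_field M W Y" and Z: "smooth_field M W Z" and p: "p \<in> W" and v: "v \<in> tangent_space M p" by auto
  have pt: "p \<in> topspace (mtop M)" using openin_subset[OF W] p by blast
  show "lc p v (\<lambda>q. tadd (Y q) (Z q)) = tadd (lc p v Y) (lc p v Z)"
    unfolding lc_def D_add[OF W Y Z p v] tort_linear(3)[OF smooth_field_tangent[OF Y p] smooth_field_tangent[OF Z p] v pt]
    by (rule ext) (simp add: algebra_simps)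
next
  fix W Y f p v
  assume a: "openin (mtop M) W \<and> smooth_field M W Y \<and> smooth_fun M W f \<and> p \<in> W \<and> v \<in> tangent_space M p"
  then have W: "openin (mtop M) W" and Y: "smooth_field M W Y" and f: "smooth_fun M W f" and p: "p \<in> W" and v: "v \<in> tangent_space M p" by auto
  have pt: "p \<in> topspace (mtop M)" using openin_subset[OF W] p by blast
  show "lc p v (\<lambda>q. tscale (f q) (Y q)) = tadd (tscale (vec_deriv M p v f) (Y p)) (tscale (f p) (lc p v Y))"
    unfolding lc_def D_leibniz[OF W Y f p v] tort_linear(4)[OF smooth_field_tangent[OF Y p] v v pt]
    by (rule ext) (simp add: algebra_simps)
qed

text \<open>Removing half of the skew part leaves the symmetric part, which exhibits
  \<open>lc\<close> as free of torsion.\<close>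

lemma gam_lc:
  assumes c: "c \<in> atlas M" and x: "x \<in> cim c"
  shows "gam M lc c x u v = (1/2) *\<^sub>R (\<Gamma> c x u v + \<Gamma> c x v u)"
proof -
  let ?p = "cinv c x"
  have p: "c \<in> charts_at M ?p" using c x by (simp add: chartsI)
  have t: "tort ?p (tvec_of M c ?p u) (coord_field M c j ?p) c = tor M D c x u (axis j 1)" for j
    using tort_chart[OF tvec_of_tangent[OF p, of u] tvec_of_tangent[OF p, of "axis j 1"] p] p x
    by (simp add: coord_field_def)
  have "gam M lc c x u v = \<Gamma> c x u v - (1/2) *\<^sub>R (\<Sum>j\<in>UNIV. v $ j *\<^sub>R tor M D c x u (axis j 1))"
    by (simp add: gam_def lc_def t scaleR_diff_right sum_subtractf scaleR_sum_right mult.commute)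
  also have "(\<Sum>j\<in>UNIV. v $ j *\<^sub>R tor M D c x u (axis j 1)) = tor M D c x u v"
    by (rule linear_axis_expansion[OF linear_tor(2)[OF c x], symmetric])
  also have "\<Gamma> c x u v - (1/2) *\<^sub>R tor M D c x u v = (1/2) *\<^sub>R (\<Gamma> c x u v + \<Gamma> c x v u)"
    by (simp add: tor_def vec_eq_iff field_simps)
  finally show ?thesis .
qed

lemma torsion_freeI:
  assumes "\<And>c x u v. c \<in> atlas M \<Longrightarrow> x \<in> cim c \<Longrightarrow> tor M D c x u v = 0"
  shows "torsion_free M D"
  unfolding torsion_free_def
proof (intro allI impI)
  fix W X Y p assume a: "openin (mtop M) W \<and> smooth_field M W X \<and> smooth_field M W Y \<and> p \<in> W"
  then have pt: "p \<in> topspace (mtop M)" using openin_subset by blast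
  note c = chart_at[OF pt] and C = chartsD[OF chart_at[OF pt]]
  have "torsion M D X Y p = tort p (X p) (Y p)" using torsion_eq a by blast
  also have "\<dots> = tzero" unfolding tort_def assms[OF C(1) cmap_cim[OF C(2)]] by (rule tvec_of_linear(3)[OF c])
  finally show "torsion M D X Y p = tzero" .
qed

lemma torsion_freeD:
  assumes tf: "torsion_free M D" and c: "c \<in> atlas M" and x: "x \<in> cim c"
  shows "tor M D c x u v = 0"
proof -
  have p: "c \<in> charts_at M (cinv c x)" using c x by (simp add: chartsI)
  have t: "cfield M c w (cinv c x) = tvec_of M c (cinv c x) w" for w by (simp add: cfield_def)
  have "torsion M D (cfield M c u) (cfield M c v) (cinv c x) = tzero"
    using tf open_cdom[OF c] smooth_field_cfield[OF c] cinv_cdom[OF x] unfolding torsion_free_def by blast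
  then have "tort (cinv c x) (tvec_of M c (cinv c x) u) (tvec_of M c (cinv c x) v) c = 0"
    using torsion_eq[OF open_cdom[OF c] smooth_field_cfield[OF c] smooth_field_cfield[OF c] cinv_cdom[OF x], of u v] by (simp add: t)
  then show ?thesis
    using tort_chart[OF tvec_of_tangent[OF p] tvec_of_tangent[OF p] p, of u v] p x by simp
qed

lemma torsion_free_lc: "torsion_free M lc"
proof -
  interpret L: lin_conn M lc by unfold_locales (rule linear_connection_lc)
  show ?thesis by (rule L.torsion_freeI) (simp add: tor_def gam_lc add.commute)
qed

end

section \<open>Flat connections with alternating torsion\<close>

locale alt_conn = metric_conn M F D for M :: "('a, 3) manifold" and F and D +
  assumes alt: "totally_antisymmetric_torsion M (averaged_metric M F) D" and fl: "flat M D"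
begin

text \<open>The hypothesis on the torsion concerns fields; on fields with constant coordinates in
  \<open>c\<close> it becomes the pointwise condition of the locale.\<close>

lemma metric_torsion_chart:
  assumes c: "c \<in> atlas M" and x: "x \<in> cim c"
  shows "metric_torsion (G c x) (tor M D c x)"
proof (rule metric_torsion.intro)
  show "v \<bullet> (G c x *v w) = w \<bullet> (G c x *v v)" for v w by (rule G_sym[OF c x])
  show "0 < v \<bullet> (G c x *v v)" if "v \<noteq> 0" for v by (rule G_pos[OF c x that])
  show "linear (\<lambda>u. tor M D c x u v)" for v by (rule linear_tor(1)[OF c x])
  show "linear (tor M D c x u)" for u by (rule linear_tor(2)[OF c x])
  show "tor M D c x v u = - tor M D c x u v" for u v by (simp add: tor_def)
  fix u v w
  let ?p = "cinv c x"
  note p = chart_at_cinv[OF c x]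
  have lt: "lowered_torsion M (averaged_metric M F) D (cfield M c a) (cfield M c b) (cfield M c e) ?p = tor M D c x a b \<bullet> (G c x *v e)" for a b e
  proof -
    have t: "cfield M c w ?p = tvec_of M c ?p w" for w by (simp add: cfield_def)
    have "torsion M D (cfield M c a) (cfield M c b) ?p = tort ?p (tvec_of M c ?p a) (tvec_of M c ?p b)"
      using torsion_eq[OF open_cdom[OF c] smooth_field_cfield[OF c] smooth_field_cfield[OF c] cinv_cdom[OF x], of a b] by (simp add: t)
    then show ?thesis
      using averaged_chart[OF tort_tangent[OF charts_at_topspace[OF p]] tvec_of_tangent[OF p] p]
        tort_chart[OF tvec_of_tangent[OF p] tvec_of_tangent[OF p] p] p x
      by (simp add: lowered_torsion_def t)
  qed
  have "lowered_torsion M (averaged_metric M F) D (cfield M c u) (cfield M c w) (cfield M c v) ?p =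
      - lowered_torsion M (averaged_metric M F) D (cfield M c u) (cfield M c v) (cfield M c w) ?p"
    using alt open_cdom[OF c] smooth_field_cfield[OF c] cinv_cdom[OF x] unfolding totally_antisymmetric_torsion_def by blast
  then show "tor M D c x u w \<bullet> (G c x *v v) = - (tor M D c x u v \<bullet> (G c x *v w))" unfolding lt .
qed

text \<open>The correction by half the torsion contributes two terms that are opposite, because
  \<open>T(h,_)\<close> is skew for \<gamma>.\<close>

lemma metric_gam_lc: "metric_gam (gam M lc)"
  unfolding metric_gam_def
proof (intro ballI allI)
  fix c x u v assume c: "c \<in> atlas M" and x: "x \<in> cim c"
  interpret metric_torsion "G c x" "tor M D c x" by (rule metric_torsion_chart[OF c x])
  have e: "gam M lc c x h u = \<Gamma> c x h u - (1/2) *\<^sub>R tor M D c x h u" for h u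
    by (simp add: gam_lc[OF c x] tor_def vec_eq_iff field_simps)
  have "gam M lc c x h u \<bullet> (G c x *v v) + u \<bullet> (G c x *v gam M lc c x h v) =
      \<Gamma> c x h u \<bullet> (G c x *v v) + u \<bullet> (G c x *v \<Gamma> c x h v)" for h
    using T_alt[of h v u] sym[of u "tor M D c x h v"]
    by (simp add: e inner_diff_left inner_diff_right matrix_vector_mult_diff_distrib matrix_vector_mult_scaleR)
  then show "((\<lambda>x. u \<bullet> (G c x *v v)) has_derivative
      (\<lambda>h. gam M lc c x h u \<bullet> (G c x *v v) + u \<bullet> (G c x *v gam M lc c x h v))) (at x)"
    using G_const_deriv[OF c x] by simp
qed

lemma levi_civita_lc: "levi_civita M (averaged_metric M F) lc"
proof -
  interpret L: metric_conn M F lc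
    by unfold_locales (rule linear_connection_lc metric_gam_lc)+
  show ?thesis by (rule L.levi_civita_averaged[OF torsion_free_lc])
qed

text \<open>The covariant derivative of the torsion in direction \<open>h\<close>, evaluated at
  \<open>u\<close> and \<open>v\<close>, in coordinates.\<close>

definition DT :: "('a, 3) chart \<Rightarrow> real^3 \<Rightarrow> real^3 \<Rightarrow> real^3 \<Rightarrow> real^3 \<Rightarrow> real^3" where
  "DT c x h u v = fd (\<lambda>x. \<Gamma> c x u v) x h - fd (\<lambda>x. \<Gamma> c x v u) x h
     + \<Gamma> c x h (tor M D c x u v) - tor M D c x (\<Gamma> c x h u) v - tor M D c x u (\<Gamma> c x h v)"

lemma flat_chart:
  assumes "c \<in> atlas M" "x \<in> cim c"
  shows "fd (\<lambda>x. \<Gamma> c x v w) x u - fd (\<lambda>x. \<Gamma> c x u w) x v + \<Gamma> c x u (\<Gamma> c x v w) - \<Gamma> c x v (\<Gamma> c x u w) = 0"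
  using flat_curv[OF fl assms] by (simp add: curv_def)

lemma tor_deriv:
  assumes "c \<in> atlas M" "x \<in> cim c"
  shows "((\<lambda>x. tor M D c x u v) has_derivative (\<lambda>h. fd (\<lambda>x. \<Gamma> c x u v) x h - fd (\<lambda>x. \<Gamma> c x v u) x h)) (at x)"
  unfolding tor_def by (intro has_derivative_diff has_derivative_fd gam_differentiable assms)

lemma DT_zero:
  assumes c: "c \<in> atlas M" and x: "x \<in> cim c" and h: "h \<noteq> 0"
  shows "DT c x h u v = 0"
proof -
  interpret metric_torsion "G c x" "tor M D c x" by (rule metric_torsion_chart[OF c x])
  note o = open_cim[OF c]
  note lg = linear_gam_left[OF c x] linear_gam_right[where c = c and x = x]
  have ld: "linear (\<lambda>u. fd (\<lambda>x. \<Gamma> c x u v) x h)" "linear (\<lambda>v. fd (\<lambda>x. \<Gamma> c x u v) x h)" for u v h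
    by (rule linear_fd_apply[OF o x _ gam_differentiable[OF c x]], rule linear_gam_left[OF c], assumption,
        rule linear_fd_apply[OF o x linear_gam_right gam_differentiable[OF c x]])
  note lins = linear_add[OF ld(1)] linear_add[OF ld(2)] linear_cmul[OF ld(1)] linear_cmul[OF ld(2)]
    linear_add[OF lg(1)] linear_add[OF lg(2)] linear_cmul[OF lg(1)] linear_cmul[OF lg(2)]
    linear_add[OF T_lin(1)] linear_add[OF T_lin(2)] linear_cmul[OF T_lin(1)] linear_cmul[OF T_lin(2)]
  show ?thesis
  proof (rule parallel_torsion[where DT = "DT c x", OF _ _ _ _ _ h])
    show "linear (\<lambda>u. DT c x h u v)" for h v
      by (rule linearI) (simp_all add: DT_def lins algebra_simps)
    show "linear (DT c x h u)" for h u
      by (rule linearI) (simp_all add: DT_def lins algebra_simps)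
    show "DT c x h v u = - DT c x h u v" for h u v
      using T_skew[of v u] T_skew[of "\<Gamma> c x h u" v] T_skew[of u "\<Gamma> c x h v"] linear_neg[OF linear_gam_right[where c = c and x = x and u = h], of "tor M D c x u v"]
      by (simp add: DT_def)
    show "DT c x u v w + DT c x v w u + DT c x w u v + tor M D c x (tor M D c x u v) w + tor M D c x (tor M D c x v w) u
        + tor M D c x (tor M D c x w u) v = 0" for u v w
      using flat_identities(1)[of "\<Gamma> c x" "\<lambda>u v w. fd (\<lambda>x. \<Gamma> c x v w) x u" u v w, OF lg flat_chart[OF c x]]
      unfolding DT_def tor_def by simp
    show "DT c x h u w \<bullet> (G c x *v v) = - (DT c x h u v \<bullet> (G c x *v w))" for h u v w
    proof -
      \<comment> \<open>The alternation of the covariant derivative is obtained by differentiating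
        that of the torsion; as \<gamma> is parallel, the derivative of \<open>G\<close> turns into
        Christoffel terms.\<close>
      have d: "((\<lambda>z. tor M D c z u v \<bullet> (G c z *v w)) has_derivative
          (\<lambda>h. (fd (\<lambda>x. \<Gamma> c x u v) x h - fd (\<lambda>x. \<Gamma> c x v u) x h + \<Gamma> c x h (tor M D c x u v)) \<bullet> (G c x *v w)
             + tor M D c x u v \<bullet> (G c x *v \<Gamma> c x h w))) (at x)" for v w
        using G_deriv[OF c x differentiableI[OF tor_deriv[OF c x, of u v]], of "\<lambda>_. w"]
        by (simp add: fd_apply[OF tor_deriv[OF c x]])
      have eq: "fd (\<lambda>z. tor M D c z u w \<bullet> (G c z *v v)) x = fd (\<lambda>z. - (tor M D c z u v \<bullet> (G c z *v w))) x"
        by (rule fd_cong_open[OF o x]) (rule metric_torsion.T_alt[OF metric_torsion_chart[OF c]])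
      have e: "(fd (\<lambda>x. \<Gamma> c x u w) x h - fd (\<lambda>x. \<Gamma> c x w u) x h + \<Gamma> c x h (tor M D c x u w)) \<bullet> (G c x *v v)
             + tor M D c x u w \<bullet> (G c x *v \<Gamma> c x h v) =
          - ((fd (\<lambda>x. \<Gamma> c x u v) x h - fd (\<lambda>x. \<Gamma> c x v u) x h + \<Gamma> c x h (tor M D c x u v)) \<bullet> (G c x *v w)
             + tor M D c x u v \<bullet> (G c x *v \<Gamma> c x h w))"
        by (rule trans[OF fd_apply[OF d[of w v], of h, symmetric] trans[OF fun_cong[OF eq] fd_apply[OF has_derivative_minus[OF d[of v w]]]]])
      show ?thesis
        using e T_alt[of "\<Gamma> c x h u" w v] T_alt[of u "\<Gamma> c x h v" w] T_alt[of u "\<Gamma> c x h w" v]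
        by (simp add: DT_def inner_add_left inner_diff_left)
    qed
  qed
qed

definition \<kappa>c :: "('a, 3) chart \<Rightarrow> real^3 \<Rightarrow> real" where
  "\<kappa>c c x = metric_torsion.\<kappa> (G c x) (tor M D c x)"

lemma torsion_inner_chart:
  assumes "c \<in> atlas M" "x \<in> cim c"
  shows "tor M D c x a b \<bullet> (G c x *v tor M D c x e f) =
    \<kappa>c c x * ((a \<bullet> (G c x *v e)) * (b \<bullet> (G c x *v f)) - (a \<bullet> (G c x *v f)) * (b \<bullet> (G c x *v e)))"
  unfolding \<kappa>c_def by (rule metric_torsion.torsion_inner[OF metric_torsion_chart[OF assms]])

text \<open>By \<open>flat_identities\<close> the curvature consists of a covariant derivative of
  the torsion, zero by \<open>DT_zero\<close>, and the quadratic term. Repeating \<open>v\<close> is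
  enough for sectional curvature.\<close>

lemma curv_lc:
  assumes c: "c \<in> atlas M" and x: "x \<in> cim c" and v: "v \<noteq> 0"
  shows "lin_conn.curv M lc c x u v v = - (1/4) *\<^sub>R tor M D c x (tor M D c x u v) v"
proof -
  interpret L: lin_conn M lc by unfold_locales (rule linear_connection_lc)
  have d: "fd (\<lambda>x. gam M lc c x a b) x h = (1/2) *\<^sub>R (fd (\<lambda>x. \<Gamma> c x a b) x h + fd (\<lambda>x. \<Gamma> c x b a) x h)" for a b h
  proof -
    have "((\<lambda>x. (1/2) *\<^sub>R (\<Gamma> c x a b + \<Gamma> c x b a)) has_derivative
        (\<lambda>h. (1/2) *\<^sub>R (fd (\<lambda>x. \<Gamma> c x a b) x h + fd (\<lambda>x. \<Gamma> c x b a) x h))) (at x)"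
      by (intro has_derivative_scaleR_right has_derivative_add has_derivative_fd gam_differentiable c x)
    from fd_apply[OF this, of h] show ?thesis
      using fd_cong_open[OF open_cim[OF c] x gam_lc[OF c, where u = a and v = b]] by simp
  qed
  have "L.curv c x u v v = (1/2) *\<^sub>R DT c x v u v - (1/4) *\<^sub>R tor M D c x (tor M D c x u v) v"
    using flat_identities(2)[of "\<Gamma> c x" "\<lambda>u v w. fd (\<lambda>x. \<Gamma> c x v w) x u" u v, OF linear_gam_left[OF c x] linear_gam_right flat_chart[OF c x]]
    unfolding L.curv_def d gam_lc[OF c x] DT_def tor_def by simp
  then show ?thesis using DT_zero[OF c x v] by simp
qed

lemma sectional_curvature_lc:
  assumes W: "openin (mtop M) W" and X: "smooth_field M W X" and Y: "smooth_field M W Y" and p: "p \<in> W"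
    and ind: "tindependent (X p) (Y p)" and c: "c \<in> charts_at M p"
  shows "sectional_curvature M (averaged_metric M F) lc X Y p = \<kappa>c c (cmap c p) / 4"
proof -
  interpret L: lin_conn M lc by unfold_locales (rule linear_connection_lc)
  note C = chartsD[OF c]
  let ?x = "cmap c p"
  have x: "?x \<in> cim c" using C by simp
  interpret metric_torsion "G c ?x" "tor M D c ?x" by (rule metric_torsion_chart[OF C(1) x])
  note Xp = smooth_field_tangent[OF X p] and Yp = smooth_field_tangent[OF Y p]
  let ?u = "X p c" and ?v = "Y p c"
  have ind': "a = 0 \<and> b = 0" if "a *\<^sub>R ?u + b *\<^sub>R ?v = 0" for a b
  proof -
    have "tadd (tscale a (X p)) (tscale b (Y p)) = tzero"
      using that by (intro tangent_eqI[OF _ _ c]) (simp_all add: Xp Yp)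
    then show ?thesis using ind unfolding tindependent_def by blast
  qed
  have v: "?v \<noteq> 0" using ind'[of 0 1] by auto
  have area: "(?u \<bullet> (G c ?x *v ?u)) * (?v \<bullet> (G c ?x *v ?v)) - (?u \<bullet> (G c ?x *v ?v))\<^sup>2 > 0"
    by (rule area_pos[OF ind'])
  have ct: "curvature M lc X Y Y p \<in> tangent_space M p"
    unfolding curvature_def
    by (intro tangent_diff L.D_tangent[OF W] L.D_smooth[OF W] X Y p Xp Yp L.lie_bracket_tangent[OF W])
  have "curvature M lc X Y Y p c = - (1/4) *\<^sub>R tor M D c ?x (tor M D c ?x ?u ?v) ?v"
    using L.curvature_chart[OF W X Y Y p c] curv_lc[OF C(1) x v] by simp
  then have "averaged_metric M F p (curvature M lc X Y Y p) (X p) = - (1/4) * (tor M D c ?x (tor M D c ?x ?u ?v) ?v \<bullet> (G c ?x *v ?u))"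
    using averaged_chart[OF ct Xp c] by simp
  \<comment> \<open>Cyclic symmetry of the lowered torsion moves the outer \<open>T\<close> to the
    other side, so the curvature term becomes the squared length of \<open>T(u,v)\<close>.\<close>
  also have "tor M D c ?x (tor M D c ?x ?u ?v) ?v \<bullet> (G c ?x *v ?u) = - (tor M D c ?x ?u ?v \<bullet> (G c ?x *v tor M D c ?x ?u ?v))"
    using cross_triple[of "tor M D c ?x ?u ?v" ?v ?u] T_skew[of ?v ?u]
      torsion_form[of "tor M D c ?x ?u ?v" ?v ?u] torsion_form[of ?v ?u "tor M D c ?x ?u ?v"] by simp
  also have "tor M D c ?x ?u ?v \<bullet> (G c ?x *v tor M D c ?x ?u ?v) =
      \<kappa>c c ?x * ((?u \<bullet> (G c ?x *v ?u)) * (?v \<bullet> (G c ?x *v ?v)) - (?u \<bullet> (G c ?x *v ?v))\<^sup>2)"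
    using torsion_inner_chart[OF C(1) x, of ?u ?v ?u ?v] sym[of ?v ?u] by (simp add: power2_eq_square)
  finally show ?thesis
    unfolding sectional_curvature_def
    using area averaged_chart[OF Xp Xp c] averaged_chart[OF Yp Yp c] averaged_chart[OF Xp Yp c] by simp
qed

end

subsection \<open>Constancy of the curvature\<close>

context alt_conn
begin

text \<open>The Gram determinant of the first two coordinate vectors. It presents \<kappa> as the
  squared length of their torsion divided by their squared area, a quotient that can be
  differentiated and transformed.\<close>

definition area_axes :: "('a, 3) chart \<Rightarrow> real^3 \<Rightarrow> real" where
  "area_axes c x = (axis 1 1 \<bullet> (G c x *v axis 1 1)) * (axis 2 1 \<bullet> (G c x *v axis 2 1)) - (axis 1 1 \<bullet> (G c x *v axis 2 1))\<^sup>2"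

lemma area_axes_pos:
  assumes "c \<in> atlas M" "x \<in> cim c"
  shows "area_axes c x > 0"
  unfolding area_axes_def
proof (rule metric_torsion.area_pos[OF metric_torsion_chart[OF assms]])
  fix a b :: real
  assume "a *\<^sub>R axis 1 1 + b *\<^sub>R axis 2 1 = (0 :: real^3)"
  then show "a = 0 \<and> b = 0" by (simp add: vec_eq_iff forall_3 axis_def)
qed

lemma torsion_area:
  assumes "c \<in> atlas M" "x \<in> cim c"
  shows "tor M D c x (axis 1 1) (axis 2 1) \<bullet> (G c x *v tor M D c x (axis 1 1) (axis 2 1)) = \<kappa>c c x * area_axes c x"
  using torsion_inner_chart[OF assms, of "axis 1 1" "axis 2 1" "axis 1 1" "axis 2 1"] G_sym[OF assms, of "axis 2 1" "axis 1 1"]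
  by (simp add: area_axes_def power2_eq_square)

lemma kappa_deriv:
  assumes c: "c \<in> atlas M" and x: "x \<in> cim c"
  shows "(\<kappa>c c has_derivative (\<lambda>h. 0)) (at x)"
proof -
  let ?u = "axis 1 1 :: real^3" and ?v = "axis 2 1 :: real^3"
  let ?T = "tor M D c" and ?g = "\<lambda>a b. a \<bullet> (G c x *v b)"
  interpret metric_torsion "G c x" "?T x" by (rule metric_torsion_chart[OF c x])
  define dT where "dT h = fd (\<lambda>x. \<Gamma> c x ?u ?v) x h - fd (\<lambda>x. \<Gamma> c x ?v ?u) x h + \<Gamma> c x h (?T x ?u ?v)" for h
  define N' where "N' h = ?g (dT h) (?T x ?u ?v) + ?g (?T x ?u ?v) (dT h)" for h
  define A' where "A' h = ?g ?u ?u * (?g (\<Gamma> c x h ?v) ?v + ?g ?v (\<Gamma> c x h ?v)) + (?g (\<Gamma> c x h ?u) ?u + ?g ?u (\<Gamma> c x h ?u)) * ?g ?v ?v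
      - 2 * (?g (\<Gamma> c x h ?u) ?v + ?g ?u (\<Gamma> c x h ?v)) * ?g ?u ?v" for h
  have dN: "((\<lambda>z. ?T z ?u ?v \<bullet> (G c z *v ?T z ?u ?v)) has_derivative N') (at x)"
    using G_deriv[OF c x differentiableI[OF tor_deriv[OF c x]] differentiableI[OF tor_deriv[OF c x]], of ?u ?v ?u ?v]
    by (simp add: N'_def[abs_def] dT_def fd_apply[OF tor_deriv[OF c x]])
  have dA: "(area_axes c has_derivative A') (at x)"
  proof -
    have "((\<lambda>z. (?u \<bullet> (G c z *v ?u)) * (?v \<bullet> (G c z *v ?v)) - (?u \<bullet> (G c z *v ?v)) * (?u \<bullet> (G c z *v ?v))) has_derivative A') (at x)"
      by (rule has_derivative_eq_rhs[OF has_derivative_diff[OF has_derivative_mult[OF G_const_deriv[OF c x] G_const_deriv[OF c x]]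
            has_derivative_mult[OF G_const_deriv[OF c x] G_const_deriv[OF c x]]]])
        (simp add: A'_def fun_eq_iff algebra_simps)
    then show ?thesis by (simp add: area_axes_def[abs_def] power2_eq_square)
  qed
  \<comment> \<open>Numerator and denominator of \<kappa> vary in the same proportion. The case
    \<open>h = 0\<close> is separate because \<open>DT_zero\<close> concerns nonzero
    directions.\<close>
  have eq: "N' h = \<kappa>c c x * A' h" for h
  proof (cases "h = 0")
    case True
    then show ?thesis
      using linear_0[OF has_derivative_linear[OF dN]] linear_0[OF has_derivative_linear[OF dA]] by simp
  next
    case False
    \<comment> \<open>As the torsion is parallel, its derivative is the torsion of the derivatives
      of its arguments; \<open>torsion_inner_chart\<close> then applies to each of the resulting
      products.\<close>
    have "dT h = ?T x (\<Gamma> c x h ?u) ?v + ?T x ?u (\<Gamma> c x h ?v)"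
      using DT_zero[OF c x False, of ?u ?v] by (simp add: DT_def dT_def algebra_simps)
    then have "N' h = 2 * (?g (?T x (\<Gamma> c x h ?u) ?v) (?T x ?u ?v) + ?g (?T x ?u (\<Gamma> c x h ?v)) (?T x ?u ?v))"
      using sym[of "?T x ?u ?v"] by (simp add: N'_def inner_add_left)
    then show ?thesis
      using sym[of ?v ?u] sym[of ?u "\<Gamma> c x h ?u"] sym[of ?u "\<Gamma> c x h ?v"] sym[of ?v "\<Gamma> c x h ?u"] sym[of ?v "\<Gamma> c x h ?v"]
      unfolding torsion_inner_chart[OF c x] by (simp add: A'_def algebra_simps)
  qed
  have ne: "area_axes c x \<noteq> 0" using area_axes_pos[OF c x] by simp
  have "((\<lambda>z. (?T z ?u ?v \<bullet> (G c z *v ?T z ?u ?v)) / area_axes c z) has_derivative (\<lambda>h. 0)) (at x)"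
    by (rule has_derivative_eq_rhs[OF has_derivative_divide'[OF dN dA ne]]) (simp add: eq torsion_area[OF c x] fun_eq_iff)
  moreover have "(?T z ?u ?v \<bullet> (G c z *v ?T z ?u ?v)) / area_axes c z = \<kappa>c c z" if "z \<in> cim c" for z
    using torsion_area[OF c that] area_axes_pos[OF c that] by simp
  ultimately show ?thesis
    using has_derivative_cong_open[OF open_cim[OF c] x, of "\<lambda>z. (?T z ?u ?v \<bullet> (G c z *v ?T z ?u ?v)) / area_axes c z" "\<kappa>c c"] by blast
qed

lemma kappa_chart:
  assumes c: "c \<in> charts_at M p" and d: "d \<in> charts_at M p"
  shows "\<kappa>c c (cmap c p) = \<kappa>c d (cmap d p)"
proof -
  note C = chartsD[OF c] and E = chartsD[OF d]
  have x: "cmap c p \<in> cim c" "cmap d p \<in> cim d" using C E by simp_all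
  let ?u = "axis 1 1 :: real^3" and ?v = "axis 2 1 :: real^3"
  \<comment> \<open>The squared length of the torsion of two axes is computed in both charts; in
    \<open>d\<close> it involves the Gram determinant of their Jacobian images, which is the same
    since the Jacobian is an isometry.\<close>
  have "\<kappa>c c (cmap c p) * area_axes c (cmap c p) = \<kappa>c d (cmap d p) * area_axes c (cmap c p)"
    unfolding torsion_area[OF C(1) x(1), symmetric] G_transform[OF c d] tor_transform[OF c d] torsion_inner_chart[OF E(1) x(2)]
    using G_transform[OF c d] G_sym[OF C(1) x(1), of ?v ?u] by (simp add: area_axes_def power2_eq_square)
  then show ?thesis using area_axes_pos[OF C(1) x(1)] by simp
qed

definition \<kappa>p :: "'a \<Rightarrow> real" where
  "\<kappa>p p = \<kappa>c (chart_at M p) (cmap (chart_at M p) p)"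

lemma kappa_at: "c \<in> charts_at M p \<Longrightarrow> \<kappa>p p = \<kappa>c c (cmap c p)"
  unfolding \<kappa>p_def by (rule kappa_chart[OF chart_at[OF charts_at_topspace]])

lemma kappa_locally_constant:
  assumes p: "p \<in> topspace (mtop M)"
  shows "\<exists>U. openin (mtop M) U \<and> p \<in> U \<and> (\<forall>q\<in>U. \<kappa>p q = \<kappa>p p)"
proof -
  define c where "c = chart_at M p"
  have c: "c \<in> charts_at M p" unfolding c_def by (rule chart_at[OF p])
  note C = chartsD[OF c]
  obtain e where e: "e > 0" "ball (cmap c p) e \<subseteq> cim c"
    using open_contains_ball[of "cim c"] open_cim[OF C(1)] cmap_cim[OF C(2)] by blast
  have "\<exists>k. \<forall>x\<in>ball (cmap c p) e. \<kappa>c c x = k"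
  proof (rule has_derivative_zero_constant[OF convex_ball])
    fix x assume "x \<in> ball (cmap c p) e"
    then have "x \<in> cim c" using e by blast
    then show "(\<kappa>c c has_derivative (\<lambda>h. 0)) (at x within ball (cmap c p) e)"
      by (rule has_derivative_at_withinI[OF kappa_deriv[OF C(1)]])
  qed
  then obtain k where k: "\<And>x. x \<in> ball (cmap c p) e \<Longrightarrow> \<kappa>c c x = k" by blast
  have "\<kappa>p q = k" if q: "q \<in> cinv c ` ball (cmap c p) e" for q
  proof -
    from q obtain x where x: "x \<in> ball (cmap c p) e" "q = cinv c x" by blast
    then have xc: "x \<in> cim c" using e by blast
    then show ?thesis using kappa_at[OF chart_at_cinv[OF C(1) xc]] k[OF x(1)] x(2) by simp
  qed
  moreover have "p \<in> cinv c ` ball (cmap c p) e"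
    using C e by (intro image_eqI[of _ _ "cmap c p"]) auto
  moreover have "openin (mtop M) (cinv c ` ball (cmap c p) e)"
    by (rule openin_cinv_image[OF C(1) open_ball e(2)])
  ultimately show ?thesis by (intro exI[of _ "cinv c ` ball (cmap c p) e"]) auto
qed

lemma kappa_constant:
  assumes con: "connected_space (mtop M)" and p: "p \<in> topspace (mtop M)" and q: "q \<in> topspace (mtop M)"
  shows "\<kappa>p q = \<kappa>p p"
proof (rule ccontr)
  assume ne: "\<kappa>p q \<noteq> \<kappa>p p"
  \<comment> \<open>Local constancy makes every set defined through \<kappa> open, in particular a
    level set and its complement.\<close>
  have o: "openin (mtop M) {r \<in> topspace (mtop M). P (\<kappa>p r)}" for P
  proof (subst openin_subopen, intro ballI)
    fix r assume r: "r \<in> {r \<in> topspace (mtop M). P (\<kappa>p r)}"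
    then obtain U where U: "openin (mtop M) U" "r \<in> U" "\<forall>q\<in>U. \<kappa>p q = \<kappa>p r" using kappa_locally_constant by blast
    have "U \<subseteq> {r \<in> topspace (mtop M). P (\<kappa>p r)}"
    proof
      fix q assume q: "q \<in> U"
      then have "\<kappa>p q = \<kappa>p r" using U(3) by blast
      then show "q \<in> {r \<in> topspace (mtop M). P (\<kappa>p r)}" using openin_subset[OF U(1)] q r by simp blast
    qed
    then show "\<exists>T. openin (mtop M) T \<and> r \<in> T \<and> T \<subseteq> {r \<in> topspace (mtop M). P (\<kappa>p r)}" using U by blast
  qed
  let ?A = "{r \<in> topspace (mtop M). \<kappa>p r = \<kappa>p p}" and ?B = "{r \<in> topspace (mtop M). \<kappa>p r \<noteq> \<kappa>p p}"
  have "openin (mtop M) ?A" "openin (mtop M) ?B" using o[of "\<lambda>k. k = \<kappa>p p"] o[of "\<lambda>k. k \<noteq> \<kappa>p p"] by auto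
  moreover have "topspace (mtop M) \<subseteq> ?A \<union> ?B" "?A \<inter> ?B = {}" "?A \<noteq> {}" "?B \<noteq> {}" using p q ne by auto
  ultimately show False using con unfolding connected_space_def by blast
qed

lemma constant_curvature:
  assumes con: "connected_space (mtop M)" and p: "p \<in> topspace (mtop M)"
  shows "constant_sectional_curvature M (averaged_metric M F) (\<kappa>p p / 4)"
  unfolding constant_sectional_curvature_def
proof (intro conjI exI[of _ lc] allI impI)
  fix W X Y q
  assume a: "openin (mtop M) W \<and> smooth_field M W X \<and> smooth_field M W Y \<and> q \<in> W \<and> tindependent (X q) (Y q)"
  then have q: "q \<in> topspace (mtop M)" using openin_subset by blast
  have "sectional_curvature M (averaged_metric M F) lc X Y q = \<kappa>p q / 4"
    unfolding \<kappa>p_def using a by (intro sectional_curvature_lc[OF _ _ _ _ _ chart_at[OF q]]) auto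
  then show "sectional_curvature M (averaged_metric M F) lc X Y q = \<kappa>p p / 4"
    using kappa_constant[OF con p q] by simp
qed (rule riemannian_averaged levi_civita_lc)+

lemma kappa_nonneg:
  assumes "p \<in> topspace (mtop M)"
  shows "\<kappa>p p \<ge> 0"
proof -
  note C = chartsD[OF chart_at[OF assms]]
  interpret metric_torsion "G (chart_at M p) (cmap (chart_at M p) p)" "tor M D (chart_at M p) (cmap (chart_at M p) p)"
    by (rule metric_torsion_chart[OF C(1) cmap_cim[OF C(2)]])
  show ?thesis using detA by (simp add: \<kappa>p_def \<kappa>c_def \<kappa>_def)
qed

lemma kappa_zero_torsion_free:
  assumes "\<And>p. p \<in> topspace (mtop M) \<Longrightarrow> \<kappa>p p = 0"
  shows "torsion_free M D"
proof (rule torsion_freeI)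
  fix c x u v assume c: "c \<in> atlas M" and x: "x \<in> cim c"
  interpret metric_torsion "G c x" "tor M D c x" by (rule metric_torsion_chart[OF c x])
  have "\<kappa>p (cinv c x) = 0" using assms charts_at_topspace[OF chart_at_cinv[OF c x]] by blast
  then have "\<kappa> = 0" using kappa_at[OF chart_at_cinv[OF c x]] x by (simp add: \<kappa>c_def)
  then have "\<tau> = 0" using detA by (simp add: \<kappa>_def)
  then show "tor M D c x u v = 0" by (rule torsion_zero)
qed

end

subsection \<open>A second compatible connection without torsion\<close>

text \<open>The tangent plane of an ellipsoid at \<open>y\<close> consists of the vectors \<open>T h y\<close>; a norm whose
  derivative vanishes along all of them is constant on the ellipsoids.\<close>

lemma (in metric_torsion) norm_invariant_imp_quadratic:
  assumes mn: "minkowski_norm f" and \<tau>: "\<tau> \<noteq> 0" and inv: "\<And>h y. y \<noteq> 0 \<Longrightarrow> fd f y (T h y) = 0"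
  obtains C where "\<And>y. (f y)\<^sup>2 = C * (y \<bullet> (A *v y))"
proof -
  interpret minkowski_norm f by (rule mn)
  define q where "q y = (f y)\<^sup>2 / (y \<bullet> (A *v y))" for y
  have dq: "(q has_derivative (\<lambda>z. 0)) (at y)" if y: "y \<noteq> 0" for y
  proof -
    have p: "y \<bullet> (A *v y) > 0" by (rule pos[OF y])
    have df: "f differentiable (at y)" using smooth_on_differentiable[OF smooth] y by simp
    \<comment> \<open>Split \<open>z\<close> into a multiple of \<open>y\<close>, governed by
      Euler's identity, and a vector orthogonal to \<open>y\<close>, which is some
      \<open>T h y\<close> and does not change \<open>f\<close>. Hence \<open>f\<close> varies as
      the norm of the ellipsoid does.\<close>
    have fz: "fd f y z * (y \<bullet> (A *v y)) = f y * (z \<bullet> (A *v y))" for z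
    proof -
      define a where "a = (z \<bullet> (A *v y)) / (y \<bullet> (A *v y))"
      have "(z - a *\<^sub>R y) \<bullet> (A *v y) = 0" using p by (simp add: a_def inner_diff_left)
      then obtain h where h: "T h y = z - a *\<^sub>R y" using torsion_onto[OF \<tau> y] by blast
      have "fd f y z = fd f y (T h y) + a * fd f y y"
        using linear_diff[OF linear_fd[OF df], of z "a *\<^sub>R y"] linear_cmul[OF linear_fd[OF df], of a y] by (simp add: h)
      then have "fd f y z = a * f y" using inv[OF y] euler[OF y] by simp
      then show ?thesis using p by (simp add: a_def)
    qed
    have "((\<lambda>y. y \<bullet> (A *v y)) has_derivative (\<lambda>z. y \<bullet> (A *v z) + z \<bullet> (A *v y))) (at y)"
      by (intro has_derivative_inner has_derivative_ident bounded_linear.has_derivative[OF matrix_vector_mul_bounded_linear])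
    moreover have "((\<lambda>y. (f y)\<^sup>2) has_derivative (\<lambda>z. 2 * f y * fd f y z)) (at y)"
      using has_derivative_power[OF has_derivative_fd[OF df], of 2] by (simp add: mult_ac)
    ultimately have "(q has_derivative (\<lambda>z. (2 * f y * fd f y z * (y \<bullet> (A *v y)) - (f y)\<^sup>2 * (y \<bullet> (A *v z) + z \<bullet> (A *v y))) / ((y \<bullet> (A *v y)) * (y \<bullet> (A *v y))))) (at y)"
      unfolding q_def using p by (intro has_derivative_divide') auto
    moreover have "2 * f y * fd f y z * (y \<bullet> (A *v y)) - (f y)\<^sup>2 * (y \<bullet> (A *v z) + z \<bullet> (A *v y)) = 0" for z
    proof -
      have "2 * f y * fd f y z * (y \<bullet> (A *v y)) = 2 * f y * (f y * (z \<bullet> (A *v y)))"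
        by (simp only: fz[symmetric] mult.assoc)
      then show ?thesis using sym[of y z] by (simp add: power2_eq_square)
    qed
    ultimately show ?thesis by simp
  qed
  have con: "connected (- {0 :: real^3})" by (rule connected_punctured_universe) simp
  have C: "q y = q (axis 1 1)" if "y \<noteq> 0" for y
    by (rule has_derivative_zero_unique_connected[OF _ con dq]) (use that in \<open>auto simp: axis_eq_0_iff\<close>)
  show ?thesis
  proof (rule that[of "q (axis 1 1)"])
    fix y
    show "(f y)\<^sup>2 = q (axis 1 1) * (y \<bullet> (A *v y))"
    proof (cases "y = 0")
      case False
      then show ?thesis unfolding C[OF False, symmetric] using pos[OF False] by (simp add: q_def)
    qed (simp add: f0)
  qed
qed

locale alt_compat_conn = alt_conn M F D + compat_conn M F D for M :: "('a, 3) manifold" and F and D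
begin

text \<open>Uniqueness of the Levi-Civita connection at one point: the difference of two such
  connections is symmetric in its arguments and skew for \<gamma>.\<close>

lemma torsion_free_compatible_gam:
  assumes conn': "linear_connection M D'" and comp': "compatible M F D'" and tf: "torsion_free M D'"
    and c: "c \<in> atlas M" and x: "x \<in> cim c"
  shows "gam M D' c x h u = gam M lc c x h u"
proof -
  interpret L: compat_conn M F D' by unfold_locales (rule conn' comp')+
  interpret metric_torsion "G c x" "tor M D c x" by (rule metric_torsion_chart[OF c x])
  interpret K: lin_conn M lc by unfold_locales (rule linear_connection_lc)
  define S where "S h u = gam M D' c x h u - gam M lc c x h u" for h u
  have S_sym: "S h u = S u h" for h u
    using L.torsion_freeD[OF tf c x, of h u] K.torsion_freeD[OF torsion_free_lc c x, of h u]
    by (simp add: S_def tor_def)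
  have S_skew: "S h u \<bullet> (G c x *v v) = - (S h v \<bullet> (G c x *v u))" for h u v
  proof -
    have "(\<lambda>h. gam M D' c x h u \<bullet> (G c x *v v) + u \<bullet> (G c x *v gam M D' c x h v)) =
      (\<lambda>h. gam M lc c x h u \<bullet> (G c x *v v) + u \<bullet> (G c x *v gam M lc c x h v))"
      by (rule has_derivative_unique[of "\<lambda>x. u \<bullet> (G c x *v v)" _ x])
        (use L.metric_gam_compat metric_gam_lc c x in \<open>auto simp: metric_gam_def\<close>)
    from fun_cong[OF this, of h] show ?thesis
      using sym[of u "S h v"] by (simp add: S_def inner_diff_left inner_diff_right matrix_vector_mult_diff_distrib)
  qed
  \<comment> \<open>Three skew and three symmetric exchanges alternate and return to the initial
    expression with the opposite sign.\<close>
  have "S h u \<bullet> (G c x *v v) = 0" for v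
    using S_skew[of h u v] S_skew[of v h u] S_skew[of u v h] S_sym[of h v] S_sym[of v u] S_sym[of u h] by simp
  then have "S h u = 0" by (intro inner_eqI) simp
  then show ?thesis by (simp add: S_def)
qed

lemma torsion_free_compatible_imp_riemannian:
  assumes conn': "linear_connection M D'" and comp': "compatible M F D'" and tf: "torsion_free M D'"
    and ne: "\<And>p. p \<in> topspace (mtop M) \<Longrightarrow> \<kappa>p p \<noteq> 0"
  shows "is_riemannian M F"
  unfolding is_riemannian_def
proof
  fix p assume p: "p \<in> topspace (mtop M)"
  define c where "c = chart_at M p"
  define x where "x = cmap c p"
  have cp: "c \<in> charts_at M p" unfolding c_def by (rule chart_at[OF p])
  note c = chartsD(1)[OF cp]
  have x: "x \<in> cim c" using chartsD[OF cp] by (simp add: x_def)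
  interpret L: compat_conn M F D' by unfold_locales (rule conn' comp')+
  interpret metric_torsion "G c x" "tor M D c x" by (rule metric_torsion_chart[OF c x])
  interpret m: minkowski_norm "Fc c x" by (rule minkowski_Fc[OF c x])
  have "\<kappa> \<noteq> 0" using ne[OF p] kappa_at[OF cp] by (simp add: \<kappa>c_def x_def)
  then have \<tau>: "\<tau> \<noteq> 0" by (auto simp: \<kappa>_def)
  have inv: "fd (Fc c x) y (tor M D c x h y) = 0" if y: "y \<noteq> 0" for h y
  proof -
    have df: "Fc c x differentiable (at y)" using smooth_on_differentiable[OF m.smooth] y by simp
    \<comment> \<open>Both connections preserve \<open>F\<close>, so both describe the same base
      derivative; their difference, half the torsion, annihilates the norm.\<close>
    have "(\<lambda>h. fd (Fc c x) y (gam M D c x h y)) = (\<lambda>h. fd (Fc c x) y (gam M D' c x h y))"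
      by (rule has_derivative_unique[OF Fc_horizontal[OF c x y] L.Fc_horizontal[OF c x y]])
    from fun_cong[OF this, of h]
    have "fd (Fc c x) y (gam M D c x h y - gam M lc c x h y) = 0"
      unfolding torsion_free_compatible_gam[OF conn' comp' tf c x] by (simp add: linear_diff[OF linear_fd[OF df]])
    moreover have "gam M D c x h y - gam M lc c x h y = (1/2) *\<^sub>R tor M D c x h y"
      by (simp add: gam_lc[OF c x] tor_def vec_eq_iff field_simps)
    ultimately show ?thesis by (simp add: linear_cmul[OF linear_fd[OF df]])
  qed
  obtain C where C: "\<And>y. (Fc c x y)\<^sup>2 = C * (y \<bullet> (G c x *v y))"
    using norm_invariant_imp_quadratic[OF m.minkowski_norm_axioms \<tau> inv] by blast
  show "\<exists>B. sym_bilinear_at M p B \<and> (\<forall>v\<in>tangent_space M p. (F p v)\<^sup>2 = B v v)"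
  proof (intro exI conjI ballI)
    show "sym_bilinear_at M p (\<lambda>v w. C * (v c \<bullet> (G c x *v w c)))"
      unfolding sym_bilinear_at_def
    proof (intro ballI allI conjI)
      fix u v w a
      show "C * (u c \<bullet> (G c x *v v c)) = C * (v c \<bullet> (G c x *v u c))" by (simp only: sym[of "u c" "v c"])
    qed (simp_all add: inner_add_left algebra_simps)
    fix v assume v: "v \<in> tangent_space M p"
    have "F p v = Fc c x (v c)"
      unfolding x_def Fc_cmap[OF cp] tvec_of_tangent_eq[OF v cp] by simp
    then show "(F p v)\<^sup>2 = C * (v c \<bullet> (G c x *v v c))" by (simp only: C)
  qed
qed

end

theorem theorem3:
  fixes M :: "('a, 3) manifold"
    and F :: "'a \<Rightarrow> ('a, 3) tvec \<Rightarrow> real"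
    and D :: "('a, 3) connection"
  assumes "smooth_manifold M"
    and "connected_space (mtop M)"
    and "finsler_metric M F"
    and "\<not> is_riemannian M F"
    and "linear_connection M D"
    and "compatible M F D"
    and "flat M D"
    and "totally_antisymmetric_torsion M (averaged_metric M F) D"
  shows "(classical_berwald M F \<and>
            constant_sectional_curvature M (averaged_metric M F) 0) \<or>
         (proper_generalized_berwald M F \<and>
            (\<exists>\<kappa>>0. constant_sectional_curvature M (averaged_metric M F) \<kappa>))"
proof -
  \<comment> \<open>Compatibility is interpreted first because it supplies the metric condition on
    which \<open>alt_conn\<close> is built.\<close>
  interpret C: compat_conn M F D
    by unfold_locales (fact assms)+
  interpret alt_compat_conn M F D
    by unfold_locales (fact assms C.metric_gam_compat)+
  \<comment> \<open>An empty manifold would be Riemannian vacuously, so a point exists and its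
    \<kappa> is the constant of the theorem up to the factor 1/4.\<close>
  obtain p where p: "p \<in> topspace (mtop M)"
    using assms(4) unfolding is_riemannian_def by blast
  note const = kappa_constant[OF assms(2) p]
  show ?thesis
  proof (cases "\<kappa>p p = 0")
    case True
    then have "torsion_free M D" using const by (intro kappa_zero_torsion_free) simp
    then have "classical_berwald M F"
      unfolding classical_berwald_def using assms by blast
    then show ?thesis using constant_curvature[OF assms(2) p] True by simp
  next
    case False
    then have "\<not> classical_berwald M F"
      unfolding classical_berwald_def
      using torsion_free_compatible_imp_riemannian assms(4) const by metis
    then have "proper_generalized_berwald M F"
      unfolding proper_generalized_berwald_def generalized_berwald_def using assms by blast
    moreover have "\<kappa>p p / 4 > 0" using False kappa_nonneg[OF p] by simp
    ultimately show ?thesis using constant_curvature[OF assms(2) p] by blast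
  qed
qed

end
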